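(* Let $\Omega\subset\mathbb{R}^3$ be a (not necessarily bounded) domain with Lipschitz boundary and let $\beta:(0,\infty)\to\mathbb{R}$ be strongly convex. Let moreover $f$ be a distribution such that the equation $\operatorname{div} w=f$ admits a bounded continuous solution on $\Omega$. Then there exist $v\in L^\infty(\Omega;\mathbb{R}^3)$ and $\rho\in L^\infty(\Omega;\mathbb{R})$, with $\rho$ positive and bounded away from $0$, such that $$\operatorname{div}(\rho v)=0\ \text{ in }\Omega,\qquad \operatorname{div}(v)=0\ \text{ in }\Omega,\qquad v\cdot n=0\ \text{ on }\partial\Omega,$$ and $$\operatorname{div}(\beta(\rho)v)=f$$ are satisfied in the sense of distributions.
   Context: A function $\beta:(0,\infty)\to\mathbb{R}$ is called strongly convex if there exists $\kappa>0$ such that for all $x_1,x_2>0$ and $0\le\lambda\le1$, $$\beta(\lambda x_1+(1-\lambda)x_2)\le\lambda\beta(x_1)+(1-\lambda)\beta(x_2)-\kappa\lambda(1-\lambda)|x_1-x_2|^2.$$ Here $n$ is the normal to $\partial\Omega$. The space of solenoidal vector fields on $\Omega$ is $$H(\Omega)=\left\{v\in L^2(\Omega;\mathbb{R}^3):\int_\Omega v\cdot\nabla p\,dx=0\ \text{ for every } p\in W^{1,2}(\Omega)\right\}.$$ The problem is formulated in the sense of distributions as follows: $v\in H(\Omega)$ (this encodes $\operatorname{div}v=0$ in $\Omega$ together with $v\cdot n=0$ on $\partial\Omega$), and for every $\psi\in C_c^\infty(\Omega)$, $$\int_\Omega\rho v\cdot\nabla\psi\,dx=0\qquad\text{and}\qquad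 \int_\Omega\beta(\rho)v\cdot\nabla\psi\,dx+\int_\Omega f\psi\,dx=0,$$ where, if $f$ is merely a distribution, the last integral is understood as the action of $f$ on $\psi$.
   Formalization: If Ω has infinite measure, v ∈ H(Ω) (which forces v ∈ L²) can fail, e.g. Ω = R³, f = cos x₁; there div v = 0, v·n = 0 is stated as orthogonality to ∇p for all p ∈ W^{1,2}(Ω) of bounded support. For Ω of finite measure v ∈ H(Ω) is kept. *)

theory Defs
  imports "HOL-Analysis.Analysis"
begin

definition strongly_convex :: "(real \<Rightarrow> real) \<Rightarrow> bool" where
  "strongly_convex \<beta> \<longleftrightarrow> (\<exists>\<kappa>>0. \<forall>x1>0. \<forall>x2>0. \<forall>t. 0 \<le> t \<and> t \<le> 1 \<longrightarrow>
     \<beta> (t * x1 + (1 - t) * x2) \<le> t * \<beta> x1 + (1 - t) * \<beta> x2 - \<kappa> * t * (1 - t) * \<bar>x1 - x2\<bar>\<^sup>2)"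

text \<open>Near each boundary point the set is, after a rigid change of coordinates, the region strictly
  above the graph of a Lipschitz function. The condition is local: neither the radius nor the
  Lipschitz constant is required to be uniform along an unbounded boundary.\<close>

definition lipschitz_boundary :: "(real^3) set \<Rightarrow> bool" where
  "lipschitz_boundary \<Omega> \<longleftrightarrow> (\<forall>x0\<in>frontier \<Omega>. \<exists>r>0. \<exists>T :: real^3 \<Rightarrow> real^3. \<exists>\<gamma> :: real^2 \<Rightarrow> real. \<exists>L.
     orthogonal_transformation T \<and> L-lipschitz_on UNIV \<gamma> \<and>
     \<Omega> \<inter> ball x0 r = {x \<in> ball x0 r. \<gamma> (vector [T x $ 1, T x $ 2]) < T x $ 3})"

definition lipschitz_domain :: "(real^3) set \<Rightarrow> bool" where
  "lipschitz_domain \<Omega> \<longleftrightarrow> open \<Omega> \<and> connected \<Omega> \<and> \<Omega> \<noteq> {} \<and> lipschitz_boundary \<Omega>"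

definition partial_deriv :: "3 \<Rightarrow> (real^3 \<Rightarrow> real) \<Rightarrow> real^3 \<Rightarrow> real" where
  "partial_deriv i \<psi> x = frechet_derivative \<psi> (at x) (axis i 1)"

definition grad :: "(real^3 \<Rightarrow> real) \<Rightarrow> real^3 \<Rightarrow> real^3" where
  "grad \<psi> x = (\<chi> i. partial_deriv i \<psi> x)"

text \<open>A list of coordinates encodes an iterated partial derivative.\<close>

definition iter_partial :: "3 list \<Rightarrow> (real^3 \<Rightarrow> real) \<Rightarrow> real^3 \<Rightarrow> real" where
  "iter_partial is \<psi> = foldr partial_deriv is \<psi>"

definition smooth :: "(real^3 \<Rightarrow> real) \<Rightarrow> bool" where
  "smooth \<psi> \<longleftrightarrow> (\<forall>is. \<forall>x. iter_partial is \<psi> differentiable (at x))"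

definition supp :: "(real^3 \<Rightarrow> real) \<Rightarrow> (real^3) set" where
  "supp \<psi> = closure {x. \<psi> x \<noteq> 0}"

text \<open>The space \<open>C\<^sub>c\<^sup>\<infinity>(\<Omega>)\<close>; its elements are extended by zero to the whole space.\<close>

definition test_functions :: "(real^3) set \<Rightarrow> (real^3 \<Rightarrow> real) set" where
  "test_functions \<Omega> = {\<psi>. smooth \<psi> \<and> compact (supp \<psi>) \<and> supp \<psi> \<subseteq> \<Omega>}"

text \<open>Continuity is expressed by the usual seminorm estimates: on every compact \<open>K\<close> the functional is
  bounded by a multiple of the maximum of finitely many sup-norms of derivatives. Only the
  values of \<open>f\<close> on test functions matter.\<close>

definition distribution :: "(real^3) set \<Rightarrow> ((real^3 \<Rightarrow> real) \<Rightarrow> real) \<Rightarrow> bool" where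
  "distribution \<Omega> f \<longleftrightarrow>
     (\<forall>\<phi>\<in>test_functions \<Omega>. \<forall>\<psi>\<in>test_functions \<Omega>. f (\<lambda>x. \<phi> x + \<psi> x) = f \<phi> + f \<psi>) \<and>
     (\<forall>c. \<forall>\<psi>\<in>test_functions \<Omega>. f (\<lambda>x. c * \<psi> x) = c * f \<psi>) \<and>
     (\<forall>K. compact K \<and> K \<subseteq> \<Omega> \<longrightarrow> (\<exists>C N. \<forall>\<psi>\<in>test_functions \<Omega>. supp \<psi> \<subseteq> K \<longrightarrow>
        (\<forall>M. (\<forall>is x. length is \<le> N \<longrightarrow> \<bar>iter_partial is \<psi> x\<bar> \<le> M) \<longrightarrow> \<bar>f \<psi>\<bar> \<le> C * M)))"

text \<open>The equation \<open>div u = f\<close> in the sense of distributions on \<open>\<Omega>\<close>.\<close>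

definition div_eq :: "(real^3) set \<Rightarrow> (real^3 \<Rightarrow> real^3) \<Rightarrow> ((real^3 \<Rightarrow> real) \<Rightarrow> real) \<Rightarrow> bool" where
  "div_eq \<Omega> u f \<longleftrightarrow>
     (\<forall>\<psi>\<in>test_functions \<Omega>. integral\<^sup>L (lebesgue_on \<Omega>) (\<lambda>x. u x \<bullet> grad \<psi> x) + f \<psi> = 0)"

definition L_infinity :: "(real^3) set \<Rightarrow> (real^3 \<Rightarrow> 'b::euclidean_space) set" where
  "L_infinity \<Omega> = {u. u \<in> borel_measurable (lebesgue_on \<Omega>) \<and>
     (\<exists>C. AE x in lebesgue_on \<Omega>. norm (u x) \<le> C)}"

definition L_two :: "(real^3) set \<Rightarrow> (real^3 \<Rightarrow> 'b::euclidean_space) set" where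
  "L_two \<Omega> = {u. u \<in> borel_measurable (lebesgue_on \<Omega>) \<and>
     integrable (lebesgue_on \<Omega>) (\<lambda>x. (norm (u x))\<^sup>2)}"

definition weak_grad :: "(real^3) set \<Rightarrow> (real^3 \<Rightarrow> real) \<Rightarrow> (real^3 \<Rightarrow> real^3) \<Rightarrow> bool" where
  "weak_grad \<Omega> p g \<longleftrightarrow> (\<forall>\<psi>\<in>test_functions \<Omega>. \<forall>i.
     integral\<^sup>L (lebesgue_on \<Omega>) (\<lambda>x. p x * partial_deriv i \<psi> x) =
     - integral\<^sup>L (lebesgue_on \<Omega>) (\<lambda>x. g x $ i * \<psi> x))"

text \<open>The graph of the weak gradient on \<open>W\<^sup>1\<^sup>,\<^sup>2(\<Omega>)\<close>: pairs of a Sobolev function and its gradient.\<close>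

definition W12_grad :: "(real^3) set \<Rightarrow> ((real^3 \<Rightarrow> real) \<times> (real^3 \<Rightarrow> real^3)) set" where
  "W12_grad \<Omega> = {(p, g). p \<in> L_two \<Omega> \<and> g \<in> L_two \<Omega> \<and> weak_grad \<Omega> p g}"

definition H_space :: "(real^3) set \<Rightarrow> (real^3 \<Rightarrow> real^3) set" where
  "H_space \<Omega> = {v \<in> L_two \<Omega>. \<forall>(p, g)\<in>W12_grad \<Omega>.
     integral\<^sup>L (lebesgue_on \<Omega>) (\<lambda>x. v x \<bullet> g x) = 0}"

text \<open>The weak form of \<open>div v = 0\<close> in \<open>\<Omega>\<close>, \<open>v \<sqdot> n = 0\<close> on the boundary for a bounded field that need
  not be square integrable: the orthogonality defining \<open>H(\<Omega>)\<close>, tested with Sobolev functions of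
  bounded support, for which the integral converges. On a bounded set (and on any set of
  finite measure) a bounded field satisfies it if and only if it lies in \<open>H(\<Omega>)\<close>.\<close>

definition solenoidal_tangential :: "(real^3) set \<Rightarrow> (real^3 \<Rightarrow> real^3) \<Rightarrow> bool" where
  "solenoidal_tangential \<Omega> v \<longleftrightarrow> (\<forall>(p, g)\<in>W12_grad \<Omega>. bounded {x \<in> \<Omega>. p x \<noteq> 0} \<longrightarrow>
     integral\<^sup>L (lebesgue_on \<Omega>) (\<lambda>x. v x \<bullet> g x) = 0)"

end

theory Submission
  imports Defs
begin

text \<open>
  Since \<open>\<beta>\<close> is strictly convex, the vectors \<open>(1, 1, 1)\<close>, \<open>(1, 2, 3)\<close>, \<open>(\<beta> 1, \<beta> 2, \<beta> 3)\<close> are linearly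
  independent. It therefore suffices to find three bounded fields \<open>u\<^sub>1, u\<^sub>2, u\<^sub>3\<close> with pairwise disjoint
  supports such that every \<open>u\<^sub>i - w\<close> is orthogonal to gradients: put \<open>v = \<tau> (u\<^sub>1 - 2 u\<^sub>2 + u\<^sub>3)\<close> with
  \<open>\<tau> = 1 / (\<beta> 1 - 2 \<beta> 2 + \<beta> 3)\<close> and \<open>\<rho> = i\<close> on the support of \<open>u\<^sub>i\<close>.

  The fields are the rows of a limit of \<open>3 \<times> 3\<close> matrix fields produced by convex integration from the
  start \<open>(w, w, w)\<close>. The relaxed constraint is that the sum of the moduli of the nine entries is less
  than \<open>M\<close>; its extreme points have exactly one nonzero entry. Moving mass between two entries is
  done by localized plane waves \<open>\<partial>\<^sub>l A e\<^sub>j - \<partial>\<^sub>j A e\<^sub>l\<close> with \<open>A\<close> oscillating in the direction \<open>e\<^sub>l\<close>, where \<open>l\<close>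
  differs from the column indices of both entries. Each stage increases the weighted \<open>L\<^sup>2\<close> norm by a
  multiple of the squared deficit \<open>M\<^sup>2 - |z|\<^sup>2\<close>, so that the deficit tends to zero; as the stages are
  almost orthogonal, they converge almost everywhere.
\<close>

section \<open>Smooth functions of one variable\<close>

text \<open>The target is recognised by its norm alone: \<open>norm z \<le> l1 z\<close>, with
  equality only for matrices with at most one nonzero entry. A limit with \<open>l1 \<le> M\<close>
  and \<open>norm = M\<close> almost everywhere therefore has rows with disjoint supports, although
  no stage need have them. Since \<open>l1\<close> is built from the entries, oscillations along the
  coordinate axes suffice, and every potential can be a product of functions of one variable.

  All perturbations have compact support in \<Omega>. They are orthogonal to all Sobolev gradients
  without any boundary term, so the divergence and the boundary condition are treated at once. The
  distribution \<open>f\<close> enters only through \<open>w\<close>: combinations of rows whose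
  coefficients sum to 0 cancel \<open>w\<close>, those summing to 1 reproduce it.

  The obstacle is that \<Omega> may have infinite measure. A weight makes the norms of bounded
  fields finite, but the unweighted integral of a bounded field against a square integrable gradient
  need not converge. Hence orthogonality is carried along with a cutoff inside the integral, and the
  cutoff is removed only at the end.\<close>

text \<open>Asking only for the existence of a derivative lets each closure rule supply an explicit
  formula; \<open>smooth1_deriv\<close> later identifies the witness with
  \<open>deriv\<close>.\<close>

primrec kdiff :: "nat \<Rightarrow> (real \<Rightarrow> real) \<Rightarrow> bool" where
  "kdiff 0 f = True"
| "kdiff (Suc n) f = (\<exists>f'. (\<forall>x. (f has_real_derivative f' x) (at x)) \<and> kdiff n f')"

definition smooth1 :: "(real \<Rightarrow> real) \<Rightarrow> bool" where
  "smooth1 f \<longleftrightarrow> (\<forall>n. kdiff n f)"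

lemma kdiff_SucD: "kdiff (Suc n) f \<Longrightarrow> kdiff n f"
proof (induction n arbitrary: f)
  case (Suc n)
  from Suc.prems obtain f' where "\<forall>x. (f has_real_derivative f' x) (at x)" "kdiff (Suc n) f'"
    unfolding kdiff.simps(2)[of "Suc n"] by blast
  with Suc.IH show ?case unfolding kdiff.simps(2)[of n f] by blast
qed simp

lemma kdiff_SucI:
  "(\<And>x. (f has_real_derivative f' x) (at x)) \<Longrightarrow> kdiff n f' \<Longrightarrow> kdiff (Suc n) f"
  by auto

lemma kdiff_const: "kdiff n (\<lambda>x. c)"
proof (induction n arbitrary: c)
  case (Suc n)
  show ?case using Suc[of 0] by (auto intro!: exI[of _ "\<lambda>x. 0"])
qed simp

lemma kdiff_add: "kdiff n f \<Longrightarrow> kdiff n g \<Longrightarrow> kdiff n (\<lambda>x. f x + g x)"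
proof (induction n arbitrary: f g)
  case (Suc n)
  then obtain f' g' where "\<forall>x. (f has_real_derivative f' x) (at x)" "kdiff n f'"
      "\<forall>x. (g has_real_derivative g' x) (at x)" "kdiff n g'" by auto
  with Suc.IH show ?case
    by (auto intro!: exI[of _ "\<lambda>x. f' x + g' x"] derivative_eq_intros)
qed simp

lemma kdiff_mult: "kdiff n f \<Longrightarrow> kdiff n g \<Longrightarrow> kdiff n (\<lambda>x. f x * g x)"
proof (induction n arbitrary: f g)
  case (Suc n)
  then obtain f' g' where d: "\<forall>x. (f has_real_derivative f' x) (at x)" "kdiff n f'"
      "\<forall>x. (g has_real_derivative g' x) (at x)" "kdiff n g'" by auto
  have "kdiff n (\<lambda>x. f' x * g x + f x * g' x)"
    using kdiff_add Suc.IH Suc.prems[THEN kdiff_SucD] d by auto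
  with d show ?case
    by (auto intro!: exI[of _ "\<lambda>x. f' x * g x + f x * g' x"] derivative_eq_intros)
qed simp

lemma kdiff_inverse: "kdiff n f \<Longrightarrow> (\<And>x. f x \<noteq> 0) \<Longrightarrow> kdiff n (\<lambda>x. inverse (f x))"
proof (induction n arbitrary: f)
  case (Suc n)
  then obtain f' where d: "\<forall>x. (f has_real_derivative f' x) (at x)" "kdiff n f'" by auto
  have i: "kdiff n (\<lambda>x. inverse (f x))" using Suc kdiff_SucD by blast
  have "kdiff n (\<lambda>x. ((-1) * f' x) * (inverse (f x) * inverse (f x)))"
    by (intro kdiff_mult d i kdiff_const)
  with d Suc.prems show ?case
    by (intro kdiff.simps(2)[THEN iffD2] exI[of _ "\<lambda>x. ((-1) * f' x) * (inverse (f x) * inverse (f x))"])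
       (auto intro!: derivative_eq_intros simp: power2_eq_square)
qed simp

lemma kdiff_affine: "kdiff n f \<Longrightarrow> kdiff n (\<lambda>x. f (c * x + d))"
proof (induction n arbitrary: f)
  case (Suc n)
  from Suc.prems obtain f' where d: "\<And>x. (f has_real_derivative f' x) (at x)" "kdiff n f'"
    unfolding kdiff.simps(2) by blast
  have k: "kdiff n (\<lambda>x. f' (c * x + d) * c)"
    by (rule kdiff_mult[OF Suc.IH[OF d(2)] kdiff_const])
  have "((\<lambda>x. f (c * x + d)) has_real_derivative f' (c * x + d) * c) (at x)" for x
    by (rule DERIV_chain2[OF d(1)]) (auto intro!: derivative_eq_intros)
  then show ?case by (rule kdiff_SucI) (rule k)
qed simp

text \<open>Sine and cosine are treated together because differentiation interchanges them, which
  closes the induction.\<close>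

lemma kdiff_sin_cos: "kdiff n (\<lambda>x. a * sin (N * x) + b * cos (N * x))"
proof (induction n arbitrary: a b)
  case (Suc n)
  have "((\<lambda>x. a * sin (N * x) + b * cos (N * x)) has_real_derivative
      (- (b * N)) * sin (N * x) + (a * N) * cos (N * x)) (at x)" for x
    by (auto intro!: derivative_eq_intros)
  then show ?case by (rule kdiff_SucI) (rule Suc)
qed simp

lemma smooth1_const [simp]: "smooth1 (\<lambda>x. c)"
  by (simp add: smooth1_def kdiff_const)

lemma smooth1_add: "smooth1 f \<Longrightarrow> smooth1 g \<Longrightarrow> smooth1 (\<lambda>x. f x + g x)"
  by (simp add: smooth1_def kdiff_add)

lemma smooth1_mult: "smooth1 f \<Longrightarrow> smooth1 g \<Longrightarrow> smooth1 (\<lambda>x. f x * g x)"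
  by (simp add: smooth1_def kdiff_mult)

lemma smooth1_inverse: "smooth1 f \<Longrightarrow> (\<And>x. f x \<noteq> 0) \<Longrightarrow> smooth1 (\<lambda>x. inverse (f x))"
  by (simp add: smooth1_def kdiff_inverse)

lemma smooth1_affine: "smooth1 f \<Longrightarrow> smooth1 (\<lambda>x. f (c * x + d))"
  by (simp add: smooth1_def kdiff_affine)

lemma smooth1_sin: "smooth1 (\<lambda>x. sin (N * x))"
  using kdiff_sin_cos[of _ 1 N 0] by (auto simp: smooth1_def)

lemma smooth1_deriv:
  assumes "smooth1 f"
  shows "(f has_real_derivative deriv f x) (at x)" "smooth1 (deriv f)"
proof -
  have *: "(\<forall>x. (f has_real_derivative deriv f x) (at x)) \<and> kdiff n (deriv f)" for n
  proof -
    from assms have "kdiff (Suc n) f" by (simp add: smooth1_def)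
    then obtain f' where f': "\<forall>x. (f has_real_derivative f' x) (at x)" "kdiff n f'" by auto
    then have "f' = deriv f" by (intro ext) (metis DERIV_imp_deriv)
    with f' show ?thesis by simp
  qed
  then show "(f has_real_derivative deriv f x) (at x)" "smooth1 (deriv f)"
    by (auto simp: smooth1_def)
qed

text \<open>\<open>flat 0\<close> is the classical function \<open>exp (- 1 / x)\<close> continued
  by zero. The powers of \<open>1 / x\<close> are the factors produced by differentiation; the
  family is closed under it up to linear combinations, so smoothness follows by one induction for
  all \<open>m\<close>.\<close>

definition flat :: "nat \<Rightarrow> real \<Rightarrow> real" where
  "flat m x = (if x > 0 then (1 / x) ^ m * exp (- (1 / x)) else 0)"

lemma flat_has_derivative:
  "(flat m has_real_derivative (- real m) * flat (m + 1) x + flat (m + 2) x) (at x)"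
proof -
  consider "x > 0" | "x < 0" | "x = 0" by linarith
  then show ?thesis
  proof cases
    case 1
    have i: "((\<lambda>x. 1 / x) has_real_derivative - ((1 / x)\<^sup>2)) (at x)"
      using 1 by (auto intro!: derivative_eq_intros simp: field_simps power2_eq_square)
    have p: "((\<lambda>x. (1 / x) ^ m) has_real_derivative - real m * (1 / x) ^ (m + 1)) (at x)"
      by (rule DERIV_cong[OF DERIV_power[OF i]]) (cases m; simp add: power2_eq_square algebra_simps add_divide_distrib diff_divide_distrib)
    have e: "((\<lambda>x. exp (- (1 / x))) has_real_derivative exp (- (1 / x)) * (1 / x)\<^sup>2) (at x)"
      by (rule DERIV_cong[OF DERIV_fun_exp[OF DERIV_minus[OF i]]]) simp
    have "((\<lambda>x. (1 / x) ^ m * exp (- (1 / x))) has_real_derivative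
        (- real m) * flat (m + 1) x + flat (m + 2) x) (at x)"
      by (rule DERIV_cong[OF DERIV_mult[OF p e]]) (use 1 in \<open>simp add: flat_def power_add power2_eq_square algebra_simps\<close>)
    then show ?thesis
      by (rule DERIV_cong_ev[THEN iffD1, rotated 3])
        (use 1 in \<open>auto simp: flat_def intro!: eventually_mono[OF eventually_nhds_in_open[of "{0<..}"]]\<close>)
  next
    case 2
    have "((\<lambda>x. 0) has_real_derivative (- real m) * flat (m + 1) x + flat (m + 2) x) (at x)"
      using 2 by (simp add: flat_def)
    then show ?thesis
      by (rule DERIV_cong_ev[THEN iffD1, rotated 3])
        (use 2 in \<open>auto simp: flat_def intro!: eventually_mono[OF eventually_nhds_in_open[of "{..<0}"]]\<close>)
  next
    case 3
    \<comment> \<open>With \<open>t = 1 / h\<close> this is the right difference quotient of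
      \<open>flat m\<close> at 0.\<close>
    have "((\<lambda>t::real. t ^ (m + 1) / exp t) \<longlongrightarrow> 0) at_top"
      by (rule tendsto_power_div_exp_0)
    then have "((\<lambda>h::real. (inverse h) ^ (m + 1) / exp (inverse h)) \<longlongrightarrow> 0) (at_right 0)"
      by (rule filterlim_compose[OF _ filterlim_inverse_at_top_right])
    then have r: "((\<lambda>h. (flat m (0 + h) - flat m 0) / h) \<longlongrightarrow> 0) (at_right 0)"
      by (rule Lim_transform_eventually)
        (auto simp: flat_def eventually_at_filter exp_minus field_simps)
    have l: "((\<lambda>h. (flat m (0 + h) - flat m 0) / h) \<longlongrightarrow> 0) (at_left 0)"
      by (rule Lim_transform_eventually[of "\<lambda>_. 0"]) (auto simp: flat_def eventually_at_filter)
    from l r have "((\<lambda>h. (flat m (0 + h) - flat m 0) / h) \<longlongrightarrow> 0) (at 0)"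
      by (simp add: filterlim_split_at)
    then show ?thesis using 3 by (simp add: DERIV_def flat_def)
  qed
qed

lemma smooth1_flat: "smooth1 (flat m)"
proof -
  have "kdiff n (flat m)" for n
  proof (induction n arbitrary: m)
    case (Suc n)
    have "kdiff n (\<lambda>x. (- real m) * flat (m + 1) x + flat (m + 2) x)"
      by (intro kdiff_add kdiff_mult kdiff_const Suc)
    with flat_has_derivative show ?case by (rule kdiff_SucI)
  qed simp
  then show ?thesis by (simp add: smooth1_def)
qed

text \<open>The standard quotient that is 1 up to 1 and 0 from 2 on, times its mirror image. The
  denominators are positive because \<open>2 - x\<close> and \<open>x - 1\<close> are never both
  nonpositive.\<close>

definition plateau :: "real \<Rightarrow> real" where
  "plateau x = flat 0 (2 - x) * inverse (flat 0 (2 - x) + flat 0 (x - 1)) *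
     (flat 0 (2 + x) * inverse (flat 0 (2 + x) + flat 0 (- x - 1)))"

lemma smooth1_plateau: "smooth1 plateau"
proof -
  have p: "flat 0 (2 - x) + flat 0 (x - 1) \<noteq> 0" "flat 0 (2 + x) + flat 0 (- x - 1) \<noteq> 0" for x
    by (auto simp: flat_def add_nonneg_eq_0_iff)
  have "smooth1 (\<lambda>x. flat 0 (2 - x))" "smooth1 (\<lambda>x. flat 0 (x - 1))"
       "smooth1 (\<lambda>x. flat 0 (2 + x))" "smooth1 (\<lambda>x. flat 0 (- x - 1))"
    using smooth1_affine[OF smooth1_flat[of 0], of "-1" 2] smooth1_affine[OF smooth1_flat[of 0], of 1 "-1"]
      smooth1_affine[OF smooth1_flat[of 0], of 1 2] smooth1_affine[OF smooth1_flat[of 0], of "-1" "-1"]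
    by (simp_all add: algebra_simps)
  then have "smooth1 (\<lambda>x. plateau x)" unfolding plateau_def
    by (intro smooth1_mult smooth1_inverse smooth1_add p)
  then show ?thesis by simp
qed

lemma plateau_eq_1: "plateau x = 1" if "\<bar>x\<bar> \<le> 1"
proof -
  from that have "flat 0 (x - 1) = 0" "flat 0 (- x - 1) = 0" "flat 0 (2 - x) \<noteq> 0" "flat 0 (2 + x) \<noteq> 0"
    by (simp_all add: flat_def)
  then show ?thesis by (simp add: plateau_def)
qed

lemma plateau_eq_0: "plateau x = 0" if "2 \<le> \<bar>x\<bar>"
proof -
  from that have "flat 0 (2 - x) = 0 \<or> flat 0 (2 + x) = 0"
    unfolding flat_def by (cases "x \<ge> 0") simp_all
  then show ?thesis by (auto simp: plateau_def)
qed

lemma plateau_bounds: "0 \<le> plateau x" "plateau x \<le> 1"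
proof -
  have n: "0 \<le> flat 0 y" for y by (simp add: flat_def)
  have b: "0 \<le> flat 0 y * inverse (flat 0 y + flat 0 y')"
    "flat 0 y * inverse (flat 0 y + flat 0 y') \<le> 1" for y y'
    using n[of y] n[of y'] divide_le_eq_1[of "flat 0 y" "flat 0 y + flat 0 y'"]
    by (auto simp: divide_inverse)
  show "0 \<le> plateau x" unfolding plateau_def by (intro mult_nonneg_nonneg[OF b(1) b(1)])
  show "plateau x \<le> 1" unfolding plateau_def by (intro mult_le_one b)
qed

section \<open>Products of one-variable functions as test functions\<close>

text \<open>Pure tensors: the partial derivative in direction \<open>l\<close> only replaces the
  factor \<open>a l\<close> by its derivative. Partial derivatives thus become function updates, and
  mixed ones commute because updates at distinct indices do.\<close>

definition prodfn :: "(3 \<Rightarrow> real \<Rightarrow> real) \<Rightarrow> real^3 \<Rightarrow> real" where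
  "prodfn a x = (\<Prod>i\<in>UNIV. a i (x $ i))"

lemma prodfn_has_derivative:
  assumes "\<And>i. smooth1 (a i)"
  shows "(prodfn a has_derivative (\<lambda>h. \<Sum>i\<in>UNIV. h $ i * prodfn (a(i := deriv (a i))) x)) (at x)"
proof -
  have "((\<lambda>x. a i (x $ i)) has_derivative (\<lambda>h. h $ i * deriv (a i) (x $ i))) (at x)" for i
    by (rule has_derivative_compose[OF _ smooth1_deriv(1)[OF assms, unfolded has_field_derivative_def],
          THEN has_derivative_eq_rhs])
       (auto intro!: bounded_linear_imp_has_derivative bounded_linear_vec_nth)
  then have "((\<lambda>x. \<Prod>i\<in>UNIV. a i (x $ i)) has_derivative
      (\<lambda>h. \<Sum>i\<in>UNIV. (h $ i * deriv (a i) (x $ i)) * (\<Prod>j\<in>UNIV - {i}. a j (x $ j)))) (at x)"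
    by (rule has_derivative_prod)
  moreover have "deriv (a i) (x $ i) * (\<Prod>j\<in>UNIV - {i}. a j (x $ j)) = prodfn (a(i := deriv (a i))) x" for i
    unfolding prodfn_def by (subst (2) prod.remove[of _ i]) auto
  ultimately show ?thesis
    by (simp add: prodfn_def[abs_def] mult.assoc)
qed

lemma prodfn_differentiable: "(\<And>i. smooth1 (a i)) \<Longrightarrow> prodfn a differentiable (at x)"
  using prodfn_has_derivative differentiable_def by blast

lemma prodfn_continuous: "(\<And>i. smooth1 (a i)) \<Longrightarrow> continuous_on UNIV (prodfn a)"
  by (simp add: prodfn_differentiable differentiable_imp_continuous_on differentiable_on_def)

lemma partial_deriv_prodfn:
  assumes "\<And>i. smooth1 (a i)"
  shows "partial_deriv l (prodfn a) = prodfn (a(l := deriv (a l)))"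
proof
  fix x
  have "partial_deriv l (prodfn a) x = (\<Sum>i\<in>UNIV. axis l 1 $ i * prodfn (a(i := deriv (a i))) x)"
    unfolding partial_deriv_def
    by (subst frechet_derivative_at[OF prodfn_has_derivative[of a x], OF assms, symmetric]) simp
  also have "\<dots> = (\<Sum>i\<in>UNIV. if i = l then prodfn (a(i := deriv (a i))) x else 0)"
    by (rule sum.cong) (auto simp: axis_def)
  finally show "partial_deriv l (prodfn a) x = prodfn (a(l := deriv (a l))) x" by simp
qed

text \<open>Every iterated partial derivative is again a product of smooth factors, hence
  differentiable.\<close>

lemma smooth_prodfn:
  assumes "\<And>i. smooth1 (a i)"
  shows "smooth (prodfn a)"
proof -
  have "\<exists>a'. (\<forall>i. smooth1 (a' i)) \<and> iter_partial is (prodfn a) = prodfn a'" for "is"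
  proof (induction "is")
    case Nil
    show ?case using assms by (auto simp: iter_partial_def)
  next
    case (Cons l "is")
    then obtain a' where a': "\<And>i. smooth1 (a' i)" "iter_partial is (prodfn a) = prodfn a'" by auto
    then have "iter_partial (l # is) (prodfn a) = prodfn (a'(l := deriv (a' l)))"
      by (simp add: iter_partial_def partial_deriv_prodfn)
    moreover have "\<forall>i. smooth1 ((a'(l := deriv (a' l))) i)" using a' smooth1_deriv by auto
    ultimately show ?case by blast
  qed
  then show ?thesis unfolding smooth_def using prodfn_differentiable by metis
qed

lemma prodfn_mult: "prodfn a x * prodfn b x = prodfn (\<lambda>i t. a i t * b i t) x"
  by (simp add: prodfn_def prod.distrib)

section \<open>Test functions: supports, integrals and Sobolev gradients\<close>

lemma supp_subset: "compact K \<Longrightarrow> (\<And>x. x \<notin> K \<Longrightarrow> \<psi> x = 0) \<Longrightarrow> supp \<psi> \<subseteq> K"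
  unfolding supp_def by (intro closure_minimal compact_imp_closed) auto

lemma test_functionsI:
  assumes "smooth \<psi>" "compact K" "K \<subseteq> \<Omega>" "\<And>x. x \<notin> K \<Longrightarrow> \<psi> x = 0"
  shows "\<psi> \<in> test_functions \<Omega>"
proof -
  have "supp \<psi> \<subseteq> K" by (rule supp_subset) (use assms in auto)
  moreover from this have "compact (supp \<psi>)"
    using assms(2) by (metis closed_Int_compact closed_closure inf.absorb1 supp_def)
  ultimately show ?thesis using assms(1,3) by (auto simp: test_functions_def)
qed

lemma partial_deriv_zero:
  assumes "open U" "\<And>y. y \<in> U \<Longrightarrow> \<psi> y = 0" "x \<in> U"
  shows "partial_deriv i \<psi> x = 0"
proof -
  have "(\<psi> has_derivative (\<lambda>h. 0)) (at x)"
    by (rule has_derivative_transform_within_open[of "\<lambda>x. 0" _ _ _ U]) (use assms in auto)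
  then show ?thesis unfolding partial_deriv_def by (metis frechet_derivative_at)
qed

lemma test_functionsE:
  assumes "\<psi> \<in> test_functions \<Omega>"
  obtains K where "compact K" "K \<subseteq> \<Omega>" "\<And>x. x \<notin> K \<Longrightarrow> \<psi> x = 0"
    "\<And>x i. x \<notin> K \<Longrightarrow> partial_deriv i \<psi> x = 0"
proof
  show K: "compact (supp \<psi>)" "supp \<psi> \<subseteq> \<Omega>" using assms by (auto simp: test_functions_def)
  show z: "\<psi> x = 0" if "x \<notin> supp \<psi>" for x
    using that closure_subset[of "{x. \<psi> x \<noteq> 0}"] by (auto simp: supp_def)
  show "partial_deriv i \<psi> x = 0" if "x \<notin> supp \<psi>" for x i
    by (rule partial_deriv_zero[of "- supp \<psi>"]) (use K z that compact_imp_closed in auto)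
qed

lemma test_functions_diff:
  assumes "\<psi> \<in> test_functions \<Omega>"
  shows "\<psi> differentiable (at x)" "partial_deriv i \<psi> differentiable (at x)"
    "continuous_on UNIV \<psi>" "continuous_on UNIV (partial_deriv i \<psi>)"
proof -
  have s: "iter_partial is \<psi> differentiable (at x)" for "is" x
    using assms by (simp add: test_functions_def smooth_def)
  from s[of "[]"] s[of "[i]"]
  have d: "\<psi> differentiable (at x)" "partial_deriv i \<psi> differentiable (at x)" for x
    by (simp_all add: iter_partial_def)
  then show "\<psi> differentiable (at x)" "partial_deriv i \<psi> differentiable (at x)" by auto
  show "continuous_on UNIV \<psi>" "continuous_on UNIV (partial_deriv i \<psi>)"
    using d by (simp_all add: differentiable_imp_continuous_on differentiable_on_def)
qed

lemma continuous_on_grad: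
  assumes "\<psi> \<in> test_functions \<Omega>"
  shows "continuous_on UNIV (grad \<psi>)"
  unfolding grad_def[abs_def] by (intro continuous_intros test_functions_diff(4)[OF assms])

lemma integrable_compact_support:
  fixes f :: "real^3 \<Rightarrow> 'b::{banach, second_countable_topology}"
  assumes "continuous_on UNIV f" "compact K" "\<And>x. x \<notin> K \<Longrightarrow> f x = 0"
  shows "integrable lborel f" "integrable lebesgue f"
    "\<Omega> \<in> sets lebesgue \<Longrightarrow> integrable (lebesgue_on \<Omega>) f"
proof -
  have "integrable lborel (\<lambda>x. indicator K x *\<^sub>R f x)"
    by (rule borel_integrable_compact) (use assms(2) continuous_on_subset[OF assms(1)] in auto)
  also have "(\<lambda>x. indicator K x *\<^sub>R f x) = f"
    using assms(3) by (auto simp: indicator_def)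
  finally show i: "integrable lborel f" .
  then show l: "integrable lebesgue f" 
    by (subst integrable_completion) (auto dest: borel_measurable_integrable)
  show "integrable (lebesgue_on \<Omega>) f" if "\<Omega> \<in> sets lebesgue"
    using that l by (simp add: integrable_restrict_space integrable_mult_indicator)
qed

lemma integral_lebesgue_on_eq_lborel:
  fixes f :: "real^3 \<Rightarrow> 'b::{banach, second_countable_topology}"
  assumes "continuous_on UNIV f" "\<Omega> \<in> sets lebesgue" "\<And>x. x \<notin> \<Omega> \<Longrightarrow> f x = 0"
  shows "integral\<^sup>L (lebesgue_on \<Omega>) f = integral\<^sup>L lborel f"
proof -
  have "integral\<^sup>L (lebesgue_on \<Omega>) f = integral\<^sup>L lebesgue (\<lambda>x. indicator \<Omega> x *\<^sub>R f x)"
    using assms(2) by (simp add: integral_restrict_space)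
  also have "(\<lambda>x. indicator \<Omega> x *\<^sub>R f x) = f"
    using assms(3) by (auto simp: indicator_def)
  also have "integral\<^sup>L lebesgue f = integral\<^sup>L lborel f"
    by (rule integral_completion) (use assms(1) borel_measurable_continuous_onI in auto)
  finally show ?thesis .
qed

lemma integral_lborel_translate:
  fixes f :: "real^3 \<Rightarrow> real"
  assumes "continuous_on UNIV f"
  shows "integral\<^sup>L lborel (\<lambda>x. f (v + x)) = integral\<^sup>L lborel f"
proof -
  have m: "f \<in> borel_measurable borel" by (rule borel_measurable_continuous_onI[OF assms])
  have "integral\<^sup>L lborel f = integral\<^sup>L (distr lborel borel ((+) v)) f"
    by (simp only: lborel_distr_plus)
  also have "\<dots> = integral\<^sup>L lborel (\<lambda>x. f (v + x))"
    by (subst integral_distr) (use m in auto)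
  finally show ?thesis by simp
qed

text \<open>The difference quotients of a compactly supported function have integral zero.\<close>

lemma integral_partial_deriv_eq_0:
  assumes d: "\<And>x. F differentiable (at x)" and c: "continuous_on UNIV (partial_deriv i F)"
    and K: "compact K" "\<And>x. x \<notin> K \<Longrightarrow> F x = 0" "\<And>x. x \<notin> K \<Longrightarrow> partial_deriv i F x = 0"
  shows "integral\<^sup>L lborel (partial_deriv i F) = 0"
proof -
  define e :: "real^3" where "e = axis i 1"
  define h where "h n = inverse (real (Suc n))" for n
  have h: "0 < h n" "h n \<le> 1" for n by (auto simp: h_def field_simps)
  have h0: "h \<longlonglongrightarrow> 0" unfolding h_def by (rule LIMSEQ_inverse_real_of_nat)
  have cF: "continuous_on UNIV F"
    using d by (simp add: differentiable_imp_continuous_on differentiable_on_def)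
  have dir: "((\<lambda>t. F (x + t *\<^sub>R e)) has_real_derivative partial_deriv i F (x + t *\<^sub>R e)) (at t)" for x t
  proof -
    have "(F has_derivative frechet_derivative F (at (x + t *\<^sub>R e))) (at (x + t *\<^sub>R e))"
      using d by (simp add: frechet_derivative_works)
    moreover have "((\<lambda>t. x + t *\<^sub>R e) has_derivative (\<lambda>s. s *\<^sub>R e)) (at t)"
      by (auto intro!: derivative_eq_intros)
    ultimately have D: "((\<lambda>t. F (x + t *\<^sub>R e)) has_derivative
        (\<lambda>s. frechet_derivative F (at (x + t *\<^sub>R e)) (s *\<^sub>R e))) (at t)"
      using has_derivative_compose by blast
    have "linear (frechet_derivative F (at (x + t *\<^sub>R e)))"
      using d linear_frechet_derivative by blast
    then show ?thesis unfolding has_field_derivative_def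
      by (intro has_derivative_eq_rhs[OF D]) (auto simp: linear_scale partial_deriv_def e_def)
  qed
  obtain B where B: "\<And>x. norm (partial_deriv i F x) \<le> B"
  proof -
    have "compact (partial_deriv i F ` K)"
      using c K(1) by (meson compact_continuous_image continuous_on_subset subset_UNIV)
    then obtain B where "\<And>x. x \<in> K \<Longrightarrow> norm (partial_deriv i F x) \<le> B"
      using compact_imp_bounded bounded_iff by (metis imageI)
    then have "norm (partial_deriv i F x) \<le> max B 0" for x
      using K(3)[of x] by (cases "x \<in> K") (auto simp: max.coboundedI1)
    then show ?thesis using that by blast
  qed
  obtain R where R: "K \<subseteq> cball 0 R" 
    using compact_imp_bounded[OF K(1)] by (auto simp: bounded_iff subset_iff)
  define q where "q n x = (F (h n *\<^sub>R e + x) - F x) / h n" for n x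
  have shift: "continuous_on UNIV (\<lambda>x. F (h n *\<^sub>R e + x))" for n
    by (rule continuous_on_compose2[OF cF]) (auto intro!: continuous_intros)
  \<comment> \<open>Shifts have length at most 1, so all difference quotients live in one ball and
    share a dominating function.\<close>
  have q0: "F (h n *\<^sub>R e + x) = 0" if "x \<notin> cball 0 (R + 1)" for n x
  proof (rule K(2))
    have "norm x \<le> norm (h n *\<^sub>R e + x) + norm (h n *\<^sub>R e)"
      by (metis add.commute add_diff_cancel_left' norm_triangle_ineq4)
    moreover have "norm (h n *\<^sub>R e) \<le> 1" using h[of n] by (simp add: e_def)
    ultimately have "norm (h n *\<^sub>R e + x) > R" using that by simp
    then show "h n *\<^sub>R e + x \<notin> K" using R by auto
  qed
  have "integral\<^sup>L lborel (q n) = 0" for n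
  proof -
    have "integral\<^sup>L lborel (q n) =
      (integral\<^sup>L lborel (\<lambda>x. F (h n *\<^sub>R e + x)) - integral\<^sup>L lborel F) / h n"
      unfolding q_def
      by (subst Bochner_Integration.integral_diff[symmetric])
        (auto intro!: integrable_compact_support(1)[OF shift compact_cball q0]
          integrable_compact_support(1)[OF cF K(1,2)])
    then show ?thesis by (simp add: integral_lborel_translate[OF cF])
  qed
  moreover have "(\<lambda>n. integral\<^sup>L lborel (q n)) \<longlonglongrightarrow> integral\<^sup>L lborel (partial_deriv i F)"
  proof (rule integral_dominated_convergence[where w = "\<lambda>x. B * indicator (cball 0 (R + 1)) x"])
    show "partial_deriv i F \<in> borel_measurable lborel"
      using c borel_measurable_continuous_onI by auto
    show "q n \<in> borel_measurable lborel" for n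
      unfolding q_def using shift[of n] cF
      by (intro borel_measurable_divide borel_measurable_diff)
         (auto intro: borel_measurable_continuous_onI)
    show "integrable lborel (\<lambda>x::real^3. B * indicator (cball 0 (R + 1)) x)"
      by (intro integrable_mult_right integrable_real_indicator) (use emeasure_bounded_finite[OF bounded_cball] in auto)
    show "AE x in lborel. (\<lambda>n. q n x) \<longlonglongrightarrow> partial_deriv i F x"
    proof (rule AE_I2)
      fix x
      have "((\<lambda>t. (F (x + (0 + t) *\<^sub>R e) - F (x + 0 *\<^sub>R e)) / t) \<longlongrightarrow> partial_deriv i F (x + 0 *\<^sub>R e)) (at 0)"
        using dir[of x 0] unfolding DERIV_def .
      moreover have "filterlim h (at 0) sequentially"
        using h0 h(1) by (auto simp: filterlim_at intro!: always_eventually) (metis less_irrefl)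
      ultimately have "((\<lambda>n. (F (x + (0 + h n) *\<^sub>R e) - F (x + 0 *\<^sub>R e)) / h n) \<longlongrightarrow> partial_deriv i F (x + 0 *\<^sub>R e)) sequentially"
        by (rule filterlim_compose)
      then show "(\<lambda>n. q n x) \<longlonglongrightarrow> partial_deriv i F x"
        by (simp add: q_def add.commute)
    qed
    show "AE x in lborel. norm (q n x) \<le> B * indicator (cball 0 (R + 1)) x" for n
    proof (rule AE_I2)
      fix x
      show "norm (q n x) \<le> B * indicator (cball 0 (R + 1)) x"
      proof (cases "x \<in> cball 0 (R + 1)")
        case True
        \<comment> \<open>By the mean value theorem the quotient is a value of the partial
          derivative, which gives the bound \<open>B\<close> for all \<open>n\<close>.\<close>
        have "\<exists>z>0. z < h n \<and> F (x + h n *\<^sub>R e) - F (x + 0 *\<^sub>R e) = (h n - 0) * partial_deriv i F (x + z *\<^sub>R e)"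
          by (rule MVT2[OF h(1)[of n], of "\<lambda>t. F (x + t *\<^sub>R e)" "\<lambda>t. partial_deriv i F (x + t *\<^sub>R e)"]) (rule dir)
        then obtain z where "F (x + h n *\<^sub>R e) - F (x + 0 *\<^sub>R e) = (h n - 0) * partial_deriv i F (x + z *\<^sub>R e)"
          by blast
        then have "q n x = partial_deriv i F (x + z *\<^sub>R e)"
          using h(1)[of n] by (simp add: q_def add.commute)
        then show ?thesis using True B by simp
      next
        case False
        moreover have "F x = 0" using False R K(2)[of x] by force
        ultimately show ?thesis using q0[OF False, of n] by (simp add: q_def)
      qed
    qed
  qed
  ultimately show ?thesis by (simp add: LIMSEQ_const_iff)
qed

lemma partial_deriv_mult:
  assumes "f differentiable (at x)" "g differentiable (at x)"
  shows "partial_deriv i (\<lambda>x. f x * g x) x = partial_deriv i f x * g x + f x * partial_deriv i g x"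
proof -
  have "((\<lambda>x. f x * g x) has_derivative
      (\<lambda>h. f x * frechet_derivative g (at x) h + frechet_derivative f (at x) h * g x)) (at x)"
    using assms by (intro has_derivative_mult) (simp_all add: frechet_derivative_works)
  then show ?thesis unfolding partial_deriv_def by (subst frechet_derivative_at[symmetric, OF \<open>(_ has_derivative _) _\<close>]) auto
qed

text \<open>The product of two test functions has compact support, so the integral of its partial
  derivative vanishes; the product rule then gives the weak gradient. Through this lemma,
  orthogonality to Sobolev gradients implies the distributional equations.\<close>

lemma test_function_in_W12_grad:
  assumes \<Omega>: "open \<Omega>" and \<psi>: "\<psi> \<in> test_functions \<Omega>"
  shows "(\<psi>, grad \<psi>) \<in> W12_grad \<Omega>"
proof -
  have \<Omega>m: "\<Omega> \<in> sets lebesgue" using \<Omega> by (simp add: lborelD)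
  obtain K where K: "compact K" "K \<subseteq> \<Omega>" "\<And>x. x \<notin> K \<Longrightarrow> \<psi> x = 0"
    "\<And>x i. x \<notin> K \<Longrightarrow> partial_deriv i \<psi> x = 0" by (rule test_functionsE[OF \<psi>]) blast
  have L2: "u \<in> L_two \<Omega>" if "continuous_on UNIV u" "\<And>x. x \<notin> K \<Longrightarrow> u x = 0" for u :: "real^3 \<Rightarrow> 'b::euclidean_space"
    unfolding L_two_def
  proof safe
    show "u \<in> borel_measurable (lebesgue_on \<Omega>)"
      using that(1) \<Omega>m by (metis continuous_imp_measurable_on_sets_lebesgue continuous_on_subset subset_UNIV)
    show "integrable (lebesgue_on \<Omega>) (\<lambda>x. (norm (u x))\<^sup>2)"
      by (rule integrable_compact_support(3)[OF _ K(1) _ \<Omega>m]) (use that in \<open>auto intro!: continuous_intros\<close>)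
  qed
  have "weak_grad \<Omega> \<psi> (grad \<psi>)"
    unfolding weak_grad_def
  proof (intro ballI allI)
    fix \<eta> i assume \<eta>: "\<eta> \<in> test_functions \<Omega>"
    note d = test_functions_diff[OF \<psi>] and d' = test_functions_diff[OF \<eta>]
    have e: "partial_deriv i (\<lambda>x. \<psi> x * \<eta> x) = (\<lambda>x. grad \<psi> x $ i * \<eta> x + \<psi> x * partial_deriv i \<eta> x)"
      using partial_deriv_mult[OF d(1) d'(1)] by (auto simp: grad_def)
    have z: "grad \<psi> x $ i = 0" if "x \<notin> K" for x using K(4) that by (simp add: grad_def)
    have z\<Omega>: "\<psi> x = 0 \<and> grad \<psi> x $ i = 0" if "x \<notin> \<Omega>" for x
      using that K(2,3) z by blast
    have c: "continuous_on UNIV (\<lambda>x. grad \<psi> x $ i)"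
      using d(4)[of i] by (simp add: grad_def)
    have "integral\<^sup>L lborel (partial_deriv i (\<lambda>x. \<psi> x * \<eta> x)) = 0"
      by (rule integral_partial_deriv_eq_0[OF _ _ K(1)])
        (use d(1) d'(1) K(3) z in \<open>auto simp: e intro!: continuous_intros c d d'\<close>)
    then have "0 = integral\<^sup>L (lebesgue_on \<Omega>) (\<lambda>x. grad \<psi> x $ i * \<eta> x + \<psi> x * partial_deriv i \<eta> x)"
      by (subst integral_lebesgue_on_eq_lborel[OF _ \<Omega>m])
        (use K(2,3) z in \<open>auto simp: e subset_iff intro!: continuous_intros c d d' dest: z\<Omega>\<close>)
    also have "\<dots> = integral\<^sup>L (lebesgue_on \<Omega>) (\<lambda>x. grad \<psi> x $ i * \<eta> x) +
        integral\<^sup>L (lebesgue_on \<Omega>) (\<lambda>x. \<psi> x * partial_deriv i \<eta> x)"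
      by (rule Bochner_Integration.integral_add; rule integrable_compact_support(3)[OF _ K(1) _ \<Omega>m])
        (use K(3) z in \<open>auto intro!: continuous_intros c d d'\<close>)
    finally show "integral\<^sup>L (lebesgue_on \<Omega>) (\<lambda>x. \<psi> x * partial_deriv i \<eta> x) =
        - integral\<^sup>L (lebesgue_on \<Omega>) (\<lambda>x. grad \<psi> x $ i * \<eta> x)" by linarith
  qed
  moreover have "grad \<psi> x = 0" if "x \<notin> K" for x
    using K(4)[OF that] by (simp add: grad_def vec_eq_iff)
  ultimately show ?thesis
    using L2[OF test_functions_diff(3)[OF \<psi>] K(3)] L2[OF continuous_on_grad[OF \<psi>]]
    by (simp add: W12_grad_def)
qed

section \<open>Fields orthogonal to gradients\<close>

text \<open>The weight \<open>c\<close> serves as a cutoff: a limit of neutral fields need not be integrable against \<open>g\<close>.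
  Its gradient vanishes where \<open>p\<close> does not, so the product rule produces no extra term.\<close>

definition neutral :: "(real^3) set \<Rightarrow> (real^3 \<Rightarrow> real^3^3) \<Rightarrow> bool" where
  "neutral \<Omega> \<phi> \<longleftrightarrow> continuous_on UNIV \<phi> \<and> (\<exists>K. compact K \<and> K \<subseteq> \<Omega> \<and> (\<forall>x. x \<notin> K \<longrightarrow> \<phi> x = 0)) \<and>
    (\<forall>(p, g)\<in>W12_grad \<Omega>. \<forall>c. (\<forall>k. smooth1 (c k)) \<longrightarrow>
      (\<forall>x\<in>\<Omega>. p x \<noteq> 0 \<longrightarrow> (\<forall>k. prodfn (c(k := deriv (c k))) x = 0)) \<longrightarrow>
      (\<forall>i. integral\<^sup>L (lebesgue_on \<Omega>) (\<lambda>x. prodfn c x * (\<phi> x $ i \<bullet> g x)) = 0))"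

lemma integrable_compact_support_inner:
  fixes f :: "real^3 \<Rightarrow> real^3"
  assumes "continuous_on UNIV f" "compact K" "\<And>x. x \<notin> K \<Longrightarrow> f x = 0"
    and \<Omega>: "\<Omega> \<in> sets lebesgue" and g: "g \<in> L_two \<Omega>"
  shows "integrable (lebesgue_on \<Omega>) (\<lambda>x. f x \<bullet> g x)"
proof (rule Bochner_Integration.integrable_bound)
  have "integrable (lebesgue_on \<Omega>) (\<lambda>x. (norm (f x))\<^sup>2)"
    by (rule integrable_compact_support(3)[OF _ assms(2) _ \<Omega>]) (use assms in \<open>auto intro!: continuous_on_power continuous_on_norm\<close>)
  then show "integrable (lebesgue_on \<Omega>) (\<lambda>x. (norm (f x))\<^sup>2 + (norm (g x))\<^sup>2)"
    using g by (auto simp: L_two_def)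
  have "f \<in> borel_measurable (lebesgue_on \<Omega>)"
    using assms(1) \<Omega> by (metis continuous_imp_measurable_on_sets_lebesgue continuous_on_subset subset_UNIV)
  then show "(\<lambda>x. f x \<bullet> g x) \<in> borel_measurable (lebesgue_on \<Omega>)"
    using g by (auto simp: L_two_def)
  have "\<bar>f x \<bullet> g x\<bar> \<le> (norm (f x))\<^sup>2 + (norm (g x))\<^sup>2" for x
  proof -
    have "\<bar>f x \<bullet> g x\<bar> \<le> norm (f x) * norm (g x)" by (rule Cauchy_Schwarz_ineq2)
    moreover have "2 * (norm (f x) * norm (g x)) \<le> (norm (f x))\<^sup>2 + (norm (g x))\<^sup>2"
      using sum_squares_bound[of "norm (f x)" "norm (g x)"] by simp
    moreover have "0 \<le> norm (f x) * norm (g x)" by simp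
    ultimately show ?thesis by linarith
  qed
  then show "AE x in lebesgue_on \<Omega>. norm (f x \<bullet> g x) \<le> norm ((norm (f x))\<^sup>2 + (norm (g x))\<^sup>2)"
    by (auto intro!: AE_I2)
qed

lemma neutral_integrable:
  assumes "open \<Omega>" "neutral \<Omega> \<phi>" "(p, g) \<in> W12_grad \<Omega>" "\<And>k. smooth1 (c k)"
  shows "integrable (lebesgue_on \<Omega>) (\<lambda>x. prodfn c x * (\<phi> x $ i \<bullet> g x))"
proof -
  from assms(2) obtain K where K: "compact K" "\<And>x. x \<notin> K \<Longrightarrow> \<phi> x = 0" and c: "continuous_on UNIV \<phi>"
    unfolding neutral_def by blast
  have "integrable (lebesgue_on \<Omega>) (\<lambda>x. (prodfn c x *\<^sub>R \<phi> x $ i) \<bullet> g x)"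
    by (rule integrable_compact_support_inner[OF _ K(1)])
      (use K(2) assms in \<open>auto intro!: continuous_on_scaleR continuous_on_component prodfn_continuous c simp: W12_grad_def lborelD\<close>)
  then show ?thesis by simp
qed

lemma neutral_orthogonal:
  assumes "neutral \<Omega> \<phi>" "(p, g) \<in> W12_grad \<Omega>" "\<And>k. smooth1 (c k)"
    "\<And>x k. x \<in> \<Omega> \<Longrightarrow> p x \<noteq> 0 \<Longrightarrow> prodfn (c(k := deriv (c k))) x = 0"
  shows "integral\<^sup>L (lebesgue_on \<Omega>) (\<lambda>x. prodfn c x * (\<phi> x $ i \<bullet> g x)) = 0"
proof -
  from assms(1) have *: "\<forall>(p, g)\<in>W12_grad \<Omega>. \<forall>c. (\<forall>k. smooth1 (c k)) \<longrightarrow>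
      (\<forall>x\<in>\<Omega>. p x \<noteq> 0 \<longrightarrow> (\<forall>k. prodfn (c(k := deriv (c k))) x = 0)) \<longrightarrow>
      (\<forall>i. integral\<^sup>L (lebesgue_on \<Omega>) (\<lambda>x. prodfn c x * (\<phi> x $ i \<bullet> g x)) = 0)"
    unfolding neutral_def by blast
  show ?thesis using bspec[OF *, OF assms(2)] assms(3,4) by simp
qed

lemma neutral_zero: "neutral \<Omega> (\<lambda>x. 0)"
  unfolding neutral_def by (auto intro!: exI[of _ "{}"])

lemma neutral_add:
  assumes \<Omega>: "open \<Omega>" and \<phi>: "neutral \<Omega> \<phi>" and \<phi>': "neutral \<Omega> \<phi>'"
  shows "neutral \<Omega> (\<lambda>x. \<phi> x + \<phi>' x)"
proof -
  from \<phi> \<phi>' obtain K K' where K: "compact K" "K \<subseteq> \<Omega>" "\<forall>x. x \<notin> K \<longrightarrow> \<phi> x = 0"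
    "compact K'" "K' \<subseteq> \<Omega>" "\<forall>x. x \<notin> K' \<longrightarrow> \<phi>' x = 0"
    and c: "continuous_on UNIV \<phi>" "continuous_on UNIV \<phi>'"
    unfolding neutral_def by blast
  have "integral\<^sup>L (lebesgue_on \<Omega>) (\<lambda>x. prodfn c x * ((\<phi> x + \<phi>' x) $ i \<bullet> g x)) = 0"
    if "(p, g) \<in> W12_grad \<Omega>" "\<forall>k. smooth1 (c k)"
      "\<forall>x\<in>\<Omega>. p x \<noteq> 0 \<longrightarrow> (\<forall>k. prodfn (c(k := deriv (c k))) x = 0)" for p g c i
  proof -
    have "integral\<^sup>L (lebesgue_on \<Omega>) (\<lambda>x. prodfn c x * ((\<phi> x + \<phi>' x) $ i \<bullet> g x)) =
      integral\<^sup>L (lebesgue_on \<Omega>) (\<lambda>x. prodfn c x * (\<phi> x $ i \<bullet> g x) + prodfn c x * (\<phi>' x $ i \<bullet> g x))"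
      by (simp add: inner_add_left distrib_left)
    also have "\<dots> = 0 + 0"
      using that by (subst Bochner_Integration.integral_add)
        (auto intro!: neutral_integrable[OF \<Omega>] \<phi> \<phi>' simp: neutral_orthogonal[OF \<phi>] neutral_orthogonal[OF \<phi>'])
    finally show ?thesis by simp
  qed
  then show ?thesis unfolding neutral_def
    using K c by (auto intro!: continuous_on_add exI[of _ "K \<union> K'"])
qed

lemma neutral_scaleR:
  assumes \<phi>: "neutral \<Omega> \<phi>"
  shows "neutral \<Omega> (\<lambda>x. s *\<^sub>R \<phi> x)"
proof -
  from \<phi> obtain K where K: "compact K" "K \<subseteq> \<Omega>" "\<forall>x. x \<notin> K \<longrightarrow> \<phi> x = 0"
    and c: "continuous_on UNIV \<phi>"
    unfolding neutral_def by blast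
  have "integral\<^sup>L (lebesgue_on \<Omega>) (\<lambda>x. prodfn c x * ((s *\<^sub>R \<phi> x) $ i \<bullet> g x)) = 0"
    if "(p, g) \<in> W12_grad \<Omega>" "\<forall>k. smooth1 (c k)"
      "\<forall>x\<in>\<Omega>. p x \<noteq> 0 \<longrightarrow> (\<forall>k. prodfn (c(k := deriv (c k))) x = 0)" for p g c i
  proof -
    have "integral\<^sup>L (lebesgue_on \<Omega>) (\<lambda>x. prodfn c x * ((s *\<^sub>R \<phi> x) $ i \<bullet> g x)) =
      integral\<^sup>L (lebesgue_on \<Omega>) (\<lambda>x. s * (prodfn c x * (\<phi> x $ i \<bullet> g x)))"
      by (simp add: mult_ac)
    also have "\<dots> = 0"
      using that neutral_orthogonal[OF \<phi> that(1)] by simp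
    finally show ?thesis by simp
  qed
  then show ?thesis unfolding neutral_def
    using K c by (auto intro!: continuous_on_scaleR)
qed

text \<open>With the potential \<open>A = prodfn a\<close>, the updates of the factors
  \<open>l\<close> and \<open>j\<close> are its partial derivatives. Only row \<open>i\<close> is
  nonzero, and its divergence vanishes since mixed derivatives commute.\<close>

definition wave :: "(3 \<Rightarrow> real \<Rightarrow> real) \<Rightarrow> 3 \<Rightarrow> 3 \<Rightarrow> 3 \<Rightarrow> real^3 \<Rightarrow> real^3^3" where
  "wave a i j l x = axis i (axis j (prodfn (a(l := deriv (a l))) x) - axis l (prodfn (a(j := deriv (a j))) x))"

text \<open>Each product of \<open>c\<close> with a first derivative of the potential is a test
  function, so the weak gradient moves the outer derivative onto it. The derivative of
  \<open>c\<close> is invisible because it vanishes where \<open>p\<close> does not. What remains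
  are two integrals of \<open>p\<close> against the same mixed second derivative, with opposite
  signs.\<close>

lemma neutral_wave:
  assumes \<Omega>: "open \<Omega>" and a: "\<And>k. smooth1 (a k)"
    and K: "compact K" "K \<subseteq> \<Omega>" "\<And>x. x \<notin> K \<Longrightarrow> prodfn a x = 0"
  shows "neutral \<Omega> (wave a i j l)"
proof (cases "j = l")
  case True
  then have "wave a i j l = (\<lambda>x. 0)" by (auto simp: wave_def vec_eq_iff axis_def)
  then show ?thesis using neutral_zero by simp
next
  case False
  have \<Omega>m: "\<Omega> \<in> sets lebesgue" using \<Omega> by (simp add: lborelD)
  have a': "smooth1 ((a(k := deriv (a k))) k')" for k k'
    using a smooth1_deriv(2) by auto
  have z: "prodfn (a(k := deriv (a k))) x = 0" if "x \<notin> K" for k x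
    using partial_deriv_zero[of "- K" "prodfn a" x k] K that compact_imp_closed
    by (auto simp: partial_deriv_prodfn[OF a])
  have cont: "continuous_on UNIV (wave a i j l)"
  proof -
    have 1: "continuous_on UNIV (\<lambda>x. axis k (f x))" if "continuous_on UNIV f"
      for k and f :: "real^3 \<Rightarrow> 'b::real_normed_vector"
      unfolding axis_def
    proof (rule continuous_on_vec_lambda)
      show "continuous_on UNIV (\<lambda>x. if i = k then f x else 0)" for i
        by (cases "i = k") (simp_all add: that)
    qed
    show ?thesis unfolding wave_def[abs_def]
      by (intro 1 continuous_on_diff prodfn_continuous a')
  qed
  have "integral\<^sup>L (lebesgue_on \<Omega>) (\<lambda>x. prodfn c x * (wave a i j l x $ i' \<bullet> g x)) = 0"
    if pg: "(p, g) \<in> W12_grad \<Omega>" and c: "\<And>k. smooth1 (c k)"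
      and cp: "\<forall>x\<in>\<Omega>. p x \<noteq> 0 \<longrightarrow> (\<forall>k. prodfn (c(k := deriv (c k))) x = 0)" for p g c i'
  proof (cases "i' = i")
    case True
    define \<psi> where "\<psi> k x = prodfn c x * prodfn (a(k := deriv (a k))) x" for k x
    have \<psi>s: "\<psi> k = prodfn (\<lambda>m t. c m t * (a(k := deriv (a k))) m t)" for k
      by (rule ext) (simp only: \<psi>_def prodfn_mult)
    have \<psi>T: "\<psi> k \<in> test_functions \<Omega>" for k
    proof (rule test_functionsI[OF _ K(1,2)])
      show "smooth (\<psi> k)" unfolding \<psi>s by (intro smooth_prodfn smooth1_mult c a')
      show "\<psi> k x = 0" if "x \<notin> K" for x using z[OF that] by (simp add: \<psi>_def)
    qed
    have by_parts: "integral\<^sup>L (lebesgue_on \<Omega>) (\<lambda>x. g x $ k * \<psi> m x) =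
        - integral\<^sup>L (lebesgue_on \<Omega>) (\<lambda>x. p x * (prodfn c x * prodfn (a(m := deriv (a m), k := deriv (a k))) x))"
      if "k \<noteq> m" for k m
    proof -
      have "integral\<^sup>L (lebesgue_on \<Omega>) (\<lambda>x. p x * partial_deriv k (\<psi> m) x) =
          - integral\<^sup>L (lebesgue_on \<Omega>) (\<lambda>x. g x $ k * \<psi> m x)"
        using pg \<psi>T[of m] unfolding W12_grad_def weak_grad_def by blast
      moreover have "partial_deriv k (\<psi> m) x = prodfn (c(k := deriv (c k))) x * prodfn (a(m := deriv (a m))) x +
          prodfn c x * prodfn (a(m := deriv (a m), k := deriv (a k))) x" for x
      proof -
        have "(a(m := deriv (a m))) k = a k" using that by simp
        then have "partial_deriv k (prodfn (a(m := deriv (a m)))) = prodfn (a(m := deriv (a m), k := deriv (a k)))"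
          using partial_deriv_prodfn[of "a(m := deriv (a m))" k, OF a'] by metis
        then show ?thesis
          unfolding \<psi>_def[abs_def] partial_deriv_prodfn[of c k, OF c, symmetric]
          using partial_deriv_mult[OF prodfn_differentiable[of c, OF c] prodfn_differentiable[of "a(m := deriv (a m))", OF a']]
          by metis
      qed
      \<comment> \<open>Where \<open>p\<close> vanishes both sides are 0; elsewhere the derivative
        of \<open>c\<close> is 0.\<close>
      then have "p x * partial_deriv k (\<psi> m) x =
          p x * (prodfn c x * prodfn (a(m := deriv (a m), k := deriv (a k))) x)" if "x \<in> \<Omega>" for x
        using cp that by (cases "p x = 0") auto
      then have "integral\<^sup>L (lebesgue_on \<Omega>) (\<lambda>x. p x * partial_deriv k (\<psi> m) x) =
         integral\<^sup>L (lebesgue_on \<Omega>) (\<lambda>x. p x * (prodfn c x * prodfn (a(m := deriv (a m), k := deriv (a k))) x))"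
        by (intro Bochner_Integration.integral_cong) auto
      ultimately show ?thesis by simp
    qed
    have int: "integrable (lebesgue_on \<Omega>) (\<lambda>x. g x $ k * \<psi> m x)" for k m
    proof -
      have "integrable (lebesgue_on \<Omega>) (\<lambda>x. (\<psi> m x *\<^sub>R axis k 1) \<bullet> g x)"
        by (rule integrable_compact_support_inner[OF _ K(1) _ \<Omega>m])
          (use pg z in \<open>auto intro!: continuous_intros prodfn_continuous c a' simp: W12_grad_def \<psi>_def\<close>)
      then show ?thesis by (simp add: inner_axis' mult.commute)
    qed
    have "prodfn c x * (wave a i j l x $ i' \<bullet> g x) = g x $ j * \<psi> l x - g x $ l * \<psi> j x" for x
      using True by (simp add: wave_def \<psi>_def inner_diff_left inner_axis' algebra_simps)
    then have "integral\<^sup>L (lebesgue_on \<Omega>) (\<lambda>x. prodfn c x * (wave a i j l x $ i' \<bullet> g x)) =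
        integral\<^sup>L (lebesgue_on \<Omega>) (\<lambda>x. g x $ j * \<psi> l x) - integral\<^sup>L (lebesgue_on \<Omega>) (\<lambda>x. g x $ l * \<psi> j x)"
      using int by simp
    also have "\<dots> = 0"
      using by_parts[OF False] by_parts[of l j] False
      by (simp add: fun_upd_twist[OF False])
    finally show ?thesis .
  qed (simp add: wave_def axis_def)
  moreover have "wave a i j l x = 0" if "x \<notin> K" for x
    using z[OF that] by (simp add: wave_def vec_eq_iff axis_def)
  ultimately show ?thesis unfolding neutral_def using cont K(1,2) by blast
qed

section \<open>A finite weighted measure\<close>

text \<open>A positive continuous integrable function. The exponent is 3 + 2: a ball of radius
  \<open>n + 1\<close> has volume of order \<open>(n + 1) ^ 3\<close>, which leaves the summable
  \<open>(n + 1) ^ (-2)\<close>.\<close>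

definition weight :: "real^3 \<Rightarrow> real" where
  "weight x = inverse ((1 + norm x) ^ 5)"

text \<open>A finite measure, so that bounded measurable fields are square integrable even if
  \<Omega> is unbounded. It only measures progress; orthogonality to gradients refers to the
  unweighted measure.\<close>

definition wmeasure :: "(real^3) set \<Rightarrow> (real^3) measure" where
  "wmeasure \<Omega> = density (lebesgue_on \<Omega>) (\<lambda>x. ennreal (weight x))"

lemma weight_pos: "0 < weight x"
  by (simp add: weight_def add_pos_nonneg)

lemma continuous_on_weight: "continuous_on A weight"
  unfolding weight_def
  by (intro continuous_intros) (smt (verit) norm_ge_zero zero_less_power less_numeral_extra(3))

lemma weight_measurable [measurable]: "weight \<in> borel_measurable borel"
  by (rule borel_measurable_continuous_onI[OF continuous_on_weight])

lemma weight_measurable' [measurable]: "weight \<in> borel_measurable (lebesgue_on \<Omega>)"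
  by (intro measurable_restrict_space1 measurable_completion) simp

lemma nn_integral_weight_finite: "(\<integral>\<^sup>+x. ennreal (weight x) \<partial>lborel) < \<infinity>"
proof -
  define V where "V = unit_ball_vol (real (DIM(real^3)))"
  have V: "0 \<le> V" unfolding V_def by simp
  have pt: "ennreal (weight x) \<le> (\<Sum>n. ennreal (inverse (real (Suc n) ^ 5)) * indicator (cball 0 (real (Suc n))) x)" for x
  proof -
    \<comment> \<open>The single term of the series whose index is the integer part of
      \<open>norm x\<close> already dominates the weight at \<open>x\<close>.\<close>
    define n where "n = nat \<lfloor>norm x\<rfloor>"
    have n: "real n \<le> norm x" "norm x \<le> real (Suc n)"
      using floor_correct[of "norm x"] unfolding n_def by (auto simp: add.commute less_imp_le)
    have "weight x \<le> inverse (real (Suc n) ^ 5)" unfolding weight_def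
      using n by (intro le_imp_inverse_le power_mono) auto
    then have "ennreal (weight x) \<le> ennreal (inverse (real (Suc n) ^ 5)) * indicator (cball 0 (real (Suc n))) x"
      using n by (simp add: ennreal_leI)
    also have "\<dots> \<le> (\<Sum>n. ennreal (inverse (real (Suc n) ^ 5)) * indicator (cball 0 (real (Suc n))) x)"
    proof -
      define F where "F n = ennreal (inverse (real (Suc n) ^ 5)) * indicator (cball 0 (real (Suc n))) x" for n
      have "F n \<le> suminf F" using sum_le_suminf[of F "{n}"] by simp
      then show ?thesis by (simp only: F_def[abs_def])
    qed
    finally show ?thesis .
  qed
  have "(\<integral>\<^sup>+x. ennreal (weight x) \<partial>lborel) \<le>
      (\<integral>\<^sup>+x. (\<Sum>n. ennreal (inverse (real (Suc n) ^ 5)) * indicator (cball (0::real^3) (real (Suc n))) x) \<partial>lborel)"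
    by (rule nn_integral_mono) (rule pt)
  also have "\<dots> = (\<Sum>n. ennreal (inverse (real (Suc n) ^ 5)) * emeasure lborel (cball (0::real^3) (real (Suc n))))"
    by (subst nn_integral_suminf)
      (auto simp: nn_integral_cmult_indicator simp del: of_nat_Suc intro!: borel_measurable_times_ennreal borel_measurable_indicator)
  also have "\<dots> = (\<Sum>n. ennreal (V * inverse (real (Suc n) ^ 2)))"
  proof (rule suminf_cong)
    fix n
    have "ennreal (inverse (real (Suc n) ^ 5)) * emeasure lborel (cball (0::real^3) (real (Suc n))) =
      ennreal (inverse (real (Suc n) ^ 5)) * ennreal (V * real (Suc n) ^ 3)"
      by (subst emeasure_cball) (auto simp: V_def)
    also have "\<dots> = ennreal (inverse (real (Suc n) ^ 5) * (V * real (Suc n) ^ 3))"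
      using V by (subst ennreal_mult[symmetric]) auto
    also have "inverse (real (Suc n) ^ 5) * (V * real (Suc n) ^ 3) = V * inverse (real (Suc n) ^ 2)"
      by (simp add: field_simps power_numeral_reduce del: of_nat_Suc)
    finally show "ennreal (inverse (real (Suc n) ^ 5)) * emeasure lborel (cball (0::real^3) (real (Suc n))) =
      ennreal (V * inverse (real (Suc n) ^ 2))" .
  qed
  also have "\<dots> < \<infinity>"
  proof -
    have "summable (\<lambda>n. inverse (real (Suc n) ^ 2))"
      using inverse_power_summable[of 2, where 'a = real] by (subst summable_Suc_iff) simp
    then have "summable (\<lambda>n. V * inverse (real (Suc n) ^ 2))" by (rule summable_mult)
    then show ?thesis using V by (simp add: ennreal_suminf_neq_top less_top del: of_nat_Suc)
  qed
  finally show ?thesis .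
qed

lemma space_wmeasure [simp]: "space (wmeasure \<Omega>) = \<Omega>"
  by (simp add: wmeasure_def)

text \<open>Together with \<open>AE_wmeasure\<close> this makes the two measures interchangeable in
  statements about measurability and null sets; the latter rests on the positivity of the
  weight.\<close>

lemma sets_wmeasure [measurable_cong]: "sets (wmeasure \<Omega>) = sets (lebesgue_on \<Omega>)"
  by (simp add: wmeasure_def)

lemma borel_measurable_wmeasure: "f \<in> borel_measurable (wmeasure \<Omega>) \<longleftrightarrow> f \<in> borel_measurable (lebesgue_on \<Omega>)"
  by (simp add: wmeasure_def)

lemma AE_wmeasure: "(AE x in wmeasure \<Omega>. P x) \<longleftrightarrow> (AE x in lebesgue_on \<Omega>. P x)"
  unfolding wmeasure_def by (subst AE_density) (auto simp: weight_pos)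

lemma nn_integral_lebesgue_eq_lborel:
  assumes "f \<in> borel_measurable borel"
  shows "integral\<^sup>N lebesgue f = integral\<^sup>N lborel f"
  using assms by (simp add: nn_integral_completion)

lemma finite_measure_wmeasure:
  assumes "\<Omega> \<in> sets lebesgue"
  shows "finite_measure (wmeasure \<Omega>)"
proof (rule finite_measureI)
  have "emeasure (wmeasure \<Omega>) (space (wmeasure \<Omega>)) = (\<integral>\<^sup>+x. ennreal (weight x) * indicator \<Omega> x \<partial>lebesgue_on \<Omega>)"
    unfolding wmeasure_def by (subst emeasure_density) (auto simp: assms sets_restrict_space_iff)
  also have "\<dots> \<le> (\<integral>\<^sup>+x. ennreal (weight x) \<partial>lebesgue)"
    by (subst nn_integral_restrict_space) (auto simp: assms intro!: nn_integral_mono simp: indicator_def)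
  also have "\<dots> = (\<integral>\<^sup>+x. ennreal (weight x) \<partial>lborel)"
    by (rule nn_integral_lebesgue_eq_lborel) simp
  also have "\<dots> < \<infinity>" by (rule nn_integral_weight_finite)
  finally show "emeasure (wmeasure \<Omega>) (space (wmeasure \<Omega>)) \<noteq> \<infinity>" by simp
qed

lemma integral_wmeasure:
  fixes f :: "real^3 \<Rightarrow> real"
  assumes "f \<in> borel_measurable (lebesgue_on \<Omega>)"
  shows "integral\<^sup>L (wmeasure \<Omega>) f = integral\<^sup>L (lebesgue_on \<Omega>) (\<lambda>x. weight x * f x)"
  unfolding wmeasure_def using assms
  by (subst integral_density) (auto simp: less_imp_le[OF weight_pos])

text \<open>The covering theorem supplies balls, but a localized wave is guaranteed to gain norm
  only on the cube where its cutoff equals 1. Near \<open>x\<close> the weight varies by a factor of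
  at most 2, and ball and cube have volumes \<open>V * r ^ 3\<close> and \<open>(r / 2) ^ 3\<close>,
  hence the constant \<open>2 * 8 * V\<close>, which depends neither on \<open>x\<close> nor on
  \<Omega>.\<close>

lemma wmeasure_doubling:
  obtains \<kappa> where "0 < \<kappa>" "\<And>\<Omega> x. open \<Omega> \<Longrightarrow> x \<in> \<Omega> \<Longrightarrow> \<exists>\<delta>>0. \<forall>r. 0 < r \<and> r < \<delta> \<longrightarrow>
     cball x r \<subseteq> \<Omega> \<and> measure (wmeasure \<Omega>) (cball x r) \<le> \<kappa> * measure (wmeasure \<Omega>) (cbox (x - vec (r / 4)) (x + vec (r / 4)))"
proof
  define V where "V = unit_ball_vol (real (DIM(real^3)))"
  have V: "0 < V" unfolding V_def by simp
  then show "0 < 16 * V" by simp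
  fix \<Omega> :: "(real^3) set" and x assume \<Omega>: "open \<Omega>" "x \<in> \<Omega>"
  have \<Omega>m: "\<Omega> \<in> sets lebesgue" using \<Omega> by (simp add: lborelD)
  interpret finite_measure "wmeasure \<Omega>" by (rule finite_measure_wmeasure[OF \<Omega>m])
  \<comment> \<open>This places \<open>weight x\<close> strictly between \<open>m\<close> and
    \<open>2 * m\<close>, a condition that persists in a neighbourhood.\<close>
  define m where "m = weight x / (3/2)"
  have m: "0 < m" "m < weight x" "weight x < 2 * m" using weight_pos[of x] by (auto simp: m_def)
  have "open {y. m < weight y}" "open {y. weight y < 2 * m}"
    by (auto intro!: open_Collect_less continuous_on_weight)
  then have "open (\<Omega> \<inter> {y. m < weight y} \<inter> {y. weight y < 2 * m})"
    using \<Omega> by auto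
  moreover have "x \<in> \<Omega> \<inter> {y. m < weight y} \<inter> {y. weight y < 2 * m}" using m \<Omega> by simp
  ultimately obtain \<delta> where \<delta>: "\<delta> > 0" "cball x \<delta> \<subseteq> \<Omega> \<inter> {y. m < weight y} \<inter> {y. weight y < 2 * m}"
    using open_contains_cball by blast
  have em: "emeasure (wmeasure \<Omega>) A = (\<integral>\<^sup>+y. ennreal (weight y) * indicator A y \<partial>lborel)"
    if "A \<subseteq> \<Omega>" "A \<in> sets borel" for A
  proof -
    have "emeasure (wmeasure \<Omega>) A = (\<integral>\<^sup>+y. ennreal (weight y) * indicator A y \<partial>lebesgue_on \<Omega>)"
      unfolding wmeasure_def using that
      by (subst emeasure_density) (auto simp: \<Omega>m sets_restrict_space_iff)
    also have "\<dots> = (\<integral>\<^sup>+y. ennreal (weight y) * indicator A y \<partial>lebesgue)"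
      using that by (subst nn_integral_restrict_space) (auto simp: \<Omega>m intro!: nn_integral_cong simp: indicator_def)
    also have "\<dots> = (\<integral>\<^sup>+y. ennreal (weight y) * indicator A y \<partial>lborel)"
      by (rule nn_integral_lebesgue_eq_lborel) (use that in measurable)
    finally show ?thesis .
  qed
  have "cball x r \<subseteq> \<Omega> \<and> measure (wmeasure \<Omega>) (cball x r) \<le> 16 * V * measure (wmeasure \<Omega>) (cbox (x - vec (r / 4)) (x + vec (r / 4)))"
    if r: "0 < r" "r < \<delta>" for r
  proof -
    have sub: "cball x r \<subseteq> cball x \<delta>" using r by (simp add: subset_cball)
    have inner: "cbox (x - vec (r / 4)) (x + vec (r / 4)) \<subseteq> ball x r"
    proof
      fix y assume "y \<in> cbox (x - vec (r / 4)) (x + vec (r / 4))"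
      then have "\<bar>(y - x) $ i\<bar> \<le> r / 4" for i
      proof -
        have "x $ i - r / 4 \<le> y $ i" "y $ i \<le> x $ i + r / 4"
          using \<open>y \<in> cbox _ _\<close> by (auto simp: mem_box_cart)
        then have "(y - x) $ i \<le> r / 4" "- ((y - x) $ i) \<le> r / 4" by simp_all
        then show ?thesis by (rule abs_leI)
      qed
      then have "(\<Sum>i\<in>UNIV. \<bar>(y - x) $ i\<bar>) \<le> (\<Sum>i\<in>(UNIV::3 set). r / 4)" by (intro sum_mono)
      then have "norm (y - x) \<le> 3 * (r / 4)" using norm_le_l1_cart[of "y - x"] by simp
      then show "y \<in> ball x r" using r by (simp add: dist_norm norm_minus_commute)
    qed
    have "emeasure (wmeasure \<Omega>) (cball x r) \<le> (\<integral>\<^sup>+y. ennreal (2 * m) * indicator (cball x r) y \<partial>lborel)"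
      using \<delta>(2) sub
      by (subst em) (auto intro!: nn_integral_mono ennreal_leI simp: indicator_def subset_iff less_imp_le)
    also have "\<dots> = ennreal (2 * m * (V * r ^ 3))"
      using m r V by (simp add: nn_integral_cmult_indicator emeasure_cball V_def ennreal_mult)
    finally have 1: "measure (wmeasure \<Omega>) (cball x r) \<le> 2 * m * (V * r ^ 3)"
      using m r V by (simp add: emeasure_eq_measure)
    have "ennreal (m * (r / 2) ^ 3) = (\<integral>\<^sup>+y. ennreal m * indicator (cbox (x - vec (r / 4)) (x + vec (r / 4))) y \<partial>lborel)"
    proof -
      have "measure lborel (cbox (x - vec (r / 4)) (x + vec (r / 4))) = (\<Prod>i\<in>(UNIV::3 set). r / 2)"
        using r by (subst content_cbox_cart) (auto simp: interval_ne_empty_cart intro!: prod.cong)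
      then have "emeasure lborel (cbox (x - vec (r / 4)) (x + vec (r / 4))) = ennreal ((r / 2) ^ 3)"
        using emeasure_bounded_finite[OF bounded_cbox[of "x - vec (r / 4)" "x + vec (r / 4)"]]
        by (subst emeasure_eq_ennreal_measure) auto
      then show ?thesis
        using m r by (simp add: nn_integral_cmult_indicator ennreal_mult)
    qed
    also have "\<dots> \<le> emeasure (wmeasure \<Omega>) (cbox (x - vec (r / 4)) (x + vec (r / 4)))"
      using \<delta>(2) sub inner ball_subset_cball[of x r]
      by (subst em) (auto intro!: nn_integral_mono ennreal_leI simp: indicator_def subset_iff less_imp_le)
    finally have 2: "m * (r / 2) ^ 3 \<le> measure (wmeasure \<Omega>) (cbox (x - vec (r / 4)) (x + vec (r / 4)))"
      using m r by (simp add: emeasure_eq_measure)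
    have "measure (wmeasure \<Omega>) (cball x r) \<le> 16 * V * (m * (r / 2) ^ 3)"
      using 1 by (simp add: power_divide mult_ac)
    also have "\<dots> \<le> 16 * V * measure (wmeasure \<Omega>) (cbox (x - vec (r / 4)) (x + vec (r / 4)))"
      using 2 V by (intro mult_left_mono) auto
    finally show ?thesis using \<delta> sub by blast
  qed
  then show "\<exists>\<delta>>0. \<forall>r. 0 < r \<and> r < \<delta> \<longrightarrow>
     cball x r \<subseteq> \<Omega> \<and> measure (wmeasure \<Omega>) (cball x r) \<le> 16 * V * measure (wmeasure \<Omega>) (cbox (x - vec (r / 4)) (x + vec (r / 4)))"
    using \<delta>(1) by blast
qed

text \<open>Shifting by half a period changes the sign of the cosine, so the integral is half of that of
  the cosine times a small difference.\<close>

lemma Riemann_Lebesgue_lborel: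
  fixes G :: "real^3 \<Rightarrow> real"
  assumes c: "continuous_on UNIV G" and K: "compact K" "\<And>x. x \<notin> K \<Longrightarrow> G x = 0"
    and N: "\<And>n. 1 \<le> N n" "(\<lambda>n. inverse (N n)) \<longlonglongrightarrow> 0"
  shows "(\<lambda>n. integral\<^sup>L lborel (\<lambda>x. G x * cos (N n * x $ l))) \<longlonglongrightarrow> 0"
proof -
  define e :: "real^3" where "e = axis l 1"
  define h where "h n = pi * inverse (N n)" for n
  have N0: "0 < N n" for n using N(1)[of n] by linarith
  have h: "0 \<le> h n" "h n \<le> pi" for n
    using N(1)[of n] N0[of n] by (auto simp: h_def field_simps)
  have h0: "h \<longlonglongrightarrow> 0" unfolding h_def using tendsto_mult_left[OF N(2), of pi] by simp
  obtain B where B: "\<And>x. \<bar>G x\<bar> \<le> B"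
  proof -
    have "compact (G ` K)"
      using c K(1) compact_continuous_image continuous_on_subset[OF c subset_UNIV] by blast
    then obtain B where B: "\<forall>y\<in>G ` K. norm y \<le> B"
      using compact_imp_bounded bounded_iff by metis
    have "\<bar>G x\<bar> \<le> max B 0" for x
      using B K(2)[of x] by (cases "x \<in> K") auto
    then show ?thesis using that by blast
  qed
  obtain R where R: "K \<subseteq> cball 0 R"
    using compact_imp_bounded[OF K(1)] by (auto simp: bounded_iff subset_iff)
  have cs: "continuous_on UNIV (\<lambda>x. G (h n *\<^sub>R e + x))" for n
    by (rule continuous_on_compose2[OF c]) (auto intro!: continuous_intros)
  have z: "G (h n *\<^sub>R e + x) = 0" "G x = 0" if "x \<notin> cball 0 (R + pi)" for n x
  proof -
    have "norm x \<le> norm (h n *\<^sub>R e + x) + norm (h n *\<^sub>R e)"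
      by (metis add.commute add_diff_cancel_left' norm_triangle_ineq4)
    moreover have "norm (h n *\<^sub>R e) \<le> pi" using h[of n] by (simp add: e_def)
    ultimately have "norm (h n *\<^sub>R e + x) > R" using that by simp
    then show "G (h n *\<^sub>R e + x) = 0" using R by (intro K(2)) auto
    have "norm x > R" using that pi_gt_zero by (simp del: pi_gt_zero)
    then show "G x = 0" using R by (intro K(2)) auto
  qed
  have bound: "norm (integral\<^sup>L lborel (\<lambda>x. G x * cos (N n * x $ l))) \<le>
      integral\<^sup>L lborel (\<lambda>x. \<bar>G x - G (h n *\<^sub>R e + x)\<bar>)" for n
  proof -
    let ?I = "integral\<^sup>L lborel (\<lambda>x. G x * cos (N n * x $ l))"
    have cg: "continuous_on UNIV (\<lambda>x. G x * cos (N n * x $ l))"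
      by (intro continuous_intros c)
    have cos: "cos (N n * (h n *\<^sub>R e + x) $ l) = - cos (N n * x $ l)" for x
    proof -
      have "N n * (h n *\<^sub>R e + x) $ l = N n * x $ l + pi"
        using N0[of n] by (simp add: e_def h_def field_simps)
      then show ?thesis by simp
    qed
    have "?I = integral\<^sup>L lborel (\<lambda>x. - (G (h n *\<^sub>R e + x) * cos (N n * x $ l)))"
      using integral_lborel_translate[OF cg, of "h n *\<^sub>R e"] unfolding cos by simp
    then have "?I + ?I = ?I + integral\<^sup>L lborel (\<lambda>x. - (G (h n *\<^sub>R e + x) * cos (N n * x $ l)))"
      by simp
    also have "\<dots> = integral\<^sup>L lborel (\<lambda>x. G x * cos (N n * x $ l) + - (G (h n *\<^sub>R e + x) * cos (N n * x $ l)))"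
      by (rule Bochner_Integration.integral_add[symmetric])
        (auto intro!: integrable_compact_support(1)[OF _ compact_cball, of _ 0 "R + pi"] continuous_intros c cs simp: z)
    finally have e: "2 * ?I = integral\<^sup>L lborel (\<lambda>x. (G x - G (h n *\<^sub>R e + x)) * cos (N n * x $ l))"
      by (simp add: left_diff_distrib)
    have "\<bar>2 * ?I\<bar> \<le> integral\<^sup>L lborel (\<lambda>x. \<bar>(G x - G (h n *\<^sub>R e + x)) * cos (N n * x $ l)\<bar>)"
      unfolding e by (rule integral_abs_bound)
    also have "\<dots> \<le> integral\<^sup>L lborel (\<lambda>x. \<bar>G x - G (h n *\<^sub>R e + x)\<bar>)"
      by (rule integral_mono; (rule integrable_compact_support(1)[OF _ compact_cball, of _ 0 "R + pi"])?)
        (auto intro!: continuous_intros c cs simp: z abs_mult mult_left_le)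
    finally show ?thesis by simp
  qed
  have "(\<lambda>n. integral\<^sup>L lborel (\<lambda>x. \<bar>G x - G (h n *\<^sub>R e + x)\<bar>)) \<longlonglongrightarrow> integral\<^sup>L lborel (\<lambda>x::real^3. 0)"
  proof (rule integral_dominated_convergence[where w = "\<lambda>x. (2 * B) * indicator (cball 0 (R + pi)) x"])
    show "(\<lambda>x. \<bar>G x - G (h n *\<^sub>R e + x)\<bar>) \<in> borel_measurable lborel" for n
      by (simp, rule borel_measurable_continuous_onI) (intro continuous_intros c cs)
    show "integrable lborel (\<lambda>x::real^3. (2 * B) * indicator (cball 0 (R + pi)) x)"
      by (intro integrable_mult_right integrable_real_indicator) (use emeasure_bounded_finite[OF bounded_cball] in auto)
    show "AE x in lborel. (\<lambda>n. \<bar>G x - G (h n *\<^sub>R e + x)\<bar>) \<longlonglongrightarrow> 0"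
    proof (rule AE_I2)
      fix x
      have "(\<lambda>n. h n *\<^sub>R e + x) \<longlonglongrightarrow> 0 *\<^sub>R e + x" by (intro tendsto_intros h0)
      moreover have "isCont G (0 *\<^sub>R e + x)" using c continuous_on_eq_continuous_at open_UNIV by blast
      ultimately have "(\<lambda>n. G (h n *\<^sub>R e + x)) \<longlonglongrightarrow> G (0 *\<^sub>R e + x)"
        using isCont_tendsto_compose by blast
      then have "(\<lambda>n. \<bar>G x - G (h n *\<^sub>R e + x)\<bar>) \<longlonglongrightarrow> \<bar>G x - G (0 *\<^sub>R e + x)\<bar>"
        by (intro tendsto_intros)
      then show "(\<lambda>n. \<bar>G x - G (h n *\<^sub>R e + x)\<bar>) \<longlonglongrightarrow> 0" by simp
    qed
    show "AE x in lborel. norm \<bar>G x - G (h n *\<^sub>R e + x)\<bar> \<le> (2 * B) * indicator (cball 0 (R + pi)) x" for n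
    proof (rule AE_I2)
      fix x
      show "norm \<bar>G x - G (h n *\<^sub>R e + x)\<bar> \<le> (2 * B) * indicator (cball 0 (R + pi)) x"
        using B[of x] B[of "h n *\<^sub>R e + x"] z(1)[of x n] z(2)[of x]
        by (cases "x \<in> cball 0 (R + pi)") (auto simp del: mem_cball)
    qed
  qed simp
  then have lim: "(\<lambda>n. integral\<^sup>L lborel (\<lambda>x. \<bar>G x - G (h n *\<^sub>R e + x)\<bar>)) \<longlonglongrightarrow> 0" by simp
  show ?thesis
    by (rule Lim_null_comparison[OF always_eventually lim]) (use bound in blast)
qed

text \<open>The weight is continuous and can be absorbed into the amplitude.\<close>

lemma Riemann_Lebesgue:
  fixes F :: "real^3 \<Rightarrow> real"
  assumes \<Omega>: "open \<Omega>" and c: "continuous_on UNIV F" and K: "compact K" "K \<subseteq> \<Omega>" "\<And>x. x \<notin> K \<Longrightarrow> F x = 0"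
    and N: "\<And>n. 1 \<le> N n" "(\<lambda>n. inverse (N n)) \<longlonglongrightarrow> 0"
  shows "(\<lambda>n. integral\<^sup>L (wmeasure \<Omega>) (\<lambda>x. F x * cos (N n * x $ l))) \<longlonglongrightarrow> 0"
proof -
  have \<Omega>m: "\<Omega> \<in> sets lebesgue" using \<Omega> by (simp add: lborelD)
  have "integral\<^sup>L (wmeasure \<Omega>) (\<lambda>x. F x * cos (N n * x $ l)) =
      integral\<^sup>L lborel (\<lambda>x. (weight x * F x) * cos (N n * x $ l))" for n
  proof -
    have cF: "continuous_on A (\<lambda>x. F x * cos (N n * x $ l))" for A
      by (intro continuous_intros continuous_on_subset[OF c]) auto
    have "integral\<^sup>L (wmeasure \<Omega>) (\<lambda>x. F x * cos (N n * x $ l)) =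
        integral\<^sup>L (lebesgue_on \<Omega>) (\<lambda>x. weight x * (F x * cos (N n * x $ l)))"
      by (rule integral_wmeasure) (rule continuous_imp_measurable_on_sets_lebesgue[OF cF \<Omega>m])
    also have "\<dots> = integral\<^sup>L lborel (\<lambda>x. weight x * (F x * cos (N n * x $ l)))"
      by (rule integral_lebesgue_on_eq_lborel[OF _ \<Omega>m])
        (use K in \<open>auto intro!: continuous_on_mult continuous_on_weight cF\<close>)
    finally show ?thesis by (simp add: mult.assoc)
  qed
  moreover have "(\<lambda>n. integral\<^sup>L lborel (\<lambda>x. (weight x * F x) * cos (N n * x $ l))) \<longlonglongrightarrow> 0"
    by (rule Riemann_Lebesgue_lborel[OF _ K(1) _ N]) (use K(3) in \<open>auto intro!: continuous_on_mult continuous_on_weight c\<close>)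
  ultimately show ?thesis by simp
qed

section \<open>Localized plane waves\<close>

definition l1 :: "real^3^3 \<Rightarrow> real" where
  "l1 z = (\<Sum>i\<in>UNIV. \<Sum>j\<in>UNIV. \<bar>z $ i $ j\<bar>)"

lemma l1_nonneg: "0 \<le> l1 z"
  by (simp add: l1_def sum_nonneg)

lemma l1_triangle: "l1 (z + z') \<le> l1 z + l1 z'"
  unfolding l1_def sum.distrib[symmetric] by (intro sum_mono) (simp add: abs_triangle_ineq)

lemma l1_scaleR: "l1 (c *\<^sub>R z) = \<bar>c\<bar> * l1 z"
  by (simp add: l1_def sum_distrib_left abs_mult)

lemma continuous_on_l1: "continuous_on A l1"
  unfolding l1_def by (intro continuous_intros)

lemma norm_le_l1: "norm z \<le> l1 z"
proof -
  have "norm z \<le> (\<Sum>i\<in>UNIV. norm (z $ i))"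
    unfolding norm_vec_def by (rule L2_set_le_sum) simp
  also have "\<dots> \<le> l1 z"
    unfolding l1_def by (intro sum_mono norm_le_l1_cart)
  finally show ?thesis .
qed

lemma abs_entry_le_norm: "\<bar>z $ i $ j\<bar> \<le> norm z" for z :: "real^3^3"
  using component_le_norm_cart[of "z $ i" j] Finite_Cartesian_Product.norm_nth_le[of z i] by linarith

lemma l1_le_norm: "l1 z \<le> 9 * norm z"
proof -
  have "l1 z \<le> (\<Sum>i\<in>(UNIV::3 set). \<Sum>j\<in>(UNIV::3 set). norm z)"
    unfolding l1_def by (intro sum_mono abs_entry_le_norm)
  then show ?thesis by simp
qed

text \<open>\<open>z + \<tau> b\<close> is a convex combination of \<open>z + b\<close> and
  \<open>z - b\<close>. An oscillation with profile in [-1, 1] thus respects the constraint as soon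
  as its two extreme values do.\<close>

lemma l1_segment:
  assumes "l1 (z + b) \<le> m" "l1 (z - b) \<le> m" "\<bar>\<tau>\<bar> \<le> 1"
  shows "l1 (z + \<tau> *\<^sub>R b) \<le> m"
proof -
  have "z + \<tau> *\<^sub>R b = ((1 + \<tau>) / 2) *\<^sub>R (z + b) + ((1 - \<tau>) / 2) *\<^sub>R (z - b)"
    by (simp add: vec_eq_iff field_simps)
  then have "l1 (z + \<tau> *\<^sub>R b) \<le> l1 (((1 + \<tau>) / 2) *\<^sub>R (z + b)) + l1 (((1 - \<tau>) / 2) *\<^sub>R (z - b))"
    using l1_triangle by metis
  also have "\<dots> = ((1 + \<tau>) / 2) * l1 (z + b) + ((1 - \<tau>) / 2) * l1 (z - b)"
    using assms(3) by (simp add: l1_scaleR)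
  also have "\<dots> \<le> ((1 + \<tau>) / 2) * m + ((1 - \<tau>) / 2) * m"
    using assms by (intro add_mono mult_left_mono) auto
  also have "\<dots> = m" by (simp add: field_simps)
  finally show ?thesis .
qed

lemma integrable_wmeasure:
  fixes f :: "real^3 \<Rightarrow> 'b::{banach, second_countable_topology}"
  assumes \<Omega>: "open \<Omega>" and c: "f \<in> borel_measurable (lebesgue_on \<Omega>)" and b: "\<And>x. x \<in> \<Omega> \<Longrightarrow> norm (f x) \<le> B"
  shows "integrable (wmeasure \<Omega>) f"
proof -
  interpret finite_measure "wmeasure \<Omega>"
    by (rule finite_measure_wmeasure) (use \<Omega> in \<open>simp add: lborelD\<close>)
  show ?thesis
    by (rule integrable_const_bound[where B = B]) (use b c in \<open>auto simp: borel_measurable_wmeasure intro!: AE_I2\<close>)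
qed

lemma integrable_wmeasure_continuous:
  fixes f :: "real^3 \<Rightarrow> 'b::euclidean_space"
  assumes \<Omega>: "open \<Omega>" and c: "continuous_on \<Omega> f" and b: "\<And>x. x \<in> \<Omega> \<Longrightarrow> norm (f x) \<le> B"
  shows "integrable (wmeasure \<Omega>) f"
  by (rule integrable_wmeasure[OF \<Omega> _ b])
    (rule continuous_imp_measurable_on_sets_lebesgue[OF c], use \<Omega> in \<open>simp add: lborelD\<close>)

text \<open>The fields are continuous only on \<Omega>, whereas the oscillation lemma wants
  amplitudes on the whole space. The two open sets \<Omega> and \<open>- K\<close> cover it, and the
  product is continuous on each.\<close>

lemma continuous_on_cutoff_mult:
  fixes f \<eta> :: "real^3 \<Rightarrow> real"
  assumes "open \<Omega>" "continuous_on \<Omega> f" "continuous_on UNIV \<eta>"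
    "closed K" "K \<subseteq> \<Omega>" "\<And>x. x \<notin> K \<Longrightarrow> \<eta> x = 0"
  shows "continuous_on UNIV (\<lambda>x. \<eta> x * f x)"
proof -
  have "continuous_on \<Omega> (\<lambda>x. \<eta> x * f x)"
    by (intro continuous_on_mult assms continuous_on_subset[OF assms(3)]) auto
  moreover have "continuous_on (- K) (\<lambda>x. \<eta> x * f x) \<longleftrightarrow> continuous_on (- K) (\<lambda>x. 0::real)"
    by (rule continuous_on_cong) (use assms(6) in auto)
  ultimately have "continuous_on (\<Omega> \<union> - K) (\<lambda>x. \<eta> x * f x)"
    using assms by (intro continuous_on_open_Un) auto
  moreover have "\<Omega> \<union> - K = UNIV" using assms(5) by auto
  ultimately show ?thesis by simp
qed

lemma neutralD:
  assumes "neutral \<Omega> \<phi>"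
  shows "continuous_on UNIV \<phi>" "\<exists>C\<ge>0. \<forall>x. norm (\<phi> x) \<le> C"
proof -
  from assms obtain K where K: "compact K" "\<forall>x. x \<notin> K \<longrightarrow> \<phi> x = 0" and c: "continuous_on UNIV \<phi>"
    unfolding neutral_def by blast
  show "continuous_on UNIV \<phi>" by (rule c)
  have "compact (\<phi> ` K)"
    using K(1) compact_continuous_image continuous_on_subset[OF c subset_UNIV] by blast
  then obtain B where B: "\<forall>y\<in>\<phi> ` K. norm y \<le> B"
    using compact_imp_bounded bounded_iff by metis
  have "norm (\<phi> x) \<le> max B 0" for x
    using B K(2) by (cases "x \<in> K") auto
  then show "\<exists>C\<ge>0. \<forall>x. norm (\<phi> x) \<le> C" by (intro exI[of _ "max B 0"]) auto
qed

text \<open>If the potential oscillates in the direction \<open>e\<^sub>l\<close>, the wave is, up to order \<open>1 / N\<close>, an oscillating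
  multiple of the single matrix entry \<open>(i, j)\<close>.\<close>

lemma wave_modulated:
  assumes B: "\<And>k. smooth1 (B k)" and N: "N \<noteq> 0" and jl: "j \<noteq> l"
  defines "a \<equiv> B(l := \<lambda>t. B l t * (inverse N * sin (N * t)))"
  shows "smooth1 (a k)" "prodfn a x = prodfn B x * (inverse N * sin (N * x $ l))"
    "wave a i j l x = (prodfn B x * cos (N * x $ l)) *\<^sub>R axis i (axis j 1) + (inverse N * sin (N * x $ l)) *\<^sub>R wave B i j l x"
proof -
  show "smooth1 (a k)"
    using B by (auto simp: a_def intro!: smooth1_mult smooth1_sin)
  have pull: "prodfn (b(l := \<lambda>t. b l t * g t)) x = prodfn b x * g (x $ l)" for b :: "3 \<Rightarrow> real \<Rightarrow> real" and g
  proof -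
    have "(\<Prod>i\<in>UNIV - {l}. (b(l := \<lambda>t. b l t * g t)) i (x $ i)) = (\<Prod>i\<in>UNIV - {l}. b i (x $ i))"
      by (rule prod.cong) auto
    then show ?thesis
      unfolding prodfn_def by (subst (1 2) prod.remove[of UNIV l]) auto
  qed
  show "prodfn a x = prodfn B x * (inverse N * sin (N * x $ l))"
    unfolding a_def by (rule pull)
  have "deriv (\<lambda>t. B l t * (inverse N * sin (N * t))) =
    (\<lambda>t. deriv (B l) t * (inverse N * sin (N * t)) + B l t * cos (N * t))"
    by (intro ext DERIV_imp_deriv) (use N in \<open>auto intro!: derivative_eq_intros smooth1_deriv(1)[OF B]\<close>)
  then have 1: "prodfn (a(l := deriv (a l))) x =
      prodfn (B(l := deriv (B l))) x * (inverse N * sin (N * x $ l)) + prodfn B x * cos (N * x $ l)"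
  proof -
    have "prodfn (B(l := f)) x = f (x $ l) * (\<Prod>i\<in>UNIV - {l}. B i (x $ i))" for f
    proof -
      have "(\<Prod>i\<in>UNIV - {l}. (B(l := f)) i (x $ i)) = (\<Prod>i\<in>UNIV - {l}. B i (x $ i))"
        by (rule prod.cong) auto
      then show ?thesis unfolding prodfn_def by (subst prod.remove[of UNIV l]) auto
    qed
    from this[of "\<lambda>t. deriv (B l) t * (inverse N * sin (N * t)) + B l t * cos (N * t)"]
      this[of "deriv (B l)"] this[of "B l"] show ?thesis
      unfolding a_def \<open>deriv _ = _\<close>[symmetric] fun_upd_upd fun_upd_same fun_upd_triv
      by (simp add: \<open>deriv _ = _\<close> algebra_simps)
  qed
  \<comment> \<open>As \<open>j\<close> differs from \<open>l\<close>, the derivative in direction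
    \<open>j\<close> never hits the oscillating factor, and the term keeps its
    \<open>1 / N\<close>.\<close>
  have "a(j := deriv (a j)) = (B(j := deriv (B j)))(l := \<lambda>t. (B(j := deriv (B j))) l t * (inverse N * sin (N * t)))"
    using jl by (auto simp: a_def fun_eq_iff)
  then have 2: "prodfn (a(j := deriv (a j))) x = prodfn (B(j := deriv (B j))) x * (inverse N * sin (N * x $ l))"
    using pull[of "B(j := deriv (B j))" "\<lambda>t. inverse N * sin (N * t)"] by metis
  show "wave a i j l x = (prodfn B x * cos (N * x $ l)) *\<^sub>R axis i (axis j 1) + (inverse N * sin (N * x $ l)) *\<^sub>R wave B i j l x"
    unfolding wave_def 1 2 by (simp add: vec_eq_iff axis_def algebra_simps)
qed

text \<open>Meant for a wave \<phi> and its leading part \<psi>: after expanding around \<psi>, the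
  square of the small difference is dropped because it is nonnegative, and the mixed term is bounded
  by Cauchy-Schwarz.\<close>

lemma norm_add_sq_lower:
  fixes z \<phi> \<psi> :: "'a::real_inner"
  assumes "norm z \<le> M" "norm \<psi> \<le> b" "norm (\<phi> - \<psi>) \<le> e"
  shows "(norm (z + \<phi>))\<^sup>2 \<ge> (norm z)\<^sup>2 + 2 * (z \<bullet> \<psi>) + (norm \<psi>)\<^sup>2 - 2 * (M + b) * e"
proof -
  define d where "d = \<phi> - \<psi>"
  have "(norm (z + \<phi>))\<^sup>2 = (norm z)\<^sup>2 + 2 * (z \<bullet> \<psi>) + (norm \<psi>)\<^sup>2 + 2 * ((z + \<psi>) \<bullet> d) + (norm d)\<^sup>2"
    unfolding d_def power2_norm_eq_inner by (simp add: inner_commute algebra_simps inner_diff_left inner_diff_right inner_add_left inner_add_right)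
  moreover have "\<bar>(z + \<psi>) \<bullet> d\<bar> \<le> (M + b) * e"
  proof -
    have "\<bar>(z + \<psi>) \<bullet> d\<bar> \<le> norm (z + \<psi>) * norm d" by (rule Cauchy_Schwarz_ineq2)
    also have "\<dots> \<le> (M + b) * e"
      using assms norm_triangle_ineq[of z \<psi>] order_trans[OF norm_ge_zero assms(1)] order_trans[OF norm_ge_zero assms(2)]
      by (intro mult_mono) (auto simp: d_def)
    finally show ?thesis .
  qed
  moreover have "0 \<le> (norm d)\<^sup>2" by simp
  ultimately show ?thesis unfolding mult.assoc[of 2] by linarith
qed

lemma abs_inner_le_mult:
  fixes x y :: "'a::real_inner"
  assumes "norm x \<le> A" "norm y \<le> B"
  shows "\<bar>x \<bullet> y\<bar> \<le> A * B"
  using Cauchy_Schwarz_ineq2[of x y] mult_mono[OF assms order_trans[OF norm_ge_zero assms(1)] norm_ge_zero]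
  by linarith

text \<open>Two column indices never exhaust the three coordinates. In the remaining direction both
  entries can oscillate in phase without creating divergence at leading order.\<close>

lemma exists_third_index: "\<exists>l::3. l \<noteq> j \<and> l \<noteq> j'"
proof -
  have "card {j, j'} < CARD(3)" by (simp add: card_insert_if)
  then have "{j, j'} \<noteq> UNIV" by (metis less_irrefl)
  then show ?thesis by blast
qed

text \<open>To leading order the perturbation is \<open>\<eta> x * cos (N * x $ l)\<close> times
  \<open>b\<close>. For large \<open>N\<close> the terms linear in the cosine disappear from the
  integrals, while its square has mean 1/2; this is the factor in the gain. Everything else is of
  order \<open>1 / N\<close>. The field \<open>z0\<close> is kept separate from \<open>z\<close>
  because several perturbations are added within one stage, and all of them must be almost
  orthogonal to the field at the start of that stage.\<close>

lemma local_perturbation: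
  fixes z z0 :: "real^3 \<Rightarrow> real^3^3"
  assumes \<Omega>: "open \<Omega>" and r: "0 < r" "cball x0 r \<subseteq> \<Omega>"
    and z: "continuous_on \<Omega> z" "\<And>x. x \<in> \<Omega> \<Longrightarrow> l1 (z x) < M"
    and z0: "continuous_on \<Omega> z0" "\<And>x. x \<in> \<Omega> \<Longrightarrow> norm (z0 x) \<le> M0"
    and b: "b = s *\<^sub>R axis i (axis j 1) + t *\<^sub>R axis i' (axis j' 1)"
    and seg: "\<And>y. y \<in> cball x0 r \<Longrightarrow> l1 (z y + b) < M" "\<And>y. y \<in> cball x0 r \<Longrightarrow> l1 (z y - b) < M"
    and \<epsilon>: "0 < \<epsilon>"
  obtains \<phi> where "neutral \<Omega> \<phi>" "\<And>y. y \<notin> ball x0 r \<Longrightarrow> \<phi> y = 0"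
    "\<And>y. y \<in> \<Omega> \<Longrightarrow> l1 (z y + \<phi> y) < M"
    "\<bar>\<integral>y. z0 y \<bullet> \<phi> y \<partial>wmeasure \<Omega>\<bar> \<le> \<epsilon>"
    "(\<integral>y. (norm (z y + \<phi> y))\<^sup>2 \<partial>wmeasure \<Omega>) \<ge> (\<integral>y. (norm (z y))\<^sup>2 \<partial>wmeasure \<Omega>)
       + (norm b)\<^sup>2 / 2 * measure (wmeasure \<Omega>) (cbox (x0 - vec (r / 4)) (x0 + vec (r / 4))) - \<epsilon>"
proof -
  have \<Omega>m: "\<Omega> \<in> sets lebesgue" using \<Omega> by (simp add: lborelD)
  interpret finite_measure "wmeasure \<Omega>" by (rule finite_measure_wmeasure[OF \<Omega>m])
  note integrable' = integrable_wmeasure_continuous[OF \<Omega>]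
  obtain l where l: "j \<noteq> l" "j' \<noteq> l" using exists_third_index[of j j'] by metis
  \<comment> \<open>The cutoff is 1 on the cube of half side \<open>h\<close> and 0 outside that of
    half side \<open>2 * h\<close>. The corners of the latter have distance
    \<open>2 * h * sqrt 3 < r\<close> from the centre.\<close>
  define h where "h = r / 4"
  have h: "0 < h" using r by (simp add: h_def)
  define B where "B k t = plateau ((t - x0 $ k) / h)" for k t
  have Bs: "smooth1 (B k)" for k
  proof -
    have "B k = (\<lambda>t. plateau (inverse h * t + (- x0 $ k / h)))"
      by (auto simp: B_def fun_eq_iff field_simps diff_divide_distrib)
    then show ?thesis using smooth1_affine[OF smooth1_plateau] by metis
  qed
  define \<eta> where "\<eta> = prodfn B"
  define Q where "Q = cbox (x0 - vec (2 * h)) (x0 + vec (2 * h))"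
  have \<eta>c: "continuous_on A \<eta>" for A
    unfolding \<eta>_def using prodfn_continuous[of B, OF Bs] continuous_on_subset by blast
  have \<eta>b: "0 \<le> \<eta> x" "\<eta> x \<le> 1" for x
    unfolding \<eta>_def prodfn_def B_def by (auto intro!: prod_nonneg prod_le_1 plateau_bounds)
  have \<eta>0: "\<eta> x = 0" if "x \<notin> Q" for x
  proof -
    from that obtain k where "\<not> ((x0 - vec (2 * h)) $ k \<le> x $ k \<and> x $ k \<le> (x0 + vec (2 * h)) $ k)"
      unfolding Q_def mem_box_cart by blast
    then have "2 * h < \<bar>x $ k - x0 $ k\<bar>" by (auto simp: abs_if)
    then have "B k (x $ k) = 0" unfolding B_def using h by (intro plateau_eq_0) (simp add: field_simps abs_divide)
    then show ?thesis unfolding \<eta>_def prodfn_def by (auto intro!: prod_zero)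
  qed
  have \<eta>1: "\<eta> x = 1" if "x \<in> cbox (x0 - vec h) (x0 + vec h)" for x
  proof -
    have "B k (x $ k) = 1" for k
    proof -
      have "x0 $ k - h \<le> x $ k" "x $ k \<le> x0 $ k + h"
        using that by (auto simp: mem_box_cart)
      then have "\<bar>x $ k - x0 $ k\<bar> \<le> h" by (intro abs_leI) simp_all
      then show ?thesis unfolding B_def using h by (intro plateau_eq_1) (simp add: abs_divide)
    qed
    then show ?thesis unfolding \<eta>_def prodfn_def by simp
  qed
  have Qb: "Q \<subseteq> ball x0 r"
  proof
    fix y assume y: "y \<in> Q"
    have "\<bar>(y - x0) $ i\<bar> \<le> 2 * h" for i
    proof -
      have "x0 $ i - 2 * h \<le> y $ i" "y $ i \<le> x0 $ i + 2 * h"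
        using y by (auto simp: mem_box_cart Q_def)
      then show ?thesis by (intro abs_leI) simp_all
    qed
    then have "norm (y - x0) \<le> sqrt (\<Sum>i\<in>(UNIV::3 set). (2 * h)\<^sup>2)"
      unfolding norm_vec_def L2_set_def by (intro real_sqrt_le_mono sum_mono) (metis norm_ge_zero power_mono real_norm_def)
    also have "\<dots> < r"
      using h by (intro real_less_lsqrt) (auto simp: h_def power2_eq_square)
    finally show "y \<in> ball x0 r" by (simp add: dist_norm norm_minus_commute)
  qed
  have Qc: "compact Q" "Q \<subseteq> \<Omega>"
    using order_trans[OF Qb order_trans[OF ball_subset_cball r(2)]] by (simp_all add: Q_def)
  \<comment> \<open>The waves of the unmodulated potential: up to the factor \<open>sin / N\<close>,
    this is the difference between the exact wave and its leading part.\<close>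
  define w where "w x = s *\<^sub>R wave B i j l x + t *\<^sub>R wave B i' j' l x" for x
  have wn: "neutral \<Omega> w" unfolding w_def
    by (intro neutral_add neutral_scaleR neutral_wave[OF \<Omega> Bs Qc] \<Omega>) (use \<eta>0 in \<open>auto simp: \<eta>_def\<close>)
  obtain C where C: "0 \<le> C" "\<And>x. norm (w x) \<le> C" using neutralD(2)[OF wn] by blast
  define N where "N n = real (Suc n)" for n
  have N: "0 < N n" "1 \<le> N n" for n by (simp_all add: N_def)
  have N0: "(\<lambda>n. inverse (N n)) \<longlonglongrightarrow> 0" unfolding N_def by (rule LIMSEQ_inverse_real_of_nat)
  define a where "a n = B(l := \<lambda>u. B l u * (inverse (N n) * sin (N n * u)))" for n
  define \<phi> where "\<phi> n x = s *\<^sub>R wave (a n) i j l x + t *\<^sub>R wave (a n) i' j' l x" for n x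
  define \<psi> where "\<psi> n x = (\<eta> x * cos (N n * x $ l)) *\<^sub>R b" for n x
  have Nn: "N n \<noteq> 0" for n using N(1)[of n] by simp
  note wm = wave_modulated[of B, OF Bs Nn]
  have \<phi>n: "neutral \<Omega> (\<phi> n)" for n
    unfolding \<phi>_def a_def
    by (intro neutral_add neutral_scaleR neutral_wave[OF \<Omega> _ Qc] \<Omega> wm(1)[OF l(1)])
      (use \<eta>0 in \<open>auto simp: \<eta>_def wm(2)[OF l(1)]\<close>)
  have \<phi>eq: "\<phi> n x = \<psi> n x + (inverse (N n) * sin (N n * x $ l)) *\<^sub>R w x" for n x
    unfolding \<phi>_def a_def wm(3)[OF l(1)] wm(3)[OF l(2)] \<psi>_def b w_def \<eta>_def
    by (simp add: scaleR_add_right algebra_simps)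
  have w0: "w x = 0" if "x \<notin> Q" for x
  proof -
    have "prodfn (B(k := deriv (B k))) x = 0" for k
      using partial_deriv_zero[of "- Q" "prodfn B" x k] Qc that \<eta>0 compact_imp_closed
      by (auto simp: partial_deriv_prodfn[OF Bs] \<eta>_def)
    then show ?thesis by (simp add: w_def wave_def vec_eq_iff axis_def)
  qed
  have \<phi>0: "\<phi> n x = 0" if "x \<notin> Q" for n x
    using that by (simp add: \<phi>eq \<psi>_def \<eta>0 w0)
  have \<phi>\<psi>: "norm (\<phi> n x - \<psi> n x) \<le> C * inverse (N n)" for n x
  proof -
    have "norm (\<phi> n x - \<psi> n x) = inverse (N n) * \<bar>sin (N n * x $ l)\<bar> * norm (w x)"
      using N(1)[of n] by (simp add: \<phi>eq abs_mult)
    also have "\<dots> \<le> inverse (N n) * 1 * C"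
      using N(1)[of n] C by (intro mult_mono) auto
    finally show ?thesis by (simp add: mult.commute)
  qed
  have \<psi>b: "norm (\<psi> n x) \<le> norm b" for n x
  proof -
    have "\<bar>\<eta> x * cos (N n * x $ l)\<bar> \<le> 1 * 1"
      unfolding abs_mult using \<eta>b[of x] by (intro mult_mono) auto
    then show ?thesis unfolding \<psi>_def by (simp add: mult_left_le_one_le)
  qed
  have Mz: "norm (z x) \<le> M" if "x \<in> \<Omega>" for x
    using z(2)[OF that] norm_le_l1[of "z x"] by linarith
  have ev1: "\<forall>\<^sub>F n in sequentially. \<forall>y\<in>\<Omega>. l1 (z y + \<phi> n y) < M"
  proof -
    have zc: "continuous_on (cball x0 r) z" using z(1) r continuous_on_subset by blast
    have "continuous_on (cball x0 r) (\<lambda>y. max (l1 (z y + b)) (l1 (z y - b)))"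
      by (intro continuous_on_max continuous_on_compose2[OF continuous_on_l1[of UNIV]] continuous_intros zc) auto
    \<comment> \<open>By compactness the strict constraint has a uniform margin \<open>M - m\<close>
      on the ball, which absorbs the error of order \<open>1 / N\<close>.\<close>
    from continuous_attains_sup[OF compact_cball _ this] r(1)
    obtain y0 where y0: "y0 \<in> cball x0 r"
        "\<And>y. y \<in> cball x0 r \<Longrightarrow> max (l1 (z y + b)) (l1 (z y - b)) \<le> max (l1 (z y0 + b)) (l1 (z y0 - b))"
      by auto
    define m where "m = max (l1 (z y0 + b)) (l1 (z y0 - b))"
    have m: "m < M" using seg[OF y0(1)] by (simp add: m_def)
    have "(\<lambda>n. 9 * (C * inverse (N n))) \<longlonglongrightarrow> 9 * (C * 0)" by (intro tendsto_intros N0)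
    then have "\<forall>\<^sub>F n in sequentially. 9 * (C * inverse (N n)) < M - m"
      using m by (intro order_tendstoD(2)[where y = 0]) auto
    then show ?thesis
    proof eventually_elim
      case (elim n)
      show ?case
      proof
        fix y assume y: "y \<in> \<Omega>"
        show "l1 (z y + \<phi> n y) < M"
        proof (cases "y \<in> cball x0 r")
          case True
          have "\<bar>\<eta> y * cos (N n * y $ l)\<bar> \<le> 1 * 1"
            unfolding abs_mult using \<eta>b[of y] by (intro mult_mono) auto
          then have "l1 (z y + \<psi> n y) \<le> m"
            unfolding \<psi>_def using y0(2)[OF True] by (intro l1_segment) (auto simp: m_def)
          moreover have "l1 (\<phi> n y - \<psi> n y) \<le> 9 * (C * inverse (N n))"
            using l1_le_norm[of "\<phi> n y - \<psi> n y"] \<phi>\<psi>[of n y] by linarith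
          moreover have "l1 (z y + \<phi> n y) \<le> l1 (z y + \<psi> n y) + l1 (\<phi> n y - \<psi> n y)"
            using l1_triangle[of "z y + \<psi> n y" "\<phi> n y - \<psi> n y"] by (simp add: algebra_simps)
          ultimately show ?thesis using elim by linarith
        next
          case False
          then have "\<phi> n y = 0" using Qb ball_subset_cball[of x0 r] by (intro \<phi>0) blast
          then show ?thesis using z(2)[OF y] by simp
        qed
      qed
    qed
  qed
  have cont0: "continuous_on UNIV (\<lambda>x. \<eta> x * (f x \<bullet> b))" if "continuous_on \<Omega> f" for f :: "real^3 \<Rightarrow> real^3^3"
    by (rule continuous_on_cutoff_mult[OF \<Omega> _ \<eta>c compact_imp_closed[OF Qc(1)] Qc(2) \<eta>0])
      (intro continuous_intros that)
  have RL: "(\<lambda>n. \<integral>x. \<eta> x * (f x \<bullet> b) * cos (N n * x $ l) \<partial>wmeasure \<Omega>) \<longlonglongrightarrow> 0"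
    if "continuous_on \<Omega> f" for f :: "real^3 \<Rightarrow> real^3^3"
    by (rule Riemann_Lebesgue[OF \<Omega> cont0[OF that] Qc _ N(2) N0]) (simp add: \<eta>0)
  have ev2: "\<forall>\<^sub>F n in sequentially. \<bar>\<integral>y. z0 y \<bullet> \<phi> n y \<partial>wmeasure \<Omega>\<bar> < \<epsilon>"
  proof -
    have b1: "\<bar>z0 y \<bullet> \<psi> n y\<bar> \<le> M0 * norm b" if "y \<in> \<Omega>" for n y
      by (rule abs_inner_le_mult[OF z0(2)[OF that] \<psi>b])
    have b2: "\<bar>z0 y \<bullet> (\<phi> n y - \<psi> n y)\<bar> \<le> M0 * (C * inverse (N n))" if "y \<in> \<Omega>" for n y
      by (rule abs_inner_le_mult[OF z0(2)[OF that] \<phi>\<psi>])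
    have c1: "continuous_on \<Omega> (\<psi> n)" for n
      unfolding \<psi>_def by (intro continuous_intros \<eta>c)
    have c2: "continuous_on \<Omega> (\<phi> n)" for n
      using neutralD(1)[OF \<phi>n] continuous_on_subset by blast
    have i1: "integrable (wmeasure \<Omega>) (\<lambda>y. z0 y \<bullet> \<psi> n y)" for n
      by (rule integrable'[where B = "M0 * norm b"]) (use b1 in \<open>auto intro!: continuous_intros z0 c1\<close>)
    have i2: "integrable (wmeasure \<Omega>) (\<lambda>y. z0 y \<bullet> (\<phi> n y - \<psi> n y))" for n
      by (rule integrable'[where B = "M0 * (C * inverse (N n))"]) (use b2 in \<open>auto intro!: continuous_intros z0 c1 c2\<close>)
    have bd: "\<bar>\<integral>y. z0 y \<bullet> (\<phi> n y - \<psi> n y) \<partial>wmeasure \<Omega>\<bar> \<le> M0 * (C * inverse (N n)) * measure (wmeasure \<Omega>) \<Omega>" for n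
    proof -
      have "\<bar>\<integral>y. z0 y \<bullet> (\<phi> n y - \<psi> n y) \<partial>wmeasure \<Omega>\<bar> \<le> (\<integral>y. \<bar>z0 y \<bullet> (\<phi> n y - \<psi> n y)\<bar> \<partial>wmeasure \<Omega>)"
        by (rule integral_abs_bound)
      also have "\<dots> \<le> (\<integral>y. M0 * (C * inverse (N n)) \<partial>wmeasure \<Omega>)"
        by (rule integral_mono) (use i2 b2 in auto)
      finally show ?thesis by (simp add: mult_ac)
    qed
    have "(\<lambda>n. M0 * (C * inverse (N n)) * measure (wmeasure \<Omega>) \<Omega>) \<longlonglongrightarrow> M0 * (C * 0) * measure (wmeasure \<Omega>) \<Omega>"
      by (intro tendsto_intros N0)
    then have bd0: "(\<lambda>n. M0 * (C * inverse (N n)) * measure (wmeasure \<Omega>) \<Omega>) \<longlonglongrightarrow> 0" by simp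
    have "(\<lambda>n. \<integral>y. z0 y \<bullet> (\<phi> n y - \<psi> n y) \<partial>wmeasure \<Omega>) \<longlonglongrightarrow> 0"
      by (rule Lim_null_comparison[OF always_eventually bd0]) (use bd in simp)
    from tendsto_add[OF RL[OF z0(1)] this]
    have "(\<lambda>n. \<integral>y. z0 y \<bullet> \<phi> n y \<partial>wmeasure \<Omega>) \<longlonglongrightarrow> 0"
    proof (rule Lim_transform_eventually[OF _ always_eventually, THEN tendsto_eq_rhs], intro allI)
      fix n
      have "(\<integral>x. \<eta> x * (z0 x \<bullet> b) * cos (N n * x $ l) \<partial>wmeasure \<Omega>) = (\<integral>x. z0 x \<bullet> \<psi> n x \<partial>wmeasure \<Omega>)"
        by (simp add: \<psi>_def mult_ac)
      then show "(\<integral>x. \<eta> x * (z0 x \<bullet> b) * cos (N n * x $ l) \<partial>wmeasure \<Omega>) + (\<integral>y. z0 y \<bullet> (\<phi> n y - \<psi> n y) \<partial>wmeasure \<Omega>)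
          = (\<integral>y. z0 y \<bullet> \<phi> n y \<partial>wmeasure \<Omega>)"
        using i1[of n] i2[of n] by (simp add: Bochner_Integration.integral_add[symmetric] inner_add_right[symmetric])
    qed simp
    then have "(\<lambda>n. \<bar>\<integral>y. z0 y \<bullet> \<phi> n y \<partial>wmeasure \<Omega>\<bar>) \<longlonglongrightarrow> 0" by (rule tendsto_rabs_zero)
    then show ?thesis using \<epsilon> by (rule order_tendstoD(2))
  qed
  define J where "J = (\<integral>y. (norm (z y))\<^sup>2 \<partial>wmeasure \<Omega>)"
  define P where "P = measure (wmeasure \<Omega>) (cbox (x0 - vec h) (x0 + vec h))"
  have ev3: "\<forall>\<^sub>F n in sequentially. J + (norm b)\<^sup>2 / 2 * P - \<epsilon> < (\<integral>y. (norm (z y + \<phi> n y))\<^sup>2 \<partial>wmeasure \<Omega>)"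
  proof -
    define D where "D = 2 * (M + norm b) * C"
    have c2: "continuous_on \<Omega> (\<phi> n)" for n
      using neutralD(1)[OF \<phi>n] continuous_on_subset by blast
    have i0: "integrable (wmeasure \<Omega>) (\<lambda>y. (norm (z y))\<^sup>2)"
      by (rule integrable'[where B = "M\<^sup>2"]) (use Mz in \<open>auto intro!: continuous_intros z power_mono\<close>)
    have i1: "integrable (wmeasure \<Omega>) (\<lambda>y. \<eta> y * (z y \<bullet> b) * cos (N n * y $ l))" for n
    proof (rule integrable'[where B = "M * norm b"])
      show "continuous_on \<Omega> (\<lambda>y. \<eta> y * (z y \<bullet> b) * cos (N n * y $ l))"
        by (intro continuous_intros \<eta>c z)
      fix y assume y: "y \<in> \<Omega>"
      have "\<bar>z y \<bullet> \<psi> n y\<bar> \<le> M * norm b"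
        by (rule abs_inner_le_mult[OF Mz[OF y] \<psi>b])
      then show "norm (\<eta> y * (z y \<bullet> b) * cos (N n * y $ l)) \<le> M * norm b"
        by (simp add: \<psi>_def mult_ac abs_mult)
    qed
    have i2: "integrable (wmeasure \<Omega>) (\<lambda>y. (\<eta> y)\<^sup>2)"
      by (rule integrable'[where B = 1]) (use \<eta>b in \<open>auto intro!: continuous_intros \<eta>c power_le_one\<close>)
    have i3: "integrable (wmeasure \<Omega>) (\<lambda>y. (\<eta> y)\<^sup>2 * cos ((2 * N n) * y $ l))" for n
      by (rule integrable'[where B = 1])
        (use \<eta>b in \<open>auto simp: abs_mult intro!: continuous_intros \<eta>c mult_le_one power_le_one\<close>)
    have i4: "integrable (wmeasure \<Omega>) (\<lambda>y. (norm (z y + \<phi> n y))\<^sup>2)" for n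
    proof -
      obtain C' where C': "\<And>x. norm (\<phi> n x) \<le> C'" using neutralD(2)[OF \<phi>n] by blast
      show ?thesis
        by (rule integrable'[where B = "(M + C')\<^sup>2"])
          (use Mz C' in \<open>auto intro!: continuous_intros z c2 power_mono norm_triangle_le add_mono\<close>)
    qed
    have lb: "J + 2 * (\<integral>y. \<eta> y * (z y \<bullet> b) * cos (N n * y $ l) \<partial>wmeasure \<Omega>) + (norm b)\<^sup>2 / 2 * (\<integral>y. (\<eta> y)\<^sup>2 \<partial>wmeasure \<Omega>)
       + (norm b)\<^sup>2 / 2 * (\<integral>y. (\<eta> y)\<^sup>2 * cos ((2 * N n) * y $ l) \<partial>wmeasure \<Omega>) - D * inverse (N n) * measure (wmeasure \<Omega>) \<Omega>
       \<le> (\<integral>y. (norm (z y + \<phi> n y))\<^sup>2 \<partial>wmeasure \<Omega>)" (is "?L \<le> _") for n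
    proof -
      have "?L = (\<integral>y. (norm (z y))\<^sup>2 + 2 * (\<eta> y * (z y \<bullet> b) * cos (N n * y $ l)) + (norm b)\<^sup>2 / 2 * (\<eta> y)\<^sup>2
          + (norm b)\<^sup>2 / 2 * ((\<eta> y)\<^sup>2 * cos ((2 * N n) * y $ l)) - D * inverse (N n) \<partial>wmeasure \<Omega>)"
        using i0 i1[of n] i2 i3[of n] by (simp add: J_def)
      also have "\<dots> \<le> (\<integral>y. (norm (z y + \<phi> n y))\<^sup>2 \<partial>wmeasure \<Omega>)"
      proof (rule integral_mono)
        show "integrable (wmeasure \<Omega>) (\<lambda>y. (norm (z y))\<^sup>2 + 2 * (\<eta> y * (z y \<bullet> b) * cos (N n * y $ l)) + (norm b)\<^sup>2 / 2 * (\<eta> y)\<^sup>2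
          + (norm b)\<^sup>2 / 2 * ((\<eta> y)\<^sup>2 * cos ((2 * N n) * y $ l)) - D * inverse (N n))"
          using i0 i1[of n] i2 i3[of n] by simp
        show "integrable (wmeasure \<Omega>) (\<lambda>y. (norm (z y + \<phi> n y))\<^sup>2)" by (rule i4)
        fix y assume "y \<in> space (wmeasure \<Omega>)"
        then have y: "y \<in> \<Omega>" by simp
        \<comment> \<open>The squared cosine is half of 1 plus the cosine of the doubled argument:
          the constant part is the gain, the other part oscillates away.\<close>
        have "(norm (\<psi> n y))\<^sup>2 = (norm b)\<^sup>2 / 2 * (\<eta> y)\<^sup>2 + (norm b)\<^sup>2 / 2 * ((\<eta> y)\<^sup>2 * cos ((2 * N n) * y $ l))"
        proof -
          have dbl: "cos ((2 * N n) * y $ l) = 2 * (cos (N n * y $ l))\<^sup>2 - 1"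
            using cos_double_cos[of "N n * y $ l"] by (simp add: mult.assoc)
          show ?thesis unfolding dbl by (simp add: \<psi>_def power_mult_distrib field_simps)
        qed
        moreover have "z y \<bullet> \<psi> n y = \<eta> y * (z y \<bullet> b) * cos (N n * y $ l)" by (simp add: \<psi>_def mult_ac)
        moreover have "(norm (z y))\<^sup>2 + 2 * (z y \<bullet> \<psi> n y) + (norm (\<psi> n y))\<^sup>2 - 2 * (M + norm b) * (C * inverse (N n)) \<le> (norm (z y + \<phi> n y))\<^sup>2"
          by (rule norm_add_sq_lower[OF Mz[OF y] \<psi>b \<phi>\<psi>])
        ultimately show "(norm (z y))\<^sup>2 + 2 * (\<eta> y * (z y \<bullet> b) * cos (N n * y $ l)) + (norm b)\<^sup>2 / 2 * (\<eta> y)\<^sup>2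
          + (norm b)\<^sup>2 / 2 * ((\<eta> y)\<^sup>2 * cos ((2 * N n) * y $ l)) - D * inverse (N n) \<le> (norm (z y + \<phi> n y))\<^sup>2"
          by (simp add: D_def mult.assoc)
      qed
      finally show ?thesis .
    qed
    have RL2: "(\<lambda>n. \<integral>y. (\<eta> y)\<^sup>2 * cos ((2 * N n) * y $ l) \<partial>wmeasure \<Omega>) \<longlonglongrightarrow> 0"
    proof (rule Riemann_Lebesgue[OF \<Omega> _ Qc])
      show "continuous_on UNIV (\<lambda>y. (\<eta> y)\<^sup>2)" by (intro continuous_intros \<eta>c)
      show "1 \<le> 2 * N n" for n using N(2)[of n] by simp
      have "(\<lambda>n. inverse 2 * inverse (N n)) \<longlonglongrightarrow> inverse 2 * 0" by (intro tendsto_intros N0)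
      then show "(\<lambda>n. inverse (2 * N n)) \<longlonglongrightarrow> 0" by simp
    qed (simp add: \<eta>0)
    have "(\<lambda>n. J + 2 * (\<integral>y. \<eta> y * (z y \<bullet> b) * cos (N n * y $ l) \<partial>wmeasure \<Omega>) + (norm b)\<^sup>2 / 2 * (\<integral>y. (\<eta> y)\<^sup>2 \<partial>wmeasure \<Omega>)
       + (norm b)\<^sup>2 / 2 * (\<integral>y. (\<eta> y)\<^sup>2 * cos ((2 * N n) * y $ l) \<partial>wmeasure \<Omega>) - D * inverse (N n) * measure (wmeasure \<Omega>) \<Omega>)
       \<longlonglongrightarrow> J + 2 * 0 + (norm b)\<^sup>2 / 2 * (\<integral>y. (\<eta> y)\<^sup>2 \<partial>wmeasure \<Omega>) + (norm b)\<^sup>2 / 2 * 0 - D * 0 * measure (wmeasure \<Omega>) \<Omega>"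
      by (intro tendsto_intros RL RL2 N0 z)
    moreover have "J + (norm b)\<^sup>2 / 2 * P - \<epsilon> <
        J + 2 * 0 + (norm b)\<^sup>2 / 2 * (\<integral>y. (\<eta> y)\<^sup>2 \<partial>wmeasure \<Omega>) + (norm b)\<^sup>2 / 2 * 0 - D * 0 * measure (wmeasure \<Omega>) \<Omega>"
    proof -
      have sub: "cbox (x0 - vec h) (x0 + vec h) \<subseteq> \<Omega>"
        using \<eta>1 \<eta>0 Qc(2) by (metis subsetD subsetI zero_neq_one)
      then have meas: "cbox (x0 - vec h) (x0 + vec h) \<in> sets (wmeasure \<Omega>)"
        by (simp add: sets_wmeasure sets_restrict_space_iff \<Omega>m)
      have "P = (\<integral>y. indicator (cbox (x0 - vec h) (x0 + vec h)) y \<partial>wmeasure \<Omega>)"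
        using meas sub by (simp add: P_def Int_absorb2)
      also have "\<dots> \<le> (\<integral>y. (\<eta> y)\<^sup>2 \<partial>wmeasure \<Omega>)"
      proof (rule integral_mono[OF _ i2])
        show "integrable (wmeasure \<Omega>) (indicator (cbox (x0 - vec h) (x0 + vec h)) :: _ \<Rightarrow> real)"
          using meas by (simp add: less_top[symmetric])
        show "indicator (cbox (x0 - vec h) (x0 + vec h)) y \<le> (\<eta> y)\<^sup>2" for y
          using \<eta>1[of y] by (auto simp: indicator_def)
      qed
      finally have "(norm b)\<^sup>2 / 2 * P \<le> (norm b)\<^sup>2 / 2 * (\<integral>y. (\<eta> y)\<^sup>2 \<partial>wmeasure \<Omega>)"
        by (intro mult_left_mono) auto
      then show ?thesis using \<epsilon> by simp
    qed
    ultimately have "\<forall>\<^sub>F n in sequentially. J + (norm b)\<^sup>2 / 2 * P - \<epsilon> <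
       J + 2 * (\<integral>y. \<eta> y * (z y \<bullet> b) * cos (N n * y $ l) \<partial>wmeasure \<Omega>) + (norm b)\<^sup>2 / 2 * (\<integral>y. (\<eta> y)\<^sup>2 \<partial>wmeasure \<Omega>)
       + (norm b)\<^sup>2 / 2 * (\<integral>y. (\<eta> y)\<^sup>2 * cos ((2 * N n) * y $ l) \<partial>wmeasure \<Omega>) - D * inverse (N n) * measure (wmeasure \<Omega>) \<Omega>"
      by (rule order_tendstoD(1))
    then show ?thesis by eventually_elim (rule less_le_trans[OF _ lb])
  qed
  obtain n where n: "\<forall>y\<in>\<Omega>. l1 (z y + \<phi> n y) < M" "\<bar>\<integral>y. z0 y \<bullet> \<phi> n y \<partial>wmeasure \<Omega>\<bar> < \<epsilon>"
    "J + (norm b)\<^sup>2 / 2 * P - \<epsilon> < (\<integral>y. (norm (z y + \<phi> n y))\<^sup>2 \<partial>wmeasure \<Omega>)"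
    using eventually_happens'[OF sequentially_bot eventually_conj[OF ev1 eventually_conj[OF ev2 ev3]]] by blast
  show ?thesis
  proof (rule that[of "\<phi> n"])
    show "neutral \<Omega> (\<phi> n)" by (rule \<phi>n)
    show "\<phi> n y = 0" if "y \<notin> ball x0 r" for y using that Qb by (intro \<phi>0) blast
  qed (use n in \<open>auto simp: J_def P_def h_def\<close>)
qed

section \<open>Increasing the norm\<close>

text \<open>Either there is room to move the largest entry \<open>\<alpha>\<close> alone, or the second largest entry \<open>\<beta>\<close> is not
  small and mass can be exchanged between the two without changing \<open>l1\<close>.\<close>

lemma splitting_direction:
  assumes z: "l1 z < M"
  obtains i j i' j' s t b where "b = s *\<^sub>R axis i (axis j 1) + t *\<^sub>R axis i' (axis j' 1)"
    "(M\<^sup>2 - (norm z)\<^sup>2) / (64 * M) \<le> norm b" "l1 (z + b) < M" "l1 (z - b) < M"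
proof -
  define f where "f p = z $ fst p $ snd p" for p :: "3 \<times> 3"
  define E :: "3 \<times> 3 \<Rightarrow> real^3^3" where "E p = axis (fst p) (axis (snd p) 1)" for p
  have E: "E p $ fst q $ snd q = (if q = p then 1 else 0)" for p q
    by (cases p, cases q) (auto simp: E_def axis_def)
  have l1: "l1 x = (\<Sum>p\<in>UNIV. \<bar>x $ fst p $ snd p\<bar>)" for x
    unfolding l1_def by (simp add: sum.cartesian_product case_prod_unfold)
  have Mp: "0 < M" using z l1_nonneg[of z] by linarith
  have nz: "norm z < M" using z norm_le_l1[of z] by linarith
  \<comment> \<open>The factor is generous: it yields \<open>32 * c\<close> in \<open>key\<close>
    below, so that either \<open>M - n\<close> exceeds \<open>c\<close>, or the eight entries other
    than the largest force the second largest to be at least \<open>c\<close>.\<close>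
  define c where "c = (M\<^sup>2 - (norm z)\<^sup>2) / (64 * M)"
  have c: "0 < c" using Mp nz by (auto simp: c_def intro!: divide_pos_pos power_strict_mono)
  have cM: "64 * M * c = M\<^sup>2 - (norm z)\<^sup>2" using Mp by (simp add: c_def)
  obtain \<alpha> where \<alpha>: "\<And>p. \<bar>f p\<bar> \<le> \<bar>f \<alpha>\<bar>"
  proof -
    let ?S = "range (\<lambda>p. \<bar>f p\<bar>)"
    have "Max ?S \<in> ?S" by (intro Max_in) auto
    then obtain \<alpha> where "Max ?S = \<bar>f \<alpha>\<bar>" by (rule imageE)
    moreover have "\<bar>f p\<bar> \<le> Max ?S" for p by (intro Max_ge) auto
    ultimately show ?thesis using that by metis
  qed
  have ne: "UNIV - {\<alpha>} \<noteq> {}"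
  proof
    assume "UNIV - {\<alpha>} = {}"
    then have "(UNIV :: (3 \<times> 3) set) \<subseteq> {\<alpha>}" by blast
    then have "card (UNIV :: (3 \<times> 3) set) \<le> card {\<alpha>}" by (intro card_mono) auto
    then show False by simp
  qed
  obtain \<beta> where \<beta>: "\<beta> \<noteq> \<alpha>" "\<And>p. p \<noteq> \<alpha> \<Longrightarrow> \<bar>f p\<bar> \<le> \<bar>f \<beta>\<bar>"
  proof -
    let ?S = "(\<lambda>p. \<bar>f p\<bar>) ` (UNIV - {\<alpha>})"
    have "Max ?S \<in> ?S" using ne by (intro Max_in) auto
    then obtain \<beta> where "\<beta> \<noteq> \<alpha>" "Max ?S = \<bar>f \<beta>\<bar>" by auto
    moreover have "\<bar>f p\<bar> \<le> Max ?S" if "p \<noteq> \<alpha>" for p using that by (intro Max_ge) auto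
    ultimately show ?thesis using that by metis
  qed
  define n where "n = l1 z"
  have n: "0 \<le> n" "n < M" using z l1_nonneg by (auto simp: n_def)
  have n\<alpha>: "n = \<bar>f \<alpha>\<bar> + (\<Sum>p\<in>UNIV - {\<alpha>}. \<bar>f p\<bar>)"
    unfolding n_def l1 f_def by (subst sum.remove[of _ \<alpha>]) auto
  have "(\<Sum>p\<in>UNIV - {\<alpha>}. \<bar>f p\<bar>) \<le> (\<Sum>p\<in>UNIV - {\<alpha>}. \<bar>f \<beta>\<bar>)" by (intro sum_mono) (use \<beta> in auto)
  also have "\<dots> = 8 * \<bar>f \<beta>\<bar>" by simp
  finally have n8: "n - \<bar>f \<alpha>\<bar> \<le> 8 * \<bar>f \<beta>\<bar>" using n\<alpha> by linarith
  have f\<alpha>n: "\<bar>f \<alpha>\<bar> \<le> n" unfolding n\<alpha> by (simp add: sum_nonneg)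
  have f\<alpha>z: "\<bar>f \<alpha>\<bar> \<le> norm z"
    unfolding f_def by (rule abs_entry_le_norm)
  \<comment> \<open>The defect is split at \<open>n = l1 z\<close>. The first part measures the room
    left by the constraint; the second is controlled by the eight entries other than \<alpha>, since
    \<open>norm z\<close> is at least the largest modulus.\<close>
  have "64 * M * c = (M\<^sup>2 - n\<^sup>2) + (n\<^sup>2 - (norm z)\<^sup>2)" using cM by simp
  also have "\<dots> \<le> (M\<^sup>2 - n\<^sup>2) + (n\<^sup>2 - \<bar>f \<alpha>\<bar>\<^sup>2)"
    using power_mono[OF f\<alpha>z, of 2] by simp
  also have "\<dots> = (M - n) * (M + n) + (n - \<bar>f \<alpha>\<bar>) * (n + \<bar>f \<alpha>\<bar>)"
    by (simp add: power2_eq_square algebra_simps)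
  also have "\<dots> \<le> (M - n) * (2 * M) + (8 * \<bar>f \<beta>\<bar>) * (2 * M)"
    using n n8 f\<alpha>n by (intro add_mono mult_mono) auto
  finally have "(2 * M) * (32 * c) \<le> (2 * M) * ((M - n) + 8 * \<bar>f \<beta>\<bar>)" by (simp add: algebra_simps)
  then have key: "32 * c \<le> (M - n) + 8 * \<bar>f \<beta>\<bar>" using Mp by simp
  show ?thesis
  proof (cases "c < M - n")
    case True
    have "l1 (E \<alpha>) = (\<Sum>p\<in>UNIV. if p = \<alpha> then 1 else 0)"
      unfolding l1 E by (rule sum.cong) auto
    then have lE: "l1 (E \<alpha>) = 1" by simp
    show ?thesis
    proof (rule that[of "c *\<^sub>R E \<alpha>" c "fst \<alpha>" "snd \<alpha>" 0 "fst \<beta>" "snd \<beta>"])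
      show "c *\<^sub>R E \<alpha> = c *\<^sub>R axis (fst \<alpha>) (axis (snd \<alpha>) 1) + 0 *\<^sub>R axis (fst \<beta>) (axis (snd \<beta>) 1)"
        by (simp add: E_def)
      show "(M\<^sup>2 - (norm z)\<^sup>2) / (64 * M) \<le> norm (c *\<^sub>R E \<alpha>)"
        using c abs_entry_le_norm[of "c *\<^sub>R E \<alpha>" "fst \<alpha>" "snd \<alpha>"] by (simp add: c_def[symmetric] E)
      show "l1 (z + c *\<^sub>R E \<alpha>) < M"
        using l1_triangle[of z "c *\<^sub>R E \<alpha>"] c True by (simp add: l1_scaleR lE n_def)
      show "l1 (z - c *\<^sub>R E \<alpha>) < M"
        using l1_triangle[of z "(- c) *\<^sub>R E \<alpha>"] c True unfolding l1_scaleR lE by (simp add: n_def)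
    qed
  next
    case False
    then have f\<beta>: "c \<le> \<bar>f \<beta>\<bar>" using key c by linarith
    then have f\<alpha>: "c \<le> \<bar>f \<alpha>\<bar>" using \<alpha>[of \<beta>] by linarith
    \<comment> \<open>One modulus grows by \<open>c\<close> and the other shrinks by
      \<open>c\<close>, in either direction of \<open>b\<close>. Both moduli are at least
      \<open>c\<close>, so no entry crosses zero and \<open>l1\<close> is preserved exactly.\<close>
    define b where "b = (c * sgn (f \<alpha>)) *\<^sub>R E \<alpha> + (- c * sgn (f \<beta>)) *\<^sub>R E \<beta>"
    have bp: "b $ fst p $ snd p = (if p = \<alpha> then c * sgn (f \<alpha>) else if p = \<beta> then - c * sgn (f \<beta>) else 0)" for p
      using \<beta>(1) by (auto simp: b_def E)
    have move: "l1 (z + \<tau> *\<^sub>R b) = n" if \<tau>: "\<tau> = 1 \<or> \<tau> = -1" for \<tau> :: real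
    proof -
      have p: "\<bar>f p + \<tau> * b $ fst p $ snd p\<bar> = \<bar>f p\<bar> + \<tau> * ((if p = \<alpha> then c else 0) - (if p = \<beta> then c else 0))" for p
        using \<tau> c f\<alpha> f\<beta> \<beta>(1) unfolding bp by (auto simp: sgn_if abs_if split: if_splits)
      have "l1 (z + \<tau> *\<^sub>R b) = (\<Sum>p\<in>UNIV. \<bar>f p + \<tau> * b $ fst p $ snd p\<bar>)"
        unfolding l1 f_def by simp
      also have "\<dots> = (\<Sum>p\<in>UNIV. \<bar>f p\<bar>) + \<tau> * ((\<Sum>p\<in>UNIV. if p = \<alpha> then c else 0) - (\<Sum>p\<in>UNIV. if p = \<beta> then c else 0))"
        unfolding p by (simp add: sum.distrib sum_distrib_left[symmetric] sum_subtractf)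
      also have "\<dots> = n" by (simp add: n_def l1 f_def)
      finally show ?thesis .
    qed
    show ?thesis
    proof (rule that[of b "c * sgn (f \<alpha>)" "fst \<alpha>" "snd \<alpha>" "- c * sgn (f \<beta>)" "fst \<beta>" "snd \<beta>"])
      show "b = (c * sgn (f \<alpha>)) *\<^sub>R axis (fst \<alpha>) (axis (snd \<alpha>) 1) + (- c * sgn (f \<beta>)) *\<^sub>R axis (fst \<beta>) (axis (snd \<beta>) 1)"
        by (simp add: E_def b_def)
      have "\<bar>b $ fst \<alpha> $ snd \<alpha>\<bar> = c" unfolding bp using f\<alpha> c by (auto simp: abs_mult sgn_if)
      moreover have "\<bar>b $ fst \<alpha> $ snd \<alpha>\<bar> \<le> norm b"
        by (rule abs_entry_le_norm)
      ultimately show "(M\<^sup>2 - (norm z)\<^sup>2) / (64 * M) \<le> norm b" by (simp add: c_def)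
      show "l1 (z + b) < M" "l1 (z - b) < M" using move[of 1] move[of "-1"] n by simp_all
    qed
  qed
qed

section \<open>Admissible fields and their defect\<close>

definition admissible :: "(real^3) set \<Rightarrow> real \<Rightarrow> (real^3 \<Rightarrow> real^3^3) \<Rightarrow> bool" where
  "admissible \<Omega> M z \<longleftrightarrow> continuous_on \<Omega> z \<and> (\<forall>x\<in>\<Omega>. l1 (z x) < M)"

definition defect :: "real \<Rightarrow> real^3^3 \<Rightarrow> real" where
  "defect M z = M\<^sup>2 - (norm z)\<^sup>2"

lemma admissible_norm: "admissible \<Omega> M z \<Longrightarrow> x \<in> \<Omega> \<Longrightarrow> norm (z x) \<le> M"
  unfolding admissible_def using norm_le_l1[of "z x"] by fastforce

lemma admissible_defect:
  assumes "admissible \<Omega> M z" "x \<in> \<Omega>"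
  shows "0 < defect M (z x)" "defect M (z x) \<le> M\<^sup>2"
proof -
  have "norm (z x) < M" using assms norm_le_l1[of "z x"] by (fastforce simp: admissible_def)
  then show "0 < defect M (z x)" by (simp add: defect_def power_strict_mono)
qed (simp add: defect_def)

lemma admissible_add:
  assumes "admissible \<Omega> M z" "neutral \<Omega> \<phi>" "\<And>x. x \<in> \<Omega> \<Longrightarrow> l1 (z x + \<phi> x) < M"
  shows "admissible \<Omega> M (\<lambda>x. z x + \<phi> x)"
  using assms neutralD(1)[OF assms(2)] unfolding admissible_def
  by (auto intro!: continuous_on_add continuous_on_subset[of UNIV \<phi>])

lemma continuous_on_defect: "continuous_on A z \<Longrightarrow> continuous_on A (\<lambda>x. defect M (z x))"
  unfolding defect_def by (intro continuous_intros)

lemma integrable_defect: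
  assumes \<Omega>: "open \<Omega>" and z: "admissible \<Omega> M z"
  shows integrable_defect_sq: "integrable (wmeasure \<Omega>) (\<lambda>y. (defect M (z y))\<^sup>2)"
    and "integrable (wmeasure \<Omega>) (\<lambda>y. defect M (z y))"
    and "integrable (wmeasure \<Omega>) (\<lambda>y. (norm (z y))\<^sup>2)"
proof -
  from z have zc: "continuous_on \<Omega> z" by (simp add: admissible_def)
  have d: "0 \<le> defect M (z y)" "defect M (z y) \<le> M\<^sup>2" if "y \<in> \<Omega>" for y
    using admissible_defect[OF z that] by simp_all
  show "integrable (wmeasure \<Omega>) (\<lambda>y. (defect M (z y))\<^sup>2)"
  proof (rule integrable_wmeasure_continuous[OF \<Omega>])
    show "norm ((defect M (z y))\<^sup>2) \<le> (M\<^sup>2)\<^sup>2" if "y \<in> \<Omega>" for y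
      using power_mono[OF d(2)[OF that] d(1)[OF that], of 2] by simp
  qed (intro continuous_intros continuous_on_defect zc)
  show "integrable (wmeasure \<Omega>) (\<lambda>y. defect M (z y))"
    by (rule integrable_wmeasure_continuous[OF \<Omega> continuous_on_defect[OF zc], where B = "M\<^sup>2"]) (use d in auto)
  show "integrable (wmeasure \<Omega>) (\<lambda>y. (norm (z y))\<^sup>2)"
  proof (rule integrable_wmeasure_continuous[OF \<Omega>])
    show "norm ((norm (z y))\<^sup>2) \<le> M\<^sup>2" if "y \<in> \<Omega>" for y
      using power_mono[OF admissible_norm[OF z that] norm_ge_zero, of 2] by simp
  qed (intro continuous_intros zc)
qed

text \<open>The splitting direction of the centre stays admissible on small balls by continuity, and
  there the defect at most doubles. Combined with the comparison of ball and cube, the gain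
  dominates the integral of the squared defect over the whole ball, with \<kappa> independent of the
  field and of the ball.\<close>

lemma good_balls:
  assumes \<Omega>: "open \<Omega>" and M: "0 < M"
  obtains \<kappa> where "0 < \<kappa>" "\<And>z x d. admissible \<Omega> M z \<Longrightarrow> x \<in> \<Omega> \<Longrightarrow> 0 < d \<Longrightarrow> \<exists>r b i j s i' j' t.
      0 < r \<and> r < d \<and> cball x r \<subseteq> \<Omega> \<and> b = s *\<^sub>R axis i (axis j 1) + t *\<^sub>R axis i' (axis j' 1) \<and>
      (\<forall>y\<in>cball x r. l1 (z y + b) < M \<and> l1 (z y - b) < M) \<and>
      \<kappa> * (\<integral>y. indicator (cball x r) y * (defect M (z y))\<^sup>2 \<partial>wmeasure \<Omega>)
        \<le> (norm b)\<^sup>2 / 2 * measure (wmeasure \<Omega>) (cbox (x - vec (r / 4)) (x + vec (r / 4)))"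
proof -
  have \<Omega>m: "\<Omega> \<in> sets lebesgue" using \<Omega> by (simp add: lborelD)
  interpret finite_measure "wmeasure \<Omega>" by (rule finite_measure_wmeasure[OF \<Omega>m])
  obtain K where K: "0 < K" "\<And>x. x \<in> \<Omega> \<Longrightarrow> \<exists>\<delta>>0. \<forall>r. 0 < r \<and> r < \<delta> \<longrightarrow>
     cball x r \<subseteq> \<Omega> \<and> measure (wmeasure \<Omega>) (cball x r) \<le> K * measure (wmeasure \<Omega>) (cbox (x - vec (r / 4)) (x + vec (r / 4)))"
    using wmeasure_doubling \<Omega> by metis
  \<comment> \<open>The product of 4 from doubling the defect, 2 from the mean of the squared
    cosine, and the square of 64 from \<open>splitting_direction\<close>.\<close>
  define \<kappa> where "\<kappa> = 1 / (32768 * M\<^sup>2 * K)"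
  have \<kappa>: "0 < \<kappa>" using K M by (simp add: \<kappa>_def)
  show ?thesis
  proof (rule that[OF \<kappa>])
    fix z x and d :: real assume z: "admissible \<Omega> M z" and x: "x \<in> \<Omega>" and d: "0 < d"
    from z have zc: "continuous_on \<Omega> z" and zM: "l1 (z x) < M" using x by (auto simp: admissible_def)
    obtain i j i' j' s t b where b: "b = s *\<^sub>R axis i (axis j 1) + t *\<^sub>R axis i' (axis j' 1)"
      "defect M (z x) / (64 * M) \<le> norm b" "l1 (z x + b) < M" "l1 (z x - b) < M"
      using splitting_direction[OF zM] unfolding defect_def by metis
    obtain \<delta> where \<delta>: "0 < \<delta>" "\<And>r. 0 < r \<Longrightarrow> r < \<delta> \<Longrightarrow>
     cball x r \<subseteq> \<Omega> \<and> measure (wmeasure \<Omega>) (cball x r) \<le> K * measure (wmeasure \<Omega>) (cbox (x - vec (r / 4)) (x + vec (r / 4)))"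
      using K(2)[OF x] by blast
    have dx: "0 < defect M (z x)" using admissible_defect[OF z x] by simp
    \<comment> \<open>Negativity of this one continuous function encodes all three conditions wanted
      on the ball.\<close>
    define m where "m y = max (max (l1 (z y + b) - M) (l1 (z y - b) - M)) (defect M (z y) - 2 * defect M (z x))" for y
    have "continuous_on \<Omega> m" unfolding m_def
      by (intro continuous_on_max continuous_on_diff continuous_on_compose2[OF continuous_on_l1[of UNIV]]
          continuous_on_defect zc continuous_on_add continuous_on_const) auto
    moreover have "m x < 0" using b dx by (simp add: m_def)
    ultimately have "open (\<Omega> \<inter> m -` {..<0})" "x \<in> \<Omega> \<inter> m -` {..<0}"
      using \<Omega> x by (auto intro: continuous_open_preimage)
    then obtain e where e: "0 < e" "cball x e \<subseteq> \<Omega> \<inter> m -` {..<0}"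
      using open_contains_cball by blast
    define r where "r = min e (min d \<delta>) / 2"
    have r: "0 < r" "r < d" "r < \<delta>" "r \<le> e" using e \<delta>(1) d by (auto simp: r_def)
    have sub: "cball x r \<subseteq> \<Omega>" using \<delta>(2) r by blast
    have mr: "l1 (z y + b) < M" "l1 (z y - b) < M" "defect M (z y) \<le> 2 * defect M (z x)" if "y \<in> cball x r" for y
    proof -
      have "m y < 0" using e(2) r(4) that subset_cball[of r e x] by blast
      then show "l1 (z y + b) < M" "l1 (z y - b) < M" "defect M (z y) \<le> 2 * defect M (z x)"
        by (auto simp: m_def)
    qed
    let ?P = "measure (wmeasure \<Omega>) (cbox (x - vec (r / 4)) (x + vec (r / 4)))"
    have meas: "cball x r \<in> sets (wmeasure \<Omega>)"
      using sub by (simp add: sets_wmeasure sets_restrict_space_iff \<Omega>m)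
    have "(\<integral>y. indicator (cball x r) y * (defect M (z y))\<^sup>2 \<partial>wmeasure \<Omega>) \<le>
        (\<integral>y. (2 * defect M (z x))\<^sup>2 * indicator (cball x r) y \<partial>wmeasure \<Omega>)"
    proof (rule integral_mono)
      have "integrable (wmeasure \<Omega>) (\<lambda>y. (defect M (z y))\<^sup>2)"
        by (rule integrable_defect_sq[OF \<Omega> z])
      from integrable_mult_indicator[OF meas this]
      show "integrable (wmeasure \<Omega>) (\<lambda>y. indicator (cball x r) y * (defect M (z y))\<^sup>2)" by simp
      show "integrable (wmeasure \<Omega>) (\<lambda>y. (2 * defect M (z x))\<^sup>2 * indicator (cball x r) y)"
        using meas by (simp add: less_top[symmetric])
      show "indicator (cball x r) y * (defect M (z y))\<^sup>2 \<le> (2 * defect M (z x))\<^sup>2 * indicator (cball x r) y"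
        if "y \<in> space (wmeasure \<Omega>)" for y
      proof (cases "y \<in> cball x r")
        case True
        then have "(defect M (z y))\<^sup>2 \<le> (2 * defect M (z x))\<^sup>2"
          using that mr(3)[OF True] admissible_defect(1)[OF z, of y] by (intro power_mono) auto
        then show ?thesis using True by simp
      qed simp
    qed
    also have "\<dots> = (2 * defect M (z x))\<^sup>2 * measure (wmeasure \<Omega>) (cball x r)"
      using sub by (simp add: Int_absorb2)
    also have "\<dots> \<le> (2 * defect M (z x))\<^sup>2 * (K * ?P)"
      using \<delta>(2)[OF r(1,3)] by (intro mult_left_mono) auto
    finally have "\<kappa> * (\<integral>y. indicator (cball x r) y * (defect M (z y))\<^sup>2 \<partial>wmeasure \<Omega>) \<le> \<kappa> * ((2 * defect M (z x))\<^sup>2 * (K * ?P))"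
      using \<kappa> by (intro mult_left_mono) auto
    also have "\<dots> = (defect M (z x) / (64 * M))\<^sup>2 / 2 * ?P"
      using K M by (simp add: \<kappa>_def power2_eq_square field_simps)
    also have "\<dots> \<le> (norm b)\<^sup>2 / 2 * ?P"
      using b(2) dx M by (intro mult_right_mono divide_right_mono power_mono) auto
    finally have "\<kappa> * (\<integral>y. indicator (cball x r) y * (defect M (z y))\<^sup>2 \<partial>wmeasure \<Omega>) \<le> (norm b)\<^sup>2 / 2 * ?P" .
    then show "\<exists>r b i j s i' j' t.
      0 < r \<and> r < d \<and> cball x r \<subseteq> \<Omega> \<and> b = s *\<^sub>R axis i (axis j 1) + t *\<^sub>R axis i' (axis j' 1) \<and>
      (\<forall>y\<in>cball x r. l1 (z y + b) < M \<and> l1 (z y - b) < M) \<and>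
      \<kappa> * (\<integral>y. indicator (cball x r) y * (defect M (z y))\<^sup>2 \<partial>wmeasure \<Omega>)
        \<le> (norm b)\<^sup>2 / 2 * measure (wmeasure \<Omega>) (cbox (x - vec (r / 4)) (x + vec (r / 4)))"
      using r(1,2) sub b(1) mr(1,2) by blast
  qed
qed

section \<open>Summing the gains over a covering by disjoint balls\<close>

definition good_ball :: "(real^3) set \<Rightarrow> real \<Rightarrow> (real^3 \<Rightarrow> real^3^3) \<Rightarrow> real \<Rightarrow> real^3 \<Rightarrow> real \<Rightarrow> bool" where
  "good_ball \<Omega> M z \<gamma> x r \<longleftrightarrow> 0 < r \<and> cball x r \<subseteq> \<Omega> \<and>
    (\<exists>b i j s i' j' t. b = s *\<^sub>R axis i (axis j 1) + t *\<^sub>R axis i' (axis j' 1) \<and>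
      (\<forall>y\<in>cball x r. l1 (z y + b) < M \<and> l1 (z y - b) < M) \<and>
      \<gamma> \<le> (norm b)\<^sup>2 / 2 * measure (wmeasure \<Omega>) (cbox (x - vec (r / 4)) (x + vec (r / 4))))"

lemma integrable_inner_neutral:
  fixes z0 :: "real^3 \<Rightarrow> real^3^3"
  assumes \<Omega>: "open \<Omega>" and z0: "continuous_on \<Omega> z0" "\<And>x. x \<in> \<Omega> \<Longrightarrow> norm (z0 x) \<le> M0" and \<phi>: "neutral \<Omega> \<phi>"
  shows "integrable (wmeasure \<Omega>) (\<lambda>y. z0 y \<bullet> \<phi> y)"
proof -
  obtain C where C: "\<And>x. norm (\<phi> x) \<le> C" using neutralD(2)[OF \<phi>] by blast
  have "continuous_on \<Omega> \<phi>" using neutralD(1)[OF \<phi>] continuous_on_subset by blast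
  then show ?thesis
    by (intro integrable_wmeasure_continuous[OF \<Omega>, where B = "M0 * C"])
      (auto intro!: continuous_on_inner z0 abs_inner_le_mult C)
qed

text \<open>Here \<open>\<gamma> (x, r)\<close> is the gain that a single wave guarantees on its
  ball, up to an error. The balls are disjoint, so the earlier perturbations vanish on the next ball
  and its conditions on \<open>z\<close> remain valid there; the error budget is halved at each step
  of the induction.\<close>

lemma finite_perturbation:
  fixes z z0 :: "real^3 \<Rightarrow> real^3^3" and C :: "((real^3) \<times> real) set"
  assumes \<Omega>: "open \<Omega>" and z: "admissible \<Omega> M z"
    and z0: "continuous_on \<Omega> z0" "\<And>x. x \<in> \<Omega> \<Longrightarrow> norm (z0 x) \<le> M0"
    and C: "finite C" "\<And>x r. (x, r) \<in> C \<Longrightarrow> good_ball \<Omega> M z (\<gamma> (x, r)) x r"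
    and disj: "pairwise (\<lambda>i j. disjnt (cball (fst i) (snd i)) (cball (fst j) (snd j))) C"
    and "0 < \<epsilon>"
  shows "\<exists>\<phi>. neutral \<Omega> \<phi> \<and> (\<forall>y. y \<notin> (\<Union>i\<in>C. cball (fst i) (snd i)) \<longrightarrow> \<phi> y = 0) \<and>
    admissible \<Omega> M (\<lambda>x. z x + \<phi> x) \<and>
    \<bar>\<integral>y. z0 y \<bullet> \<phi> y \<partial>wmeasure \<Omega>\<bar> \<le> \<epsilon> \<and>
    (\<integral>y. (norm (z y + \<phi> y))\<^sup>2 \<partial>wmeasure \<Omega>) \<ge> (\<integral>y. (norm (z y))\<^sup>2 \<partial>wmeasure \<Omega>) + sum \<gamma> C - \<epsilon>"
  using C disj \<open>0 < \<epsilon>\<close>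
proof (induction C arbitrary: \<epsilon> rule: finite_induct)
  case empty
  then show ?case using neutral_zero z by (intro exI[of _ "\<lambda>x. 0"]) simp
next
  case (insert i C)
  obtain x r where i: "i = (x, r)" by (cases i)
  have "pairwise (\<lambda>i j. disjnt (cball (fst i) (snd i)) (cball (fst j) (snd j))) C"
    using insert.prems(2) by (rule pairwise_subset) auto
  from insert.IH[OF insert.prems(1) this, of "\<epsilon> / 2"] insert.prems(3)
  obtain \<phi> where \<phi>: "neutral \<Omega> \<phi>" "\<And>y. y \<notin> (\<Union>i\<in>C. cball (fst i) (snd i)) \<Longrightarrow> \<phi> y = 0"
    "admissible \<Omega> M (\<lambda>x. z x + \<phi> x)"
    "\<bar>\<integral>y. z0 y \<bullet> \<phi> y \<partial>wmeasure \<Omega>\<bar> \<le> \<epsilon> / 2"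
    "(\<integral>y. (norm (z y + \<phi> y))\<^sup>2 \<partial>wmeasure \<Omega>) \<ge> (\<integral>y. (norm (z y))\<^sup>2 \<partial>wmeasure \<Omega>) + sum \<gamma> C - \<epsilon> / 2"
    by auto
  have "good_ball \<Omega> M z (\<gamma> (x, r)) x r" using insert.prems(1) i by auto
  then obtain b i' j s i'' j' t where g: "0 < r" "cball x r \<subseteq> \<Omega>"
      "b = s *\<^sub>R axis i' (axis j 1) + t *\<^sub>R axis i'' (axis j' 1)"
      "\<And>y. y \<in> cball x r \<Longrightarrow> l1 (z y + b) < M" "\<And>y. y \<in> cball x r \<Longrightarrow> l1 (z y - b) < M"
      "\<gamma> (x, r) \<le> (norm b)\<^sup>2 / 2 * measure (wmeasure \<Omega>) (cbox (x - vec (r / 4)) (x + vec (r / 4)))"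
    unfolding good_ball_def by blast
  have \<phi>0: "\<phi> y = 0" if y: "y \<in> cball x r" for y
  proof (rule \<phi>(2), rule notI)
    assume "y \<in> (\<Union>i\<in>C. cball (fst i) (snd i))"
    then obtain k where k: "k \<in> C" "y \<in> cball (fst k) (snd k)" by blast
    then have "disjnt (cball (fst i) (snd i)) (cball (fst k) (snd k))"
      using insert.prems(2) insert.hyps(2) by (intro pairwiseD[OF insert.prems(2)]) auto
    then show False using k(2) y i by (auto simp: disjnt_iff)
  qed
  have zc: "continuous_on \<Omega> (\<lambda>x. z x + \<phi> x)" and zM: "\<And>x. x \<in> \<Omega> \<Longrightarrow> l1 (z x + \<phi> x) < M"
    using \<phi>(3) by (auto simp: admissible_def)
  obtain \<phi>' where \<phi>': "neutral \<Omega> \<phi>'" "\<And>y. y \<notin> ball x r \<Longrightarrow> \<phi>' y = 0"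
    "\<And>y. y \<in> \<Omega> \<Longrightarrow> l1 (z y + \<phi> y + \<phi>' y) < M"
    "\<bar>\<integral>y. z0 y \<bullet> \<phi>' y \<partial>wmeasure \<Omega>\<bar> \<le> \<epsilon> / 2"
    "(\<integral>y. (norm (z y + \<phi> y + \<phi>' y))\<^sup>2 \<partial>wmeasure \<Omega>) \<ge> (\<integral>y. (norm (z y + \<phi> y))\<^sup>2 \<partial>wmeasure \<Omega>)
       + (norm b)\<^sup>2 / 2 * measure (wmeasure \<Omega>) (cbox (x - vec (r / 4)) (x + vec (r / 4))) - \<epsilon> / 2"
  proof (rule local_perturbation[OF \<Omega> g(1,2) zc zM z0 g(3), of "\<epsilon> / 2"])
    show "l1 (z y + \<phi> y + b) < M" "l1 (z y + \<phi> y - b) < M" if "y \<in> cball x r" for y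
      using g(4,5)[OF that] \<phi>0[OF that] by simp_all
  qed (use insert.prems(3) in auto)
  show ?case
  proof (intro exI conjI allI impI)
    show "neutral \<Omega> (\<lambda>y. \<phi> y + \<phi>' y)" by (rule neutral_add[OF \<Omega> \<phi>(1) \<phi>'(1)])
    show "\<phi> y + \<phi>' y = 0" if "y \<notin> (\<Union>i\<in>insert i C. cball (fst i) (snd i))" for y
      using that \<phi>(2)[of y] \<phi>'(2)[of y] i by auto
    show "admissible \<Omega> M (\<lambda>x. z x + (\<phi> x + \<phi>' x))"
      using admissible_add[OF \<phi>(3) \<phi>'(1,3)] by (simp add: add.assoc)
    have "(\<integral>y. z0 y \<bullet> (\<phi> y + \<phi>' y) \<partial>wmeasure \<Omega>) = (\<integral>y. z0 y \<bullet> \<phi> y \<partial>wmeasure \<Omega>) + (\<integral>y. z0 y \<bullet> \<phi>' y \<partial>wmeasure \<Omega>)"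
      unfolding inner_add_right
      by (intro Bochner_Integration.integral_add integrable_inner_neutral[OF \<Omega> z0] \<phi>(1) \<phi>'(1))
    then show "\<bar>\<integral>y. z0 y \<bullet> (\<phi> y + \<phi>' y) \<partial>wmeasure \<Omega>\<bar> \<le> \<epsilon>" using \<phi>(4) \<phi>'(4) by linarith
    show "(\<integral>y. (norm (z y))\<^sup>2 \<partial>wmeasure \<Omega>) + sum \<gamma> (insert i C) - \<epsilon> \<le> (\<integral>y. (norm (z y + (\<phi> y + \<phi>' y)))\<^sup>2 \<partial>wmeasure \<Omega>)"
      using \<phi>(5) \<phi>'(5) g(6) insert.hyps i by (simp add: add.assoc)
  qed
qed

text \<open>Good balls exist at all points and at all scales, so the Vitali theorem selects disjoint
  ones that fill \<Omega> up to a null set. By dominated convergence finitely many of them already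
  capture the integral of the squared defect up to a small loss.\<close>

lemma improvement_step:
  assumes \<Omega>: "open \<Omega>" and M: "0 < M"
  obtains \<kappa> where "0 < \<kappa>" "\<And>z z0 M0 \<epsilon>. admissible \<Omega> M z \<Longrightarrow> continuous_on \<Omega> z0 \<Longrightarrow> (\<And>x. x \<in> \<Omega> \<Longrightarrow> norm (z0 x) \<le> M0) \<Longrightarrow> 0 < \<epsilon> \<Longrightarrow>
    \<exists>\<phi>. neutral \<Omega> \<phi> \<and> admissible \<Omega> M (\<lambda>x. z x + \<phi> x) \<and> \<bar>\<integral>y. z0 y \<bullet> \<phi> y \<partial>wmeasure \<Omega>\<bar> \<le> \<epsilon> \<and>
    (\<integral>y. (norm (z y + \<phi> y))\<^sup>2 \<partial>wmeasure \<Omega>) \<ge> (\<integral>y. (norm (z y))\<^sup>2 \<partial>wmeasure \<Omega>)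
      + \<kappa> * (\<integral>y. (defect M (z y))\<^sup>2 \<partial>wmeasure \<Omega>) - \<epsilon>"
proof -
  have \<Omega>m: "\<Omega> \<in> sets lebesgue" using \<Omega> by (simp add: lborelD)
  obtain \<kappa> where \<kappa>: "0 < \<kappa>" and good: "\<And>z x d. admissible \<Omega> M z \<Longrightarrow> x \<in> \<Omega> \<Longrightarrow> 0 < d \<Longrightarrow> \<exists>r b i j s i' j' t.
      0 < r \<and> r < d \<and> cball x r \<subseteq> \<Omega> \<and> b = s *\<^sub>R axis i (axis j 1) + t *\<^sub>R axis i' (axis j' 1) \<and>
      (\<forall>y\<in>cball x r. l1 (z y + b) < M \<and> l1 (z y - b) < M) \<and>
      \<kappa> * (\<integral>y. indicator (cball x r) y * (defect M (z y))\<^sup>2 \<partial>wmeasure \<Omega>)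
        \<le> (norm b)\<^sup>2 / 2 * measure (wmeasure \<Omega>) (cbox (x - vec (r / 4)) (x + vec (r / 4)))"
    by (rule good_balls[OF \<Omega> M]) blast
  show ?thesis
  proof (rule that[OF \<kappa>])
    fix z z0 :: "real^3 \<Rightarrow> real^3^3" and M0 \<epsilon> :: real
    assume z: "admissible \<Omega> M z" and z0: "continuous_on \<Omega> z0" "\<And>x. x \<in> \<Omega> \<Longrightarrow> norm (z0 x) \<le> M0" and \<epsilon>: "0 < \<epsilon>"
    define g where "g y = (defect M (z y))\<^sup>2" for y
    have gi: "integrable (wmeasure \<Omega>) g" unfolding g_def by (rule integrable_defect_sq[OF \<Omega> z])
    have g0: "0 \<le> g y" for y by (simp add: g_def)
    define \<gamma> where "\<gamma> i = \<kappa> * (\<integral>y. indicator (cball (fst i) (snd i)) y * g y \<partial>wmeasure \<Omega>)" for i :: "(real^3) \<times> real"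
    define I where "I = {i. good_ball \<Omega> M z (\<gamma> i) (fst i) (snd i)}"
    have cover: "\<exists>i. i \<in> I \<and> x \<in> cball (fst i) (snd i) \<and> snd i < d" if x: "x \<in> \<Omega>" and d: "0 < d" for x d
    proof -
      from good[OF z x d] obtain r where r: "0 < r" "r < d" "good_ball \<Omega> M z (\<gamma> (x, r)) x r"
        unfolding good_ball_def \<gamma>_def g_def fst_conv snd_conv by blast
      then show ?thesis by (intro exI[of _ "(x, r)"]) (simp add: I_def)
    qed
    obtain C where C: "countable C" "C \<subseteq> I" "pairwise (\<lambda>i j. disjnt (cball (fst i) (snd i)) (cball (fst j) (snd j))) C"
      "negligible (\<Omega> - (\<Union>i\<in>C. cball (fst i) (snd i)))"
      by (rule Vitali_covering_theorem_cballs[of I snd \<Omega> fst, OF _ cover]) (auto simp: I_def good_ball_def)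
    obtain e where e: "C \<subseteq> range (e :: nat \<Rightarrow> _)"
      using C(1) by (metis countable_subset_image UNIV_I countableE_infinite empty_subsetI from_nat_into_surj image_eqI subsetI uncountable_def)
    \<comment> \<open>The enumeration \<open>e\<close> may take values outside \<open>C\<close>,
      which can be finite or empty; hence the intersection.\<close>
    define Cn where "Cn n = C \<inter> e ` {..<n}" for n
    have Cn: "finite (Cn n)" "Cn n \<subseteq> C" for n by (auto simp: Cn_def)
    have disjn: "pairwise (\<lambda>i j. disjnt (cball (fst i) (snd i)) (cball (fst j) (snd j))) (Cn n)" for n
      using C(3) Cn(2) by (rule pairwise_subset)
    have ballm: "cball (fst i) (snd i) \<in> sets (wmeasure \<Omega>)" if "i \<in> C" for i
      using that C(2) by (auto simp: I_def good_ball_def sets_wmeasure sets_restrict_space_iff \<Omega>m)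
    let ?U = "\<lambda>n. \<Union>i\<in>Cn n. cball (fst i) (snd i)"
    have sum_eq: "sum \<gamma> (Cn n) = \<kappa> * (\<integral>y. indicator (?U n) y * g y \<partial>wmeasure \<Omega>)" for n
    proof -
      have ind: "indicator (?U n) y = (\<Sum>i\<in>Cn n. indicator (cball (fst i) (snd i)) y :: real)" for y
        by (rule indicator_UN_disjoint[OF Cn(1)])
          (use disjn in \<open>auto simp: disjoint_family_on_def pairwise_def disjnt_def\<close>)
      have "(\<integral>y. indicator (?U n) y * g y \<partial>wmeasure \<Omega>) = (\<integral>y. (\<Sum>i\<in>Cn n. indicator (cball (fst i) (snd i)) y * g y) \<partial>wmeasure \<Omega>)"
        unfolding ind sum_distrib_right ..
      also have "\<dots> = (\<Sum>i\<in>Cn n. \<integral>y. indicator (cball (fst i) (snd i)) y * g y \<partial>wmeasure \<Omega>)"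
      proof (rule Bochner_Integration.integral_sum)
        fix i assume "i \<in> Cn n"
        then have "i \<in> C" using Cn(2) by blast
        from integrable_mult_indicator[OF ballm[OF this] gi]
        show "integrable (wmeasure \<Omega>) (\<lambda>y. indicator (cball (fst i) (snd i)) y * g y)" by simp
      qed
      finally show ?thesis by (simp add: \<gamma>_def sum_distrib_left)
    qed
    have "(\<lambda>n. \<integral>y. indicator (?U n) y * g y \<partial>wmeasure \<Omega>) \<longlonglongrightarrow> (\<integral>y. g y \<partial>wmeasure \<Omega>)"
    proof (rule integral_dominated_convergence[where w = g])
      show "g \<in> borel_measurable (wmeasure \<Omega>)" using gi by auto
      have "?U n \<in> sets (wmeasure \<Omega>)" for n
        by (intro sets.finite_UN Cn(1) ballm subsetD[OF Cn(2)])
      then show "(\<lambda>y. indicator (?U n) y * g y) \<in> borel_measurable (wmeasure \<Omega>)" for n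
        using gi by (intro borel_measurable_times borel_measurable_indicator) auto
      show "integrable (wmeasure \<Omega>) g" by (rule gi)
      show "AE y in wmeasure \<Omega>. norm (indicator (?U n) y * g y) \<le> g y" for n
        using g0 by (intro AE_I2) (auto simp: indicator_def)
      have "AE y in lebesgue. y \<notin> \<Omega> - (\<Union>i\<in>C. cball (fst i) (snd i))"
        using C(4) by (intro AE_not_in) (simp add: negligible_iff_null_sets)
      then have "AE y in lebesgue_on \<Omega>. y \<in> (\<Union>i\<in>C. cball (fst i) (snd i))"
        using \<Omega>m by (subst AE_restrict_space_iff) auto
      then show "AE y in wmeasure \<Omega>. (\<lambda>n. indicator (?U n) y * g y) \<longlonglongrightarrow> g y"
        unfolding AE_wmeasure
      proof eventually_elim
        case (elim y)
        then obtain i where i: "i \<in> C" "y \<in> cball (fst i) (snd i)" by blast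
        then obtain m where m: "i = e m" using e by blast
        have "\<forall>\<^sub>F n in sequentially. indicator (?U n) y * g y = g y"
          using eventually_gt_at_top[of m]
        proof eventually_elim
          case (elim n)
          then have "i \<in> Cn n" using i(1) m by (auto simp: Cn_def)
          then have "y \<in> ?U n" using i(2) by blast
          then show ?case by simp
        qed
        then show ?case by (rule tendsto_eventually)
      qed
    qed
    then have "(\<lambda>n. \<kappa> * (\<integral>y. indicator (?U n) y * g y \<partial>wmeasure \<Omega>)) \<longlonglongrightarrow> \<kappa> * (\<integral>y. g y \<partial>wmeasure \<Omega>)"
      by (rule tendsto_mult_left)
    then have "\<forall>\<^sub>F n in sequentially. \<kappa> * (\<integral>y. g y \<partial>wmeasure \<Omega>) - \<epsilon> / 2 < \<kappa> * (\<integral>y. indicator (?U n) y * g y \<partial>wmeasure \<Omega>)"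
      using \<epsilon> by (intro order_tendstoD(1)) auto
    then obtain n where n: "\<kappa> * (\<integral>y. g y \<partial>wmeasure \<Omega>) - \<epsilon> / 2 < sum \<gamma> (Cn n)"
      unfolding sum_eq using eventually_happens'[OF sequentially_bot] by blast
    have gb: "good_ball \<Omega> M z (\<gamma> (x, r)) x r" if "(x, r) \<in> Cn n" for x r
    proof -
      have "(x, r) \<in> I" using that Cn(2) C(2) by blast
      then show ?thesis by (simp add: I_def)
    qed
    from finite_perturbation[OF \<Omega> z z0 Cn(1) gb disjn, of n "\<epsilon> / 2"] \<epsilon>
    obtain \<phi> where \<phi>: "neutral \<Omega> \<phi>" "admissible \<Omega> M (\<lambda>x. z x + \<phi> x)"
      "\<bar>\<integral>y. z0 y \<bullet> \<phi> y \<partial>wmeasure \<Omega>\<bar> \<le> \<epsilon> / 2"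
      "(\<integral>y. (norm (z y + \<phi> y))\<^sup>2 \<partial>wmeasure \<Omega>) \<ge> (\<integral>y. (norm (z y))\<^sup>2 \<partial>wmeasure \<Omega>) + sum \<gamma> (Cn n) - \<epsilon> / 2"
      by auto
    moreover have "(\<integral>y. (norm (z y))\<^sup>2 \<partial>wmeasure \<Omega>) + \<kappa> * (\<integral>y. (defect M (z y))\<^sup>2 \<partial>wmeasure \<Omega>) - \<epsilon>
        \<le> (\<integral>y. (norm (z y + \<phi> y))\<^sup>2 \<partial>wmeasure \<Omega>)"
      using \<phi>(4) n by (simp add: g_def)
    ultimately show "\<exists>\<phi>. neutral \<Omega> \<phi> \<and> admissible \<Omega> M (\<lambda>x. z x + \<phi> x) \<and> \<bar>\<integral>y. z0 y \<bullet> \<phi> y \<partial>wmeasure \<Omega>\<bar> \<le> \<epsilon> \<and>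
    (\<integral>y. (norm (z y + \<phi> y))\<^sup>2 \<partial>wmeasure \<Omega>) \<ge> (\<integral>y. (norm (z y))\<^sup>2 \<partial>wmeasure \<Omega>)
      + \<kappa> * (\<integral>y. (defect M (z y))\<^sup>2 \<partial>wmeasure \<Omega>) - \<epsilon>"
      using \<epsilon> by (intro exI[of _ \<phi>]) auto
  qed
qed

section \<open>Passage to the limit\<close>

lemma neutral_diff_trans:
  assumes "open \<Omega>" "neutral \<Omega> (\<lambda>x. y x - z x)" "neutral \<Omega> (\<lambda>x. y' x - y x)"
  shows "neutral \<Omega> (\<lambda>x. y' x - z x)"
  using neutral_add[OF assms(1,3,2)] by simp

text \<open>A crude form of Young's inequality. On a finite measure it turns a bound on the integral
  of a square into one on the integral itself, with a free parameter \<open>a\<close>.\<close>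

lemma le_add_square_divide:
  fixes a d :: real
  assumes a: "0 < a"
  shows "d \<le> a + d\<^sup>2 / a"
proof -
  have "2 * (a * d) \<le> a\<^sup>2 + d\<^sup>2" using sum_squares_bound[of a d] by simp
  moreover have "0 \<le> a\<^sup>2" "0 \<le> d\<^sup>2" by simp_all
  ultimately have "a * d \<le> a\<^sup>2 + d\<^sup>2" by linarith
  also have "\<dots> = a * (a + d\<^sup>2 / a)" using a by (simp add: power2_eq_square field_simps)
  finally show ?thesis using a by simp
qed

text \<open>Raising the weighted norm is the same as lowering the mean defect. The last two parts
  compare the mean defect with the mean squared defect, in which the gain of a step is
  measured.\<close>

lemma integral_defect:
  assumes \<Omega>: "open \<Omega>" and z: "admissible \<Omega> M z"
  shows "(\<integral>y. defect M (z y) \<partial>wmeasure \<Omega>) = M\<^sup>2 * measure (wmeasure \<Omega>) \<Omega> - (\<integral>y. (norm (z y))\<^sup>2 \<partial>wmeasure \<Omega>)"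
    "0 \<le> (\<integral>y. defect M (z y) \<partial>wmeasure \<Omega>)"
    "(\<integral>y. (defect M (z y))\<^sup>2 \<partial>wmeasure \<Omega>) \<le> M\<^sup>2 * (\<integral>y. defect M (z y) \<partial>wmeasure \<Omega>)"
    "0 < a \<Longrightarrow> (\<integral>y. defect M (z y) \<partial>wmeasure \<Omega>) \<le> a * measure (wmeasure \<Omega>) \<Omega> + (\<integral>y. (defect M (z y))\<^sup>2 \<partial>wmeasure \<Omega>) / a"
proof -
  interpret finite_measure "wmeasure \<Omega>"
    by (rule finite_measure_wmeasure) (use \<Omega> in \<open>simp add: lborelD\<close>)
  note i = integrable_defect[OF \<Omega> z]
  show "(\<integral>y. defect M (z y) \<partial>wmeasure \<Omega>) = M\<^sup>2 * measure (wmeasure \<Omega>) \<Omega> - (\<integral>y. (norm (z y))\<^sup>2 \<partial>wmeasure \<Omega>)"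
    unfolding defect_def using i(3) by simp
  show "0 \<le> (\<integral>y. defect M (z y) \<partial>wmeasure \<Omega>)"
    using admissible_defect(1)[OF z] by (intro Bochner_Integration.integral_nonneg) (simp add: less_imp_le)
  have "(\<integral>y. (defect M (z y))\<^sup>2 \<partial>wmeasure \<Omega>) \<le> (\<integral>y. M\<^sup>2 * defect M (z y) \<partial>wmeasure \<Omega>)"
    using i admissible_defect[OF z]
    by (intro integral_mono) (auto simp: power2_eq_square[of "defect _ _"] intro!: mult_right_mono less_imp_le)
  then show "(\<integral>y. (defect M (z y))\<^sup>2 \<partial>wmeasure \<Omega>) \<le> M\<^sup>2 * (\<integral>y. defect M (z y) \<partial>wmeasure \<Omega>)" by simp
  assume a: "0 < a"
  have "(\<integral>y. defect M (z y) \<partial>wmeasure \<Omega>) \<le> (\<integral>y. a + (defect M (z y))\<^sup>2 / a \<partial>wmeasure \<Omega>)"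
  proof (rule integral_mono[OF i(2)])
    show "integrable (wmeasure \<Omega>) (\<lambda>y. a + (defect M (z y))\<^sup>2 / a)" using i by simp
    show "d \<le> a + d\<^sup>2 / a" for d :: real by (rule le_add_square_divide[OF a])
  qed
  also have "\<dots> = a * measure (wmeasure \<Omega>) \<Omega> + (\<integral>y. (defect M (z y))\<^sup>2 \<partial>wmeasure \<Omega>) / a"
    using i by (simp add: mult.commute)
  finally show "(\<integral>y. defect M (z y) \<partial>wmeasure \<Omega>) \<le> a * measure (wmeasure \<Omega>) \<Omega> + (\<integral>y. (defect M (z y))\<^sup>2 \<partial>wmeasure \<Omega>) / a" .
qed

text \<open>While the mean squared defect exceeds \<delta>, an improvement step lowers the mean
  defect by at least \<open>\<kappa> * \<delta> / 2\<close>. As the mean defect is nonnegative, this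
  can happen only finitely often; the induction counts the remaining steps.\<close>

lemma small_defect_sq:
  assumes \<Omega>: "open \<Omega>" and M: "0 < M" and z: "admissible \<Omega> M z" and \<epsilon>: "0 < \<epsilon>" and \<delta>: "0 < \<delta>"
  obtains z' where "admissible \<Omega> M z'" "neutral \<Omega> (\<lambda>x. z' x - z x)"
    "\<bar>\<integral>y. z y \<bullet> (z' y - z y) \<partial>wmeasure \<Omega>\<bar> \<le> \<epsilon>" "(\<integral>y. (defect M (z' y))\<^sup>2 \<partial>wmeasure \<Omega>) \<le> \<delta>"
proof -
  have zc: "continuous_on \<Omega> z" using z by (simp add: admissible_def)
  note zn = admissible_norm[OF z]
  obtain \<kappa> where \<kappa>: "0 < \<kappa>" and step: "\<And>z z0 M0 \<epsilon>. admissible \<Omega> M z \<Longrightarrow> continuous_on \<Omega> z0 \<Longrightarrow> (\<And>x. x \<in> \<Omega> \<Longrightarrow> norm (z0 x) \<le> M0) \<Longrightarrow> 0 < \<epsilon> \<Longrightarrow>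
    \<exists>\<phi>. neutral \<Omega> \<phi> \<and> admissible \<Omega> M (\<lambda>x. z x + \<phi> x) \<and> \<bar>\<integral>y. z0 y \<bullet> \<phi> y \<partial>wmeasure \<Omega>\<bar> \<le> \<epsilon> \<and>
    (\<integral>y. (norm (z y + \<phi> y))\<^sup>2 \<partial>wmeasure \<Omega>) \<ge> (\<integral>y. (norm (z y))\<^sup>2 \<partial>wmeasure \<Omega>)
      + \<kappa> * (\<integral>y. (defect M (z y))\<^sup>2 \<partial>wmeasure \<Omega>) - \<epsilon>"
    by (rule improvement_step[OF \<Omega> M]) blast
  define D where "D y = (\<integral>x. defect M (y x) \<partial>wmeasure \<Omega>)" for y
  have J: "(\<integral>x. (norm (y x))\<^sup>2 \<partial>wmeasure \<Omega>) = M\<^sup>2 * measure (wmeasure \<Omega>) \<Omega> - D y" if "admissible \<Omega> M y" for y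
    using integral_defect(1)[OF \<Omega> that] by (simp add: D_def)
  have "\<exists>z'. admissible \<Omega> M z' \<and> neutral \<Omega> (\<lambda>x. z' x - y x) \<and>
    \<bar>\<integral>x. z x \<bullet> (z' x - y x) \<partial>wmeasure \<Omega>\<bar> \<le> \<epsilon> \<and> (\<integral>x. (defect M (z' x))\<^sup>2 \<partial>wmeasure \<Omega>) \<le> \<delta>"
    if "admissible \<Omega> M y" "D y \<le> real n * (\<kappa> * \<delta> / 2)" "0 < \<epsilon>" for n y \<epsilon>
    using that
  proof (induction n arbitrary: y \<epsilon>)
    case 0
    then have "M\<^sup>2 * D y \<le> 0" by (simp add: mult_nonneg_nonpos)
    then have "(\<integral>x. (defect M (y x))\<^sup>2 \<partial>wmeasure \<Omega>) \<le> \<delta>"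
      using integral_defect(3)[OF \<Omega> 0(1)] \<delta> by (simp add: D_def)
    then show ?case using 0 neutral_zero by (intro exI[of _ y]) simp
  next
    case (Suc n)
    show ?case
    proof (cases "(\<integral>x. (defect M (y x))\<^sup>2 \<partial>wmeasure \<Omega>) \<le> \<delta>")
      case True
      then show ?thesis using Suc.prems neutral_zero by (intro exI[of _ y]) simp
    next
      case False
      \<comment> \<open>At most half of the gain may be lost, and half of the orthogonality budget
        is left for the later steps.\<close>
      define \<epsilon>' where "\<epsilon>' = min (\<epsilon> / 2) (\<kappa> * \<delta> / 2)"
      have \<epsilon>': "0 < \<epsilon>'" "\<epsilon>' \<le> \<epsilon> / 2" "\<epsilon>' \<le> \<kappa> * \<delta> / 2" using Suc.prems \<kappa> \<delta> by (auto simp: \<epsilon>'_def)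
      obtain \<phi> where \<phi>: "neutral \<Omega> \<phi>" "admissible \<Omega> M (\<lambda>x. y x + \<phi> x)"
        "\<bar>\<integral>y. z y \<bullet> \<phi> y \<partial>wmeasure \<Omega>\<bar> \<le> \<epsilon>'"
        "(\<integral>x. (norm (y x + \<phi> x))\<^sup>2 \<partial>wmeasure \<Omega>) \<ge> (\<integral>x. (norm (y x))\<^sup>2 \<partial>wmeasure \<Omega>)
          + \<kappa> * (\<integral>x. (defect M (y x))\<^sup>2 \<partial>wmeasure \<Omega>) - \<epsilon>'"
        using step[OF Suc.prems(1) zc zn \<epsilon>'(1)] by blast
      have "\<kappa> * \<delta> \<le> \<kappa> * (\<integral>x. (defect M (y x))\<^sup>2 \<partial>wmeasure \<Omega>)"
        using False \<kappa> by (intro mult_left_mono) auto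
      then have "D (\<lambda>x. y x + \<phi> x) \<le> D y - \<kappa> * \<delta> / 2"
        using \<phi>(4) \<epsilon>'(3) J[OF \<phi>(2)] J[OF Suc.prems(1)] by linarith
      also have "\<dots> \<le> real n * (\<kappa> * \<delta> / 2)" using Suc.prems(2) by (simp add: algebra_simps)
      finally have "D (\<lambda>x. y x + \<phi> x) \<le> real n * (\<kappa> * \<delta> / 2)" .
      from Suc.IH[OF \<phi>(2) this, of "\<epsilon> / 2"] Suc.prems(3)
      obtain z' where z': "admissible \<Omega> M z'" "neutral \<Omega> (\<lambda>x. z' x - (y x + \<phi> x))"
        "\<bar>\<integral>x. z x \<bullet> (z' x - (y x + \<phi> x)) \<partial>wmeasure \<Omega>\<bar> \<le> \<epsilon> / 2" "(\<integral>x. (defect M (z' x))\<^sup>2 \<partial>wmeasure \<Omega>) \<le> \<delta>"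
        by auto
      have "(\<integral>x. z x \<bullet> (z' x - y x) \<partial>wmeasure \<Omega>) =
          (\<integral>x. z x \<bullet> (z' x - (y x + \<phi> x)) + z x \<bullet> \<phi> x \<partial>wmeasure \<Omega>)"
        unfolding inner_add_right[symmetric] by simp
      also have "\<dots> = (\<integral>x. z x \<bullet> (z' x - (y x + \<phi> x)) \<partial>wmeasure \<Omega>) + (\<integral>x. z x \<bullet> \<phi> x \<partial>wmeasure \<Omega>)"
        by (intro Bochner_Integration.integral_add integrable_inner_neutral[OF \<Omega> zc zn] z'(2) \<phi>(1))
      finally have "\<bar>\<integral>x. z x \<bullet> (z' x - y x) \<partial>wmeasure \<Omega>\<bar> \<le> \<epsilon>"
        using z'(3) \<phi>(3) \<epsilon>'(2) by linarith
      moreover have "neutral \<Omega> (\<lambda>x. z' x - y x)"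
        by (rule neutral_diff_trans[OF \<Omega> _ z'(2)]) (simp add: \<phi>(1))
      ultimately show ?thesis using z' by blast
    qed
  qed note ind = this
  obtain n where "D z / (\<kappa> * \<delta> / 2) \<le> real n" using real_arch_simple by blast
  then have "D z \<le> real n * (\<kappa> * \<delta> / 2)" using \<kappa> \<delta> by (simp add: pos_divide_le_eq)
  from ind[OF z this \<epsilon>] that show ?thesis by blast
qed

lemma small_defect:
  assumes \<Omega>: "open \<Omega>" and M: "0 < M" and z: "admissible \<Omega> M z" and \<epsilon>: "0 < \<epsilon>"
  obtains z' where "admissible \<Omega> M z'" "neutral \<Omega> (\<lambda>x. z' x - z x)"
    "\<bar>\<integral>y. z y \<bullet> (z' y - z y) \<partial>wmeasure \<Omega>\<bar> \<le> \<epsilon>" "(\<integral>y. defect M (z' y) \<partial>wmeasure \<Omega>) \<le> \<epsilon>"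
proof -
  define \<nu> where "\<nu> = measure (wmeasure \<Omega>) \<Omega>"
  have \<nu>: "0 \<le> \<nu>" by (simp add: \<nu>_def)
  \<comment> \<open>With the bound \<open>a * \<epsilon> / 2\<close> for the mean squared defect,
    both terms of \<open>integral_defect(4)\<close> are at most \<open>\<epsilon> / 2\<close>. Using
    \<open>\<nu> + 1\<close> avoids division by zero.\<close>
  define a where "a = \<epsilon> / (2 * (\<nu> + 1))"
  have a: "0 < a" "a * \<nu> \<le> \<epsilon> / 2" using \<epsilon> \<nu> by (auto simp: a_def field_simps)
  have "0 < a * \<epsilon> / 2" using a \<epsilon> by simp
  from small_defect_sq[OF \<Omega> M z \<epsilon> this]
  obtain z' where z': "admissible \<Omega> M z'" "neutral \<Omega> (\<lambda>x. z' x - z x)"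
    "\<bar>\<integral>y. z y \<bullet> (z' y - z y) \<partial>wmeasure \<Omega>\<bar> \<le> \<epsilon>" "(\<integral>y. (defect M (z' y))\<^sup>2 \<partial>wmeasure \<Omega>) \<le> a * \<epsilon> / 2" .
  have "(\<integral>y. defect M (z' y) \<partial>wmeasure \<Omega>) \<le> a * \<nu> + (\<integral>y. (defect M (z' y))\<^sup>2 \<partial>wmeasure \<Omega>) / a"
    unfolding \<nu>_def by (rule integral_defect(4)[OF \<Omega> z'(1) a(1)])
  also have "(\<integral>y. (defect M (z' y))\<^sup>2 \<partial>wmeasure \<Omega>) / a \<le> (a * \<epsilon> / 2) / a"
    using z'(4) a by (intro divide_right_mono) auto
  also have "a * \<nu> + (a * \<epsilon> / 2) / a \<le> \<epsilon>" using a by simp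
  finally show ?thesis using that z' by simp
qed

text \<open>The sum of the functions has a finite integral, hence is finite almost everywhere. This
  gives pointwise convergence without passing to a subsequence.\<close>

lemma AE_summable:
  fixes f :: "nat \<Rightarrow> 'a \<Rightarrow> real"
  assumes "\<And>n. integrable M (f n)" "\<And>n. AE x in M. 0 \<le> f n x" "\<And>n. integral\<^sup>L M (f n) \<le> c n" "summable c"
  shows "AE x in M. summable (\<lambda>n. f n x)"
proof -
  have c0: "0 \<le> c n" for n
    using integral_nonneg_AE[OF assms(2)[of n]] assms(3)[of n] by linarith
  have "(\<integral>\<^sup>+x. (\<Sum>n. ennreal (f n x)) \<partial>M) = (\<Sum>n. \<integral>\<^sup>+x. ennreal (f n x) \<partial>M)"
    using assms(1) by (intro nn_integral_suminf) auto
  also have "\<dots> = (\<Sum>n. ennreal (integral\<^sup>L M (f n)))"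
    by (intro suminf_cong nn_integral_eq_integral assms)
  also have "\<dots> \<le> (\<Sum>n. ennreal (c n))" by (intro suminf_le ennreal_leI assms) auto
  also have "\<dots> < \<infinity>" using ennreal_suminf_neq_top[OF assms(4) c0] by (simp add: less_top)
  finally have "AE x in M. (\<Sum>n. ennreal (f n x)) \<noteq> \<infinity>"
    using assms(1) by (intro nn_integral_PInf_AE) auto
  moreover have "AE x in M. \<forall>n. 0 \<le> f n x" using assms(2) by (simp add: AE_all_countable)
  ultimately show ?thesis
    by eventually_elim (auto intro: summable_suminf_not_top)
qed

text \<open>Almost orthogonality bounds the squared distance of consecutive stages by the increase
  of the squared norm, which is at most the defect still present. The distances are thus summable in
  mean, and so are the defects; hence the stages converge almost everywhere and the limit has no
  defect.\<close>

lemma convex_integration: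
  assumes \<Omega>: "open \<Omega>" and z0: "admissible \<Omega> M z0" and M: "0 < M"
  obtains zs where "\<And>n. admissible \<Omega> M (zs n)" "\<And>n. neutral \<Omega> (\<lambda>x. zs n x - z0 x)"
    "AE x in lebesgue_on \<Omega>. convergent (\<lambda>n. zs n x) \<and> norm (lim (\<lambda>n. zs n x)) = M"
proof -
  have \<Omega>m: "\<Omega> \<in> sets lebesgue" using \<Omega> by (simp add: lborelD)
  interpret finite_measure "wmeasure \<Omega>" by (rule finite_measure_wmeasure[OF \<Omega>m])
  \<comment> \<open>The square root \<open>(1 / 2) ^ n\<close> must still be summable, since the
    mean distance of consecutive stages is of that order.\<close>
  define \<delta> where "\<delta> n = (1 / 4 :: real) ^ n" for n :: nat
  have \<delta>: "0 < \<delta> n" for n by (simp add: \<delta>_def)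
  define P where "P z \<longleftrightarrow> admissible \<Omega> M z \<and> neutral \<Omega> (\<lambda>x. z x - z0 x)" for z
  define Q where "Q n z z' \<longleftrightarrow> \<bar>\<integral>y. z y \<bullet> (z' y - z y) \<partial>wmeasure \<Omega>\<bar> \<le> \<delta> n \<and> (\<integral>y. defect M (z' y) \<partial>wmeasure \<Omega>) \<le> \<delta> n
      \<and> neutral \<Omega> (\<lambda>x. z' x - z x)" for n z z'
  have "\<exists>ys. \<forall>n. P (ys n) \<and> Q n (ys n) (ys (Suc n))"
  proof (rule dependent_nat_choice)
    show "\<exists>z. P z" using z0 neutral_zero by (intro exI[of _ z0]) (simp add: P_def)
    show "\<exists>z'. P z' \<and> Q n z z'" if "P z" for z n
    proof -
      from that have z: "admissible \<Omega> M z" "neutral \<Omega> (\<lambda>x. z x - z0 x)" by (auto simp: P_def)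
      from small_defect[OF \<Omega> M z(1) \<delta>[of n]] obtain z' where
        "admissible \<Omega> M z'" "neutral \<Omega> (\<lambda>x. z' x - z x)"
        "\<bar>\<integral>y. z y \<bullet> (z' y - z y) \<partial>wmeasure \<Omega>\<bar> \<le> \<delta> n" "(\<integral>y. defect M (z' y) \<partial>wmeasure \<Omega>) \<le> \<delta> n" .
      then show ?thesis using neutral_diff_trans[OF \<Omega> z(2)] by (auto simp: P_def Q_def)
    qed
  qed
  then obtain ys where ys: "\<And>n. P (ys n)" "\<And>n. Q n (ys n) (ys (Suc n))" by blast
  \<comment> \<open>The shift by one drops the starting field, whose defect is not small, so that
    the bounds hold from index 0 on.\<close>
  define zs where "zs n = ys (Suc n)" for n
  have adm: "admissible \<Omega> M (zs n)" and neu: "neutral \<Omega> (\<lambda>x. zs n x - z0 x)" for n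
    using ys(1) by (auto simp: zs_def P_def)
  have zd: "(\<integral>y. defect M (zs n y) \<partial>wmeasure \<Omega>) \<le> \<delta> n" for n
    using ys(2)[of n] by (simp add: zs_def Q_def)
  have zi: "\<bar>\<integral>y. zs n y \<bullet> (zs (Suc n) y - zs n y) \<partial>wmeasure \<Omega>\<bar> \<le> \<delta> n" for n
  proof -
    have "\<bar>\<integral>y. zs n y \<bullet> (zs (Suc n) y - zs n y) \<partial>wmeasure \<Omega>\<bar> \<le> \<delta> (Suc n)"
      using ys(2)[of "Suc n"] by (simp add: zs_def Q_def)
    also have "\<delta> (Suc n) \<le> \<delta> n" by (simp add: \<delta>_def)
    finally show ?thesis .
  qed
  have nd: "neutral \<Omega> (\<lambda>x. zs (Suc n) x - zs n x)" for n
    using ys(2)[of "Suc n"] by (simp add: zs_def Q_def)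
  have cont: "continuous_on \<Omega> (zs n)" for n using adm by (simp add: admissible_def)
  \<comment> \<open>One \<delta> comes from the increase of the squared norm, two from the mixed
    term.\<close>
  have D2: "(\<integral>y. (norm (zs (Suc n) y - zs n y))\<^sup>2 \<partial>wmeasure \<Omega>) \<le> 3 * \<delta> n"
    and i2: "integrable (wmeasure \<Omega>) (\<lambda>y. (norm (zs (Suc n) y - zs n y))\<^sup>2)" for n
  proof -
    note i = integrable_defect(3)[OF \<Omega> adm] integrable_inner_neutral[OF \<Omega> cont admissible_norm[OF adm] nd]
    have eq: "(norm (zs (Suc n) y - zs n y))\<^sup>2 = (norm (zs (Suc n) y))\<^sup>2 - (norm (zs n y))\<^sup>2 - 2 * (zs n y \<bullet> (zs (Suc n) y - zs n y))" for y
      by (simp add: power2_norm_eq_inner inner_commute algebra_simps inner_diff_left inner_diff_right)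
    show "integrable (wmeasure \<Omega>) (\<lambda>y. (norm (zs (Suc n) y - zs n y))\<^sup>2)"
      unfolding eq by (intro Bochner_Integration.integrable_diff integrable_mult_right i)
    have "(\<integral>y. (norm (zs (Suc n) y - zs n y))\<^sup>2 \<partial>wmeasure \<Omega>) =
      (\<integral>y. (norm (zs (Suc n) y))\<^sup>2 \<partial>wmeasure \<Omega>) - (\<integral>y. (norm (zs n y))\<^sup>2 \<partial>wmeasure \<Omega>)
       - 2 * (\<integral>y. zs n y \<bullet> (zs (Suc n) y - zs n y) \<partial>wmeasure \<Omega>)"
      unfolding eq using i(1)[of n] i(1)[of "Suc n"] i(2)[of n]
      by (subst Bochner_Integration.integral_diff, simp, simp, subst Bochner_Integration.integral_diff) auto
    then show "(\<integral>y. (norm (zs (Suc n) y - zs n y))\<^sup>2 \<partial>wmeasure \<Omega>) \<le> 3 * \<delta> n"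
      using zi[of n] zd[of n] integral_defect(1)[OF \<Omega> adm[of n]] integral_defect(1,2)[OF \<Omega> adm[of "Suc n"]]
      by linarith
  qed
  define \<nu> where "\<nu> = measure (wmeasure \<Omega>) \<Omega>"
  have "AE x in wmeasure \<Omega>. summable (\<lambda>n. norm (zs (Suc n) x - zs n x))"
  proof (rule AE_summable)
    show i1: "integrable (wmeasure \<Omega>) (\<lambda>y. norm (zs (Suc n) y - zs n y))" for n
    proof (rule integrable_wmeasure_continuous[OF \<Omega>])
      show "norm (norm (zs (Suc n) y - zs n y)) \<le> M + M" if "y \<in> \<Omega>" for y
        using norm_triangle_ineq4[of "zs (Suc n) y" "zs n y"] admissible_norm[OF adm[of n] that]
          admissible_norm[OF adm[of "Suc n"] that] by simp
    qed (intro continuous_intros cont)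
    show "(\<integral>y. norm (zs (Suc n) y - zs n y) \<partial>wmeasure \<Omega>) \<le> (\<nu> + 3) * (1 / 2) ^ n" for n
    proof -
      define h where "h = (1 / 2 :: real) ^ n"
      have h: "0 < h" "\<delta> n = h * h" by (auto simp: h_def \<delta>_def power_mult_distrib[symmetric])
      have "(\<integral>y. norm (zs (Suc n) y - zs n y) \<partial>wmeasure \<Omega>) \<le> (\<integral>y. h + (norm (zs (Suc n) y - zs n y))\<^sup>2 / h \<partial>wmeasure \<Omega>)"
      proof (rule integral_mono[OF i1])
        show "integrable (wmeasure \<Omega>) (\<lambda>y. h + (norm (zs (Suc n) y - zs n y))\<^sup>2 / h)" using i2 by simp
        show "d \<le> h + d\<^sup>2 / h" for d :: real by (rule le_add_square_divide[OF h(1)])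
      qed
      also have "\<dots> = h * \<nu> + (\<integral>y. (norm (zs (Suc n) y - zs n y))\<^sup>2 \<partial>wmeasure \<Omega>) / h"
        using i2 by (simp add: mult.commute \<nu>_def)
      also have "\<dots> \<le> h * \<nu> + (3 * \<delta> n) / h"
        using D2[of n] h by (intro add_left_mono divide_right_mono) auto
      also have "\<dots> = (\<nu> + 3) * h" using h by (simp add: algebra_simps)
      finally show ?thesis by (simp add: h_def)
    qed
    show "summable (\<lambda>n. (\<nu> + 3) * (1 / 2) ^ n)" by (intro summable_mult summable_geometric) simp
  qed simp
  moreover have "AE x in wmeasure \<Omega>. summable (\<lambda>n. defect M (zs n x))"
  proof (rule AE_summable[OF integrable_defect(2)[OF \<Omega> adm] _ zd])
    show "AE x in wmeasure \<Omega>. 0 \<le> defect M (zs n x)" for n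
      using admissible_defect(1)[OF adm] by (intro AE_I2) (simp add: less_imp_le)
    show "summable \<delta>" unfolding \<delta>_def by (intro summable_geometric) simp
  qed
  ultimately have "AE x in wmeasure \<Omega>. convergent (\<lambda>n. zs n x) \<and> norm (lim (\<lambda>n. zs n x)) = M"
  proof eventually_elim
    case (elim x)
    have "summable (\<lambda>n. zs (Suc n) x - zs n x)" using elim(1) by (rule summable_norm_cancel)
    then have "convergent (\<lambda>n. \<Sum>k<n. zs (Suc k) x - zs k x)" by (simp add: summable_iff_convergent)
    then have "convergent (\<lambda>n. zs n x - zs 0 x)" unfolding sum_lessThan_telescope[of "\<lambda>n. zs n x"] .
    from convergent_add[OF this convergent_const[of "zs 0 x"]]
    have c: "convergent (\<lambda>n. zs n x)" by simp
    then have l: "(\<lambda>n. zs n x) \<longlonglongrightarrow> lim (\<lambda>n. zs n x)" by (simp add: convergent_LIMSEQ_iff)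
    have "(\<lambda>n. defect M (zs n x)) \<longlonglongrightarrow> defect M (lim (\<lambda>n. zs n x))"
      unfolding defect_def by (intro tendsto_intros l)
    moreover have "(\<lambda>n. defect M (zs n x)) \<longlonglongrightarrow> 0" by (rule summable_LIMSEQ_zero[OF elim(2)])
    ultimately have "defect M (lim (\<lambda>n. zs n x)) = 0" by (rule LIMSEQ_unique)
    then have "norm (lim (\<lambda>n. zs n x)) = M" using M by (simp add: defect_def power2_eq_iff_nonneg)
    with c show ?case by simp
  qed
  then have "AE x in lebesgue_on \<Omega>. convergent (\<lambda>n. zs n x) \<and> norm (lim (\<lambda>n. zs n x)) = M"
    by (simp add: AE_wmeasure)
  with that adm neu show ?thesis by blast
qed

section \<open>The theorem\<close>

text \<open>Dominated convergence with the majorant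
  \<open>B * \<bar>prodfn c x * norm (g x)\<bar>\<close>. Its integrability is what the cutoff has
  to provide, because the limit \<open>Y\<close> is merely bounded.\<close>

lemma limit_orthogonal:
  fixes \<phi> :: "nat \<Rightarrow> real^3 \<Rightarrow> real^3^3"
  assumes \<Omega>: "open \<Omega>" and \<phi>: "\<And>n. neutral \<Omega> (\<phi> n)" "\<And>n x. x \<in> \<Omega> \<Longrightarrow> norm (\<phi> n x) \<le> B"
    and Y: "Y \<in> borel_measurable (lebesgue_on \<Omega>)" "AE x in lebesgue_on \<Omega>. (\<lambda>n. \<phi> n x) \<longlonglongrightarrow> Y x"
    and pg: "(p, g) \<in> W12_grad \<Omega>" and c: "\<And>k. smooth1 (c k)"
    "\<And>x k. x \<in> \<Omega> \<Longrightarrow> p x \<noteq> 0 \<Longrightarrow> prodfn (c(k := deriv (c k))) x = 0"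
    and int: "integrable (lebesgue_on \<Omega>) (\<lambda>x. prodfn c x * norm (g x))"
  shows "integrable (lebesgue_on \<Omega>) (\<lambda>x. prodfn c x * (Y x $ i \<bullet> g x))"
    "integral\<^sup>L (lebesgue_on \<Omega>) (\<lambda>x. prodfn c x * (Y x $ i \<bullet> g x)) = 0"
proof -
  have \<Omega>m: "\<Omega> \<in> sets lebesgue" using \<Omega> by (simp add: lborelD)
  have g: "g \<in> borel_measurable (lebesgue_on \<Omega>)" using pg by (auto simp: W12_grad_def L_two_def)
  have cm: "prodfn c \<in> borel_measurable (lebesgue_on \<Omega>)"
    using prodfn_continuous[of c, OF c(1)] \<Omega>m
    by (metis continuous_imp_measurable_on_sets_lebesgue continuous_on_subset subset_UNIV)
  have Yi: "(\<lambda>x. Y x $ i) \<in> borel_measurable (lebesgue_on \<Omega>)"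
    by (rule measurable_compose[OF Y(1)], rule borel_measurable_continuous_onI) (intro continuous_intros)
  have 1: "(\<lambda>x. prodfn c x * (Y x $ i \<bullet> g x)) \<in> borel_measurable (lebesgue_on \<Omega>)"
    by (intro borel_measurable_times borel_measurable_inner cm Yi g)
  have 2: "(\<lambda>x. prodfn c x * (\<phi> n x $ i \<bullet> g x)) \<in> borel_measurable (lebesgue_on \<Omega>)" for n
    using neutral_integrable[OF \<Omega> \<phi>(1) pg c(1)] by (rule borel_measurable_integrable)
  have 3: "integrable (lebesgue_on \<Omega>) (\<lambda>x. B * \<bar>prodfn c x * norm (g x)\<bar>)"
    using int by simp
  have 4: "AE x in lebesgue_on \<Omega>. (\<lambda>n. prodfn c x * (\<phi> n x $ i \<bullet> g x)) \<longlonglongrightarrow> prodfn c x * (Y x $ i \<bullet> g x)"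
    using Y(2) by eventually_elim (intro tendsto_intros)
  have 5: "AE x in lebesgue_on \<Omega>. norm (prodfn c x * (\<phi> n x $ i \<bullet> g x)) \<le> B * \<bar>prodfn c x * norm (g x)\<bar>" for n
  proof (rule AE_I2)
    fix x assume "x \<in> space (lebesgue_on \<Omega>)"
    then have x: "x \<in> \<Omega>" by simp
    have "norm (\<phi> n x $ i) \<le> B"
      using Finite_Cartesian_Product.norm_nth_le[of "\<phi> n x" i] \<phi>(2)[OF x, of n] by linarith
    then have "\<bar>\<phi> n x $ i \<bullet> g x\<bar> \<le> B * norm (g x)"
      by (rule abs_inner_le_mult) simp
    then have "\<bar>prodfn c x\<bar> * \<bar>\<phi> n x $ i \<bullet> g x\<bar> \<le> \<bar>prodfn c x\<bar> * (B * norm (g x))"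
      by (rule mult_left_mono) simp
    then show "norm (prodfn c x * (\<phi> n x $ i \<bullet> g x)) \<le> B * \<bar>prodfn c x * norm (g x)\<bar>"
      by (simp add: abs_mult mult_ac)
  qed
  show "integrable (lebesgue_on \<Omega>) (\<lambda>x. prodfn c x * (Y x $ i \<bullet> g x))"
    by (rule integrable_dominated_convergence[OF 1 2 3 4 5])
  have "(\<lambda>n. integral\<^sup>L (lebesgue_on \<Omega>) (\<lambda>x. prodfn c x * (\<phi> n x $ i \<bullet> g x))) \<longlonglongrightarrow>
      integral\<^sup>L (lebesgue_on \<Omega>) (\<lambda>x. prodfn c x * (Y x $ i \<bullet> g x))"
    by (rule integral_dominated_convergence[OF 1 2 3 4 5])
  moreover have "integral\<^sup>L (lebesgue_on \<Omega>) (\<lambda>x. prodfn c x * (\<phi> n x $ i \<bullet> g x)) = 0" for n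
    by (rule neutral_orthogonal[OF \<phi>(1) pg c])
  ultimately show "integral\<^sup>L (lebesgue_on \<Omega>) (\<lambda>x. prodfn c x * (Y x $ i \<bullet> g x)) = 0"
    by (simp add: LIMSEQ_const_iff)
qed

text \<open>Equality in \<open>norm z \<le> l1 z\<close> forces at most one nonzero entry, hence at most one nonzero row.\<close>

lemma rows_disjoint:
  assumes "norm z = M" "l1 z \<le> M" "i \<noteq> i'"
  shows "z $ i = 0 \<or> z $ i' = 0"
proof -
  define n where "n k = norm (z $ k)" for k
  have n: "0 \<le> n k" for k by (simp add: n_def)
  \<comment> \<open>It is enough to compare row norms: the square of their sum does not exceed the
    sum of their squares, so the mixed products, being nonnegative, all vanish.\<close>
  have "(\<Sum>k\<in>UNIV. n k) \<le> l1 z"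
    unfolding n_def l1_def by (intro sum_mono norm_le_l1_cart)
  then have "(\<Sum>k\<in>UNIV. n k)\<^sup>2 \<le> M\<^sup>2"
    using assms(2) n by (intro power_mono sum_nonneg) auto
  also have "M\<^sup>2 = (\<Sum>k\<in>UNIV. (n k)\<^sup>2)"
    using assms(1) by (auto simp: n_def norm_vec_def L2_set_def sum_nonneg)
  finally have "2 * (n 1 * n 2 + n 1 * n 3 + n 2 * n 3) \<le> 0"
    by (simp add: sum_3 power2_eq_square algebra_simps)
  moreover have nn: "0 \<le> n 1 * n 2" "0 \<le> n 1 * n 3" "0 \<le> n 2 * n 3" using n by simp_all
  ultimately have "n 1 * n 2 + n 1 * n 3 + n 2 * n 3 = 0" by (intro antisym add_nonneg_nonneg) auto
  then have "n 1 * n 2 = 0" "n 1 * n 3 = 0" "n 2 * n 3 = 0"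
    using nn by (simp_all only: add_nonneg_eq_0_iff[OF add_nonneg_nonneg] add_nonneg_eq_0_iff)
  then show ?thesis
    using exhaust_3[of i] exhaust_3[of i'] assms(3) by (auto simp: n_def)
qed

text \<open>Strong convexity at 2, the midpoint of 1 and 3. Positivity makes the normalising factor
  \<tau> well defined.\<close>

lemma strongly_convex_second_difference:
  assumes "strongly_convex \<beta>"
  shows "0 < \<beta> 1 - 2 * \<beta> 2 + \<beta> 3"
proof -
  from assms obtain \<kappa> where \<kappa>: "\<kappa> > 0" and
    "\<forall>x1>0. \<forall>x2>0. \<forall>t. 0 \<le> t \<and> t \<le> 1 \<longrightarrow>
     \<beta> (t * x1 + (1 - t) * x2) \<le> t * \<beta> x1 + (1 - t) * \<beta> x2 - \<kappa> * t * (1 - t) * \<bar>x1 - x2\<bar>\<^sup>2"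
    unfolding strongly_convex_def by blast
  from this(2)[rule_format, of 1 3 "1/2"] \<kappa> show ?thesis by simp
qed

text \<open>Once \<open>N\<close> exceeds the radius of a bounded set, the gradient of the product
  vanishes there, which is what \<open>neutral\<close> demands of a weight when \<open>p\<close>
  lives on that set.\<close>

definition cutoff :: "real \<Rightarrow> 3 \<Rightarrow> real \<Rightarrow> real" where
  "cutoff N k t = plateau (t / N)"

lemma cutoff:
  assumes "0 < N"
  shows "smooth1 (cutoff N k)" "(\<And>k. \<bar>x $ k\<bar> \<le> N) \<Longrightarrow> prodfn (cutoff N) x = 1"
    "\<bar>x $ k\<bar> < N \<Longrightarrow> prodfn ((cutoff N)(k := deriv (cutoff N k))) x = 0"
    "x \<notin> cbox (- vec (2 * N)) (vec (2 * N)) \<Longrightarrow> prodfn (cutoff N) x = 0"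
    "0 \<le> prodfn (cutoff N) x" "prodfn (cutoff N) x \<le> 1"
proof -
  have "cutoff N k = (\<lambda>t. plateau (inverse N * t + 0))" by (simp add: cutoff_def fun_eq_iff divide_inverse mult.commute)
  then show "smooth1 (cutoff N k)" using smooth1_affine[OF smooth1_plateau] by metis
  show "prodfn (cutoff N) x = 1" if "\<And>k. \<bar>x $ k\<bar> \<le> N"
    using that assms by (auto simp: prodfn_def cutoff_def plateau_eq_1)
  show "prodfn ((cutoff N)(k := deriv (cutoff N k))) x = 0" if "\<bar>x $ k\<bar> < N"
  proof -
    have "((\<lambda>t. 1) has_real_derivative 0) (at (x $ k))" by simp
    then have "(cutoff N k has_real_derivative 0) (at (x $ k))"
      by (rule has_field_derivative_transform_within_open[of _ _ _ "{- N<..<N}"])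
        (use that assms in \<open>auto simp: cutoff_def plateau_eq_1\<close>)
    then have "deriv (cutoff N k) (x $ k) = 0" by (rule DERIV_imp_deriv)
    then show ?thesis unfolding prodfn_def by (intro prod_zero) auto
  qed
  show "prodfn (cutoff N) x = 0" if "x \<notin> cbox (- vec (2 * N)) (vec (2 * N))"
  proof -
    from that obtain k where "\<not> ((- vec (2 * N)) $ k \<le> x $ k \<and> x $ k \<le> (vec (2 * N) :: real^3) $ k)"
      unfolding mem_box_cart by blast
    then have "2 \<le> \<bar>x $ k / N\<bar>" using assms by (auto simp: field_simps abs_if)
    then have "cutoff N k (x $ k) = 0" by (simp add: cutoff_def plateau_eq_0)
    then show ?thesis unfolding prodfn_def by (intro prod_zero) auto
  qed
  show "0 \<le> prodfn (cutoff N) x" "prodfn (cutoff N) x \<le> 1"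
    unfolding prodfn_def cutoff_def by (auto intro!: prod_nonneg prod_le_1 plateau_bounds)
qed

text \<open>Reduction to the version with inner products, applied to the field
  \<open>norm (g x)\<close> times a unit vector.\<close>

lemma integrable_compact_support_mult_norm:
  fixes f :: "real^3 \<Rightarrow> real" and g :: "real^3 \<Rightarrow> real^3"
  assumes "continuous_on UNIV f" "compact K" "\<And>x. x \<notin> K \<Longrightarrow> f x = 0"
    and \<Omega>: "\<Omega> \<in> sets lebesgue" and g: "g \<in> L_two \<Omega>"
  shows "integrable (lebesgue_on \<Omega>) (\<lambda>x. f x * norm (g x))"
proof -
  let ?e = "axis 1 1 :: real^3"
  have "(\<lambda>x. norm (g x) *\<^sub>R ?e) \<in> L_two \<Omega>"
    using g by (auto simp: L_two_def)
  then have "integrable (lebesgue_on \<Omega>) (\<lambda>x. (f x *\<^sub>R ?e) \<bullet> (norm (g x) *\<^sub>R ?e))"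
    by (intro integrable_compact_support_inner[OF _ assms(2) _ \<Omega>]) (auto intro!: continuous_intros assms)
  then show ?thesis by (simp add: inner_axis_axis mult.commute)
qed

lemma (in finite_measure) integrable_norm_of_square:
  fixes g :: "'a \<Rightarrow> 'b::{banach, second_countable_topology}"
  assumes "g \<in> borel_measurable M" "integrable M (\<lambda>x. (norm (g x))\<^sup>2)"
  shows "integrable M (\<lambda>x. norm (g x))"
proof (rule Bochner_Integration.integrable_bound)
  show "integrable M (\<lambda>x. 1 + (norm (g x))\<^sup>2)" using assms by simp
  have "norm y \<le> 1 + (norm y)\<^sup>2" for y :: 'b
    using le_add_square_divide[of 1 "norm y"] by simp
  then show "AE x in M. norm (norm (g x)) \<le> norm (1 + (norm (g x))\<^sup>2)"
    by (intro AE_I2) (simp add: abs_of_nonneg)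
qed (use assms in auto)

section \<open>Combinations of the limiting rows\<close>

definition row_comb :: "(3 \<Rightarrow> real) \<Rightarrow> real^3^3 \<Rightarrow> real^3" where
  "row_comb c z = (\<Sum>i\<in>UNIV. c i *\<^sub>R z $ i)"

lemma continuous_on_row_comb: "continuous_on A (row_comb c)"
  unfolding row_comb_def by (intro continuous_intros)

lemma norm_row_comb_le: "norm (row_comb c z) \<le> (\<Sum>i\<in>UNIV. \<bar>c i\<bar>) * norm z"
proof -
  have "norm (row_comb c z) \<le> (\<Sum>i\<in>UNIV. \<bar>c i\<bar> * norm (z $ i))"
    unfolding row_comb_def by (rule order_trans[OF norm_sum]) simp
  also have "\<dots> \<le> (\<Sum>i\<in>UNIV. \<bar>c i\<bar> * norm z)"
    by (intro sum_mono mult_left_mono Finite_Cartesian_Product.norm_nth_le) auto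
  finally show ?thesis by (simp add: sum_distrib_right)
qed

text \<open>Convex integration started from the matrix field whose three rows are all
  \<open>w\<close>. Each row of the limit then differs from \<open>w\<close> by a limit of neutral
  fields, so a combination of rows differs in the same sense from \<open>sum a UNIV\<close> times
  \<open>w\<close>.\<close>

lemma disjoint_solutions:
  fixes w :: "real^3 \<Rightarrow> real^3"
  assumes \<Omega>: "open \<Omega>" and w: "continuous_on \<Omega> w" "bounded (w ` \<Omega>)"
  obtains Z :: "real^3 \<Rightarrow> real^3^3" and M where "Z \<in> borel_measurable (lebesgue_on \<Omega>)"
    "AE x in lebesgue_on \<Omega>. norm (Z x) = M"
    "AE x in lebesgue_on \<Omega>. \<forall>i i'. i \<noteq> i' \<longrightarrow> Z x $ i = 0 \<or> Z x $ i' = 0"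
    "\<And>p g c a. (p, g) \<in> W12_grad \<Omega> \<Longrightarrow> (\<And>k. smooth1 (c k)) \<Longrightarrow>
      (\<And>x k. x \<in> \<Omega> \<Longrightarrow> p x \<noteq> 0 \<Longrightarrow> prodfn (c(k := deriv (c k))) x = 0) \<Longrightarrow>
      integrable (lebesgue_on \<Omega>) (\<lambda>x. prodfn c x * norm (g x)) \<Longrightarrow>
      integral\<^sup>L (lebesgue_on \<Omega>) (\<lambda>x. prodfn c x * ((row_comb a (Z x) - sum a UNIV *\<^sub>R w x) \<bullet> g x)) = 0"
proof -
  have \<Omega>m: "\<Omega> \<in> sets lebesgue" using \<Omega> by (simp add: lborelD)
  define z0 :: "real^3 \<Rightarrow> real^3^3" where "z0 x = (\<chi> i. w x)" for x
  obtain B where B: "0 < B" "\<And>x. x \<in> \<Omega> \<Longrightarrow> norm (w x) \<le> B"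
    using w(2) unfolding bounded_pos by auto
  \<comment> \<open>The start has norm at most 3 times that of \<open>w\<close>, and
    \<open>l1\<close> is at most 9 times the norm; adding 1 makes the constraint strict.\<close>
  define M where "M = 27 * B + 1"
  have M: "0 < M" using B by (simp add: M_def)
  have z0c: "continuous_on \<Omega> z0" unfolding z0_def by (intro continuous_on_vec_lambda w)
  have z0b: "l1 (z0 x) < M" if "x \<in> \<Omega>" for x
  proof -
    have "norm (z0 x) \<le> (\<Sum>i\<in>(UNIV::3 set). norm (z0 x $ i))"
      unfolding norm_vec_def by (rule L2_set_le_sum) simp
    also have "\<dots> = 3 * norm (w x)" by (simp add: z0_def)
    finally show ?thesis using l1_le_norm[of "z0 x"] B(2)[OF that] by (simp add: M_def)
  qed
  have z0: "admissible \<Omega> M z0" using z0c z0b by (simp add: admissible_def)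
  obtain zs where zs: "\<And>n. admissible \<Omega> M (zs n)" "\<And>n. neutral \<Omega> (\<lambda>x. zs n x - z0 x)"
    and conv: "AE x in lebesgue_on \<Omega>. convergent (\<lambda>n. zs n x) \<and> norm (lim (\<lambda>n. zs n x)) = M"
    by (rule convex_integration[OF \<Omega> z0 M]) blast
  define Z where "Z x = lim (\<lambda>n. zs n x)" for x
  have meas: "f \<in> borel_measurable (lebesgue_on \<Omega>)" if "continuous_on \<Omega> f" for f :: "real^3 \<Rightarrow> real^3^3"
    by (rule continuous_imp_measurable_on_sets_lebesgue[OF that \<Omega>m])
  have Zm: "Z \<in> borel_measurable (lebesgue_on \<Omega>)"
    unfolding Z_def by (intro borel_measurable_lim_metric meas) (use zs(1) in \<open>simp add: admissible_def\<close>)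
  have lim: "AE x in lebesgue_on \<Omega>. (\<lambda>n. zs n x) \<longlonglongrightarrow> Z x"
    using conv by eventually_elim (simp add: Z_def convergent_LIMSEQ_iff)
  show ?thesis
  proof (rule that[of Z M])
    show "Z \<in> borel_measurable (lebesgue_on \<Omega>)" by (rule Zm)
    show nM: "AE x in lebesgue_on \<Omega>. norm (Z x) = M" using conv by eventually_elim (simp add: Z_def)
    have sp: "AE x in lebesgue_on \<Omega>. x \<in> \<Omega>" by (rule AE_I2) simp
    show "AE x in lebesgue_on \<Omega>. \<forall>i i'. i \<noteq> i' \<longrightarrow> Z x $ i = 0 \<or> Z x $ i' = 0"
      using lim nM sp
    proof eventually_elim
      case (elim x)
      \<comment> \<open>The constraint survives in the limit as \<open>l1 \<le> M\<close>; together
        with \<open>norm = M\<close> this is the equality case.\<close>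
      have "(\<lambda>n. l1 (zs n x)) \<longlonglongrightarrow> l1 (Z x)"
        by (rule continuous_on_tendsto_compose[OF continuous_on_l1[of UNIV] elim(1)]) auto
      then have "l1 (Z x) \<le> M"
        by (rule LIMSEQ_le_const2) (use zs(1) elim(3) in \<open>auto simp: admissible_def less_imp_le\<close>)
      then show ?case using rows_disjoint[OF elim(2)] by blast
    qed
    fix p g c and a :: "3 \<Rightarrow> real"
    assume pg: "(p, g) \<in> W12_grad \<Omega>" and c: "\<And>k. smooth1 (c k)"
      "\<And>x k. x \<in> \<Omega> \<Longrightarrow> p x \<noteq> 0 \<Longrightarrow> prodfn (c(k := deriv (c k))) x = 0"
      and int: "integrable (lebesgue_on \<Omega>) (\<lambda>x. prodfn c x * norm (g x))"
    have bnd: "norm (zs n x - z0 x) \<le> M + M" if "x \<in> \<Omega>" for n x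
      using norm_triangle_ineq4[of "zs n x" "z0 x"] admissible_norm[OF zs(1)[of n] that] admissible_norm[OF z0 that]
      by linarith
    have Ym: "(\<lambda>x. Z x - z0 x) \<in> borel_measurable (lebesgue_on \<Omega>)"
      by (intro borel_measurable_diff Zm meas z0c)
    have Yl: "AE x in lebesgue_on \<Omega>. (\<lambda>n. zs n x - z0 x) \<longlonglongrightarrow> Z x - z0 x"
      using lim by eventually_elim (intro tendsto_intros)
    note lo = limit_orthogonal[OF \<Omega> zs(2) bnd Ym Yl pg c int]
    have "prodfn c x * ((row_comb a (Z x) - sum a UNIV *\<^sub>R w x) \<bullet> g x) =
        (\<Sum>i\<in>UNIV. a i * (prodfn c x * ((Z x - z0 x) $ i \<bullet> g x)))" for x
      by (simp add: row_comb_def z0_def sum_3 inner_add_left inner_diff_left) (simp add: algebra_simps)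
    then have "integral\<^sup>L (lebesgue_on \<Omega>) (\<lambda>x. prodfn c x * ((row_comb a (Z x) - sum a UNIV *\<^sub>R w x) \<bullet> g x)) =
        (\<Sum>i\<in>UNIV. integral\<^sup>L (lebesgue_on \<Omega>) (\<lambda>x. a i * (prodfn c x * ((Z x - z0 x) $ i \<bullet> g x))))"
      by (simp only:) (intro Bochner_Integration.integral_sum integrable_mult_right lo(1))
    also have "\<dots> = 0"
    proof (rule sum.neutral, rule ballI)
      show "integral\<^sup>L (lebesgue_on \<Omega>) (\<lambda>x. a i * (prodfn c x * ((Z x - z0 x) $ i \<bullet> g x))) = 0" for i
      proof -
        have "a i * integral\<^sup>L (lebesgue_on \<Omega>) (\<lambda>x. prodfn c x * ((Z x - z0 x) $ i \<bullet> g x)) = a i * 0"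
          by (rule arg_cong[OF lo(2)])
        also have "\<dots> = 0" by (rule mult_zero_right)
        finally show ?thesis unfolding integral_mult_right_zero .
      qed
    qed
    finally show "integral\<^sup>L (lebesgue_on \<Omega>) (\<lambda>x. prodfn c x * ((row_comb a (Z x) - sum a UNIV *\<^sub>R w x) \<bullet> g x)) = 0" .
  qed
qed

theorem theorem1p1:
  fixes \<Omega> :: "(real^3) set" and \<beta> :: "real \<Rightarrow> real" and f :: "(real^3 \<Rightarrow> real) \<Rightarrow> real"
  assumes "lipschitz_domain \<Omega>"
    and "strongly_convex \<beta>"
    and "distribution \<Omega> f"
    and "\<exists>w :: real^3 \<Rightarrow> real^3. continuous_on \<Omega> w \<and> bounded (w ` \<Omega>) \<and> div_eq \<Omega> w f"
  shows "\<exists>(v :: real^3 \<Rightarrow> real^3) (\<rho> :: real^3 \<Rightarrow> real).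
    v \<in> L_infinity \<Omega> \<and> \<rho> \<in> L_infinity \<Omega> \<and> (\<exists>c>0. AE x in lebesgue_on \<Omega>. c \<le> \<rho> x) \<and>
    div_eq \<Omega> (\<lambda>x. \<rho> x *\<^sub>R v x) (\<lambda>_. 0) \<and>
    div_eq \<Omega> v (\<lambda>_. 0) \<and>
    solenoidal_tangential \<Omega> v \<and>
    (emeasure lebesgue \<Omega> < \<infinity> \<longrightarrow> v \<in> H_space \<Omega>) \<and>
    div_eq \<Omega> (\<lambda>x. \<beta> (\<rho> x) *\<^sub>R v x) f"
proof -
  have \<Omega>: "open \<Omega>" using assms(1) by (simp add: lipschitz_domain_def)
  have \<Omega>m: "\<Omega> \<in> sets lebesgue" using \<Omega> by (simp add: lborelD)
  obtain w :: "real^3 \<Rightarrow> real^3" where w: "continuous_on \<Omega> w" "bounded (w ` \<Omega>)" "div_eq \<Omega> w f"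
    using assms(4) by blast
  obtain Z :: "real^3 \<Rightarrow> real^3^3" and M where Zm: "Z \<in> borel_measurable (lebesgue_on \<Omega>)"
    and ZM: "AE x in lebesgue_on \<Omega>. norm (Z x) = M"
    and disj: "AE x in lebesgue_on \<Omega>. \<forall>i i'. i \<noteq> i' \<longrightarrow> Z x $ i = 0 \<or> Z x $ i' = 0"
    and orth: "\<And>p g c a. (p, g) \<in> W12_grad \<Omega> \<Longrightarrow> (\<And>k. smooth1 (c k)) \<Longrightarrow>
      (\<And>x k. x \<in> \<Omega> \<Longrightarrow> p x \<noteq> 0 \<Longrightarrow> prodfn (c(k := deriv (c k))) x = 0) \<Longrightarrow>
      integrable (lebesgue_on \<Omega>) (\<lambda>x. prodfn c x * norm (g x)) \<Longrightarrow>
      integral\<^sup>L (lebesgue_on \<Omega>) (\<lambda>x. prodfn c x * ((row_comb a (Z x) - sum a UNIV *\<^sub>R w x) \<bullet> g x)) = 0"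
    by (rule disjoint_solutions[OF \<Omega> w(1,2)]) blast
  define \<tau> where "\<tau> = inverse (\<beta> 1 - 2 * \<beta> 2 + \<beta> 3)"
  have \<tau>: "\<tau> * (\<beta> 1 - 2 * \<beta> 2 + \<beta> 3) = 1"
    using strongly_convex_second_difference[OF assms(2)] by (simp add: \<tau>_def)
  \<comment> \<open>The solution of the three linear equations \<open>a0\<close> and
    \<open>a1\<close>: the coefficients annihilate constants and the values \<open>d i\<close>, and
    reproduce 1 on the values of \<beta>.\<close>
  define a :: "3 \<Rightarrow> real" where "a i = (if i = 2 then - 2 * \<tau> else \<tau>)" for i
  define d :: "3 \<Rightarrow> real" where "d i = (if i = 1 then 1 else if i = 2 then 2 else 3)" for i
  have a0: "sum a UNIV = 0" "(\<Sum>i\<in>UNIV. d i * a i) = 0"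
    by (simp_all add: sum_3 a_def d_def)
  have a1: "(\<Sum>i\<in>UNIV. \<beta> (d i) * a i) = 1"
    using \<tau> by (simp add: sum_3 a_def d_def algebra_simps)
  define v where "v x = row_comb a (Z x)" for x
  \<comment> \<open>The last case also covers points where all rows vanish. There \<open>v\<close>
    is 0, and the value 3 keeps \<rho> within {1, 2, 3} everywhere.\<close>
  define \<rho> where "\<rho> x = (if Z x $ 1 \<noteq> 0 then 1 else if Z x $ 2 \<noteq> 0 then 2 else 3 :: real)" for x
  \<comment> \<open>Since at most one row is nonzero, any function of \<rho> times \<open>v\<close>
    is linear in the rows. It is used for the constant 1, the identity and \<beta>.\<close>
  have \<rho>v: "AE x in lebesgue_on \<Omega>. h (\<rho> x) *\<^sub>R v x = row_comb (\<lambda>i. h (d i) * a i) (Z x)" for h :: "real \<Rightarrow> real"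
    using disj
  proof eventually_elim
    case (elim x)
    have "Z x $ 1 = 0 \<or> Z x $ 2 = 0" "Z x $ 1 = 0 \<or> Z x $ 3 = 0" "Z x $ 2 = 0 \<or> Z x $ 3 = 0"
      using elim by simp_all
    then show ?case by (auto simp: \<rho>_def v_def row_comb_def sum_3 d_def)
  qed
  have rm: "(\<lambda>x. row_comb b (Z x)) \<in> borel_measurable (lebesgue_on \<Omega>)" for b
    by (rule measurable_compose[OF Zm borel_measurable_continuous_onI[OF continuous_on_row_comb]])
  have vm: "v \<in> borel_measurable (lebesgue_on \<Omega>)" unfolding v_def by (rule rm)
  have Zi: "(\<lambda>x. Z x $ i) \<in> borel_measurable (lebesgue_on \<Omega>)" for i
    by (rule measurable_compose[OF Zm], rule borel_measurable_continuous_onI) (intro continuous_intros)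
  have \<rho>m: "\<rho> \<in> borel_measurable (lebesgue_on \<Omega>)"
    unfolding \<rho>_def using Zi[of 1] Zi[of 2] by measurable
  have vb: "AE x in lebesgue_on \<Omega>. norm (v x) \<le> (\<Sum>i\<in>UNIV. \<bar>a i\<bar>) * M"
    using ZM by eventually_elim (use norm_row_comb_le in \<open>auto simp: v_def\<close>)
  \<comment> \<open>If \<open>g\<close> itself is integrable, the constant weight 1 is
    allowed.\<close>
  have orth0: "integral\<^sup>L (lebesgue_on \<Omega>) (\<lambda>x. (row_comb b (Z x) - sum b UNIV *\<^sub>R w x) \<bullet> g x) = 0"
    if "(p, g) \<in> W12_grad \<Omega>" "integrable (lebesgue_on \<Omega>) (\<lambda>x. norm (g x))" for p g b
  proof -
    have "deriv (\<lambda>t::real. 1::real) = (\<lambda>t. 0)" by auto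
    then have "prodfn ((\<lambda>k t. 1)(k := deriv (\<lambda>t. 1))) x = 0" for k x
      unfolding prodfn_def by (intro prod_zero) auto
    moreover have "prodfn (\<lambda>k t. 1) x = 1" for x by (simp add: prodfn_def)
    ultimately show ?thesis using orth[OF that(1), of "\<lambda>k t. 1" b] that(2) by simp
  qed
  have grad_int: "integrable (lebesgue_on \<Omega>) (\<lambda>x. norm (grad \<psi> x))" if \<psi>: "\<psi> \<in> test_functions \<Omega>" for \<psi>
  proof -
    obtain K where K: "compact K" "\<And>x i. x \<notin> K \<Longrightarrow> partial_deriv i \<psi> x = 0"
      by (rule test_functionsE[OF \<psi>]) blast
    have "grad \<psi> x = 0" if "x \<notin> K" for x using K(2)[OF that] by (simp add: grad_def vec_eq_iff)
    then show ?thesis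
      by (intro integrable_compact_support(3)[OF _ K(1) _ \<Omega>m] continuous_on_norm continuous_on_grad[OF \<psi>]) simp
  qed
  have bounded_int: "integrable (lebesgue_on \<Omega>) (\<lambda>x. u x \<bullet> g x)"
    if u: "u \<in> borel_measurable (lebesgue_on \<Omega>)" "AE x in lebesgue_on \<Omega>. norm (u x) \<le> C"
      and g: "g \<in> borel_measurable (lebesgue_on \<Omega>)" "integrable (lebesgue_on \<Omega>) (\<lambda>x. norm (g x))" for u g :: "real^3 \<Rightarrow> real^3" and C
  proof (rule Bochner_Integration.integrable_bound)
    show "integrable (lebesgue_on \<Omega>) (\<lambda>x. C * norm (g x))" using g by simp
    show "(\<lambda>x. u x \<bullet> g x) \<in> borel_measurable (lebesgue_on \<Omega>)" using u g by simp
    show "AE x in lebesgue_on \<Omega>. norm (u x \<bullet> g x) \<le> norm (C * norm (g x))"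
      using u(2)
    proof eventually_elim
      case (elim x)
      from abs_inner_le_mult[OF this order_refl, of "g x"] show ?case by simp
    qed
  qed
  have solves: "integral\<^sup>L (lebesgue_on \<Omega>) (\<lambda>x. h (\<rho> x) *\<^sub>R v x \<bullet> grad \<psi> x) =
      (\<Sum>i\<in>UNIV. h (d i) * a i) * integral\<^sup>L (lebesgue_on \<Omega>) (\<lambda>x. w x \<bullet> grad \<psi> x)"
    if \<psi>: "\<psi> \<in> test_functions \<Omega>" for h \<psi>
  proof -
    define b where "b i = h (d i) * a i" for i
    have gm: "grad \<psi> \<in> borel_measurable (lebesgue_on \<Omega>)"
      using continuous_on_grad[OF \<psi>] \<Omega>m
      by (metis continuous_imp_measurable_on_sets_lebesgue continuous_on_subset subset_UNIV)
    have hm: "AE x in lebesgue_on \<Omega>. h (\<rho> x) *\<^sub>R v x \<bullet> grad \<psi> x = row_comb b (Z x) \<bullet> grad \<psi> x"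
      using \<rho>v[of h] by eventually_elim (simp add: b_def[abs_def])
    have "(\<lambda>x. h (\<rho> x) *\<^sub>R v x \<bullet> grad \<psi> x) \<in> borel_measurable (lebesgue_on \<Omega>)"
    proof -
      \<comment> \<open>As \<rho> takes only three values, its composition with an arbitrary
        \<open>h\<close> is measurable.\<close>
      have "(\<lambda>x. h (\<rho> x)) = (\<lambda>x. if Z x $ 1 \<noteq> 0 then h 1 else if Z x $ 2 \<noteq> 0 then h 2 else h 3)"
        by (auto simp: \<rho>_def)
      moreover have "\<dots> \<in> borel_measurable (lebesgue_on \<Omega>)" using Zi[of 1] Zi[of 2] by measurable
      ultimately have "(\<lambda>x. h (\<rho> x)) \<in> borel_measurable (lebesgue_on \<Omega>)" by (simp only:)
      then show ?thesis by (intro borel_measurable_inner borel_measurable_scaleR vm gm)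
    qed
    then have "integral\<^sup>L (lebesgue_on \<Omega>) (\<lambda>x. h (\<rho> x) *\<^sub>R v x \<bullet> grad \<psi> x) =
        integral\<^sup>L (lebesgue_on \<Omega>) (\<lambda>x. row_comb b (Z x) \<bullet> grad \<psi> x)"
      by (intro integral_cong_AE hm) (use rm gm in auto)
    also have "\<dots> = integral\<^sup>L (lebesgue_on \<Omega>) (\<lambda>x. (row_comb b (Z x) - sum b UNIV *\<^sub>R w x) \<bullet> grad \<psi> x + sum b UNIV * (w x \<bullet> grad \<psi> x))"
      by (simp add: inner_diff_left)
    also have "\<dots> = integral\<^sup>L (lebesgue_on \<Omega>) (\<lambda>x. (row_comb b (Z x) - sum b UNIV *\<^sub>R w x) \<bullet> grad \<psi> x)
        + sum b UNIV * integral\<^sup>L (lebesgue_on \<Omega>) (\<lambda>x. w x \<bullet> grad \<psi> x)"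
    proof -
      obtain C where C: "\<And>x. x \<in> \<Omega> \<Longrightarrow> norm (w x) \<le> C" using w(2) unfolding bounded_iff by auto
      have i1: "integrable (lebesgue_on \<Omega>) (\<lambda>x. w x \<bullet> grad \<psi> x)"
        by (rule bounded_int[OF continuous_imp_measurable_on_sets_lebesgue[OF w(1) \<Omega>m] _ gm grad_int[OF \<psi>], of C])
          (use C in \<open>auto intro!: AE_I2\<close>)
      have "AE x in lebesgue_on \<Omega>. norm (row_comb b (Z x)) \<le> (\<Sum>i\<in>UNIV. \<bar>b i\<bar>) * M"
        using ZM by eventually_elim (use norm_row_comb_le in auto)
      from bounded_int[OF rm this gm grad_int[OF \<psi>]] i1 show ?thesis by (simp add: inner_diff_left)
    qed
    also have "\<dots> = sum b UNIV * integral\<^sup>L (lebesgue_on \<Omega>) (\<lambda>x. w x \<bullet> grad \<psi> x)"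
      using orth0[OF test_function_in_W12_grad[OF \<Omega> \<psi>] grad_int[OF \<psi>], of b] by simp
    finally show ?thesis by (simp add: b_def)
  qed
  have tang: "integral\<^sup>L (lebesgue_on \<Omega>) (\<lambda>x. v x \<bullet> g x) = 0"
    if pg: "(p, g) \<in> W12_grad \<Omega>" and bd: "bounded {x \<in> \<Omega>. p x \<noteq> 0}" for p g
  proof (cases "integrable (lebesgue_on \<Omega>) (\<lambda>x. v x \<bullet> g x)")
    case True
    obtain R where R: "\<And>x. x \<in> \<Omega> \<Longrightarrow> p x \<noteq> 0 \<Longrightarrow> norm x \<le> R"
      using bd unfolding bounded_iff by blast
    \<comment> \<open>For large \<open>n\<close> the cutoff is 1 on the bounded set where
      \<open>p\<close> does not vanish, so orthogonality applies. Letting \<open>n\<close> tend to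
      infinity removes the cutoff, because \<open>v \<bullet> g\<close> is its own integrable
      majorant.\<close>
    define c where "c n = cutoff (real (Suc n))" for n
    have "0 < real (Suc n)" for n by simp
    note pc = cutoff[OF this, folded c_def]
    have "\<forall>\<^sub>F n in sequentially. integral\<^sup>L (lebesgue_on \<Omega>) (\<lambda>x. prodfn (c n) x * (v x \<bullet> g x)) = 0"
      using eventually_ge_at_top[of "nat \<lceil>R\<rceil>"]
    proof eventually_elim
      case (elim n)
      then have n: "R < real (Suc n)" by linarith
      have "integrable (lebesgue_on \<Omega>) (\<lambda>x. prodfn (c n) x * norm (g x))"
        by (rule integrable_compact_support_mult_norm[OF _ compact_cbox[of "- vec (2 * real (Suc n))" "vec (2 * real (Suc n))"] _ \<Omega>m])
          (use pg in \<open>auto intro!: prodfn_continuous pc simp: W12_grad_def\<close>)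
      moreover have "prodfn ((c n)(k := deriv (c n k))) x = 0" if "x \<in> \<Omega>" "p x \<noteq> 0" for x k
        using R[OF that] n component_le_norm_cart[of x k] by (intro pc(3)) auto
      ultimately show ?case
        using orth[OF pg, of "c n" a] pc(1)[of n] by (simp add: v_def a0)
    qed
    then have "(\<lambda>n. integral\<^sup>L (lebesgue_on \<Omega>) (\<lambda>x. prodfn (c n) x * (v x \<bullet> g x))) \<longlonglongrightarrow> 0"
      by (rule tendsto_eventually)
    moreover have "(\<lambda>n. integral\<^sup>L (lebesgue_on \<Omega>) (\<lambda>x. prodfn (c n) x * (v x \<bullet> g x))) \<longlonglongrightarrow>
        integral\<^sup>L (lebesgue_on \<Omega>) (\<lambda>x. v x \<bullet> g x)"
    proof (rule integral_dominated_convergence[where w = "\<lambda>x. \<bar>v x \<bullet> g x\<bar>"])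
      show "(\<lambda>x. v x \<bullet> g x) \<in> borel_measurable (lebesgue_on \<Omega>)" using True by simp
      show "integrable (lebesgue_on \<Omega>) (\<lambda>x. \<bar>v x \<bullet> g x\<bar>)" using True by simp
      have "prodfn (c n) \<in> borel_measurable (lebesgue_on \<Omega>)" for n
        by (rule continuous_imp_measurable_on_sets_lebesgue[OF _ \<Omega>m],
            rule continuous_on_subset[OF prodfn_continuous subset_UNIV]) (auto intro: pc)
      then show "(\<lambda>x. prodfn (c n) x * (v x \<bullet> g x)) \<in> borel_measurable (lebesgue_on \<Omega>)" for n
        using True by simp
      show "AE x in lebesgue_on \<Omega>. (\<lambda>n. prodfn (c n) x * (v x \<bullet> g x)) \<longlonglongrightarrow> v x \<bullet> g x"
      proof (rule AE_I2)
        fix x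
        have "\<forall>\<^sub>F n in sequentially. prodfn (c n) x * (v x \<bullet> g x) = v x \<bullet> g x"
          using eventually_ge_at_top[of "nat \<lceil>norm x\<rceil>"]
        proof eventually_elim
          case (elim n)
          then have "norm x \<le> real (Suc n)" by linarith
          then have "\<bar>x $ k\<bar> \<le> real (Suc n)" for k
            using component_le_norm_cart[of x k] by linarith
          then show ?case using pc(2)[of x n] by simp
        qed
        then show "(\<lambda>n. prodfn (c n) x * (v x \<bullet> g x)) \<longlonglongrightarrow> v x \<bullet> g x"
          by (rule tendsto_eventually)
      qed
      show "AE x in lebesgue_on \<Omega>. norm (prodfn (c n) x * (v x \<bullet> g x)) \<le> \<bar>v x \<bullet> g x\<bar>" for n
        using pc(5,6) by (intro AE_I2) (auto simp: abs_mult intro!: mult_left_le_one_le)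
    qed
    ultimately show ?thesis using LIMSEQ_unique by blast
  \<comment> \<open>The Bochner integral of a function that is not integrable is 0 by
    convention.\<close>
  qed (rule not_integrable_integral_eq)
  have "v \<in> H_space \<Omega>" if fin: "emeasure lebesgue \<Omega> < \<infinity>"
  proof -
    interpret finite_measure "lebesgue_on \<Omega>"
      by (rule finite_measureI) (use fin \<Omega>m in \<open>simp add: emeasure_restrict_space\<close>)
    have "integrable (lebesgue_on \<Omega>) (\<lambda>x. (norm (v x))\<^sup>2)"
    proof (rule integrable_const_bound)
      show "AE x in lebesgue_on \<Omega>. norm ((norm (v x))\<^sup>2) \<le> ((\<Sum>i\<in>UNIV. \<bar>a i\<bar>) * M)\<^sup>2"
        using vb
      proof eventually_elim
        case (elim x)
        from power_mono[OF this norm_ge_zero, of 2] show ?case by simp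
      qed
    qed (use vm in simp)
    then have "v \<in> L_two \<Omega>" using vm by (simp add: L_two_def)
    moreover have "integral\<^sup>L (lebesgue_on \<Omega>) (\<lambda>x. v x \<bullet> g x) = 0" if pg: "(p, g) \<in> W12_grad \<Omega>" for p g
    proof -
      \<comment> \<open>On a set of finite measure a square integrable gradient is integrable, so no
        cutoff and no restriction on the support of \<open>p\<close> is required.\<close>
      have "integrable (lebesgue_on \<Omega>) (\<lambda>x. norm (g x))"
        by (rule integrable_norm_of_square) (use pg in \<open>auto simp: W12_grad_def L_two_def\<close>)
      from orth0[OF pg this, of a] show ?thesis by (simp add: a0 v_def)
    qed
    ultimately show ?thesis by (auto simp: H_space_def)
  qed
  moreover have "v \<in> L_infinity \<Omega>" using vm vb by (auto simp: L_infinity_def)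
  moreover have "\<rho> \<in> L_infinity \<Omega>"
    using \<rho>m by (auto simp: L_infinity_def \<rho>_def intro!: exI[of _ 3] AE_I2)
  moreover have "\<exists>c>0. AE x in lebesgue_on \<Omega>. c \<le> \<rho> x"
    by (intro exI[of _ 1] conjI AE_I2) (auto simp: \<rho>_def)
  moreover have "div_eq \<Omega> (\<lambda>x. \<rho> x *\<^sub>R v x) (\<lambda>_. 0)"
    using solves[of _ "\<lambda>r. r"] a0 by (simp add: div_eq_def)
  moreover have "div_eq \<Omega> v (\<lambda>_. 0)"
    using solves[of _ "\<lambda>r. 1"] a0 by (simp add: div_eq_def)
  moreover have "div_eq \<Omega> (\<lambda>x. \<beta> (\<rho> x) *\<^sub>R v x) f"
    using solves[of _ \<beta>] a1 w(3) by (simp add: div_eq_def)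
  moreover have "solenoidal_tangential \<Omega> v"
    using tang by (auto simp: solenoidal_tangential_def)
  ultimately show ?thesis by blast
qed

end
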